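(* Let $n$ be a positive integer with $n \le 3$, let $\mathcal{P} \subseteq \mathbb{R}^n$ be a rational polyhedron, and let $f \colon \mathbb{R}^n \to \mathbb{R}$ be a cubic function (with real coefficients). Then $f$ is unbounded below on $\mathcal{P} \cap \mathbb{Z}^n$ if and only if there exists a ray $\mathcal{R}(y,d)$ of $\mathcal{P}$ such that, for every constant $\epsilon > 0$, $f$ is unbounded below on $\mathcal{P} \cap \mathbb{Z}^n \cap \left(\mathcal{R}(y,d) + \mathcal{B}_\epsilon\right)$.
   Context: A polyhedron is a set $\mathcal{P} = \{x \in \mathbb{R}^n : Ax \le b\}$ with $A \in \mathbb{R}^{m \times n}$, $b \in \mathbb{R}^m$; it is rational if $A \in \mathbb{Q}^{m\times n}$ and $b \in \mathbb{Q}^m$. A ray in $\mathbb{R}^n$ is a set $\mathcal{R}(y,d) = \{y + \lambda d : \lambda \ge 0\}$ with $y \in \mathbb{R}^n$ and nonzero $d \in \mathbb{R}^n$ (neither $y$ nor $d$ is required to be rational or integral). A ray of $\mathcal{P}$ is a ray fully contained in $\mathcal{P}$. $\mathcal{B}_\epsilon = \{x \in \mathbb{R}^n : \|x\| \le \epsilon\}$ (Euclidean norm), and $+$ between sets denotes the Minkowski sum. A cubic function is a polynomial function of degree three in the $n$ variables. A function $f$ is unbounded below on a set $S$ if for every $c \in \mathbb{R}$ there is $x \in S$ with $f(x) < c$, and bounded below on $S$ otherwise. *)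

theory Defs
  imports "HOL-Analysis.Analysis" "HOL-Library.Poly_Mapping" "HOL-Library.Set_Algebras"
begin

text \<open>The rows of the constraint matrix are indexed by the naturals below m, so that the number
  m of inequalities is an arbitrary natural number (possibly zero).\<close>

definition rational_polyhedron :: "(real ^ 'n) set \<Rightarrow> bool" where
  "rational_polyhedron P \<longleftrightarrow>
     (\<exists>(m::nat) (A :: nat \<Rightarrow> real ^ 'n) (b :: nat \<Rightarrow> real).
        (\<forall>i<m. (\<forall>j. A i $ j \<in> \<rat>) \<and> b i \<in> \<rat>) \<and>
        P = {x. \<forall>i<m. (\<Sum>j\<in>UNIV. A i $ j * x $ j) \<le> b i})"

definition integer_points :: "(real ^ 'n) set" where
  "integer_points = {x. \<forall>i. x $ i \<in> \<int>}"

definition ray :: "real ^ 'n \<Rightarrow> real ^ 'n \<Rightarrow> (real ^ 'n) set" where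
  "ray y d = {y + t *\<^sub>R d | t. t \<ge> 0}"

text \<open>A real polynomial in variables indexed by the type 'n is a finitely supported map from
  exponent vectors to coefficients.\<close>

type_synonym 'n real_mpoly = "('n \<Rightarrow>\<^sub>0 nat) \<Rightarrow>\<^sub>0 real"

definition eval_mpoly :: "'n::finite real_mpoly \<Rightarrow> real ^ 'n \<Rightarrow> real" where
  "eval_mpoly p x =
     (\<Sum>e\<in>Poly_Mapping.keys p.
        Poly_Mapping.lookup p e * (\<Prod>i\<in>UNIV. (x $ i) ^ Poly_Mapping.lookup e i))"

text \<open>The zero polynomial gets degree 0.\<close>

definition total_degree :: "'n::finite real_mpoly \<Rightarrow> nat" where
  "total_degree p =
     Max (insert 0 ((\<lambda>e. \<Sum>i\<in>UNIV. Poly_Mapping.lookup e i) ` Poly_Mapping.keys p))"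

definition cubic_function :: "(real ^ 'n::finite \<Rightarrow> real) \<Rightarrow> bool" where
  "cubic_function f \<longleftrightarrow> (\<exists>p. total_degree p = 3 \<and> f = eval_mpoly p)"

definition unbounded_below_on :: "('a \<Rightarrow> real) \<Rightarrow> 'a set \<Rightarrow> bool" where
  "unbounded_below_on f S \<longleftrightarrow> (\<forall>c. \<exists>x\<in>S. f x < c)"

end

theory Submission
  imports Defs "HOL-Analysis.Kronecker_Approximation_Theorem"
begin

text \<open>One direction is monotonicity. For the other, suppose that f is unbounded below on the integer points
of P but that no ray of P is as required. Three steps lead to a contradiction.

From polyhedra to cones (\<open>descending_ray_exists\<close>). For each j take an integer point of P of
least norm where f is at most -j. The slacks of the constraints are, up to a shift, natural numbers, so
after passing to a subsequence each of them is nondecreasing, and constant or divergent. Subtracting the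
first point moves the sequence into the recession cone \<open>C = {x. a i \<bullet> x \<le> 0}\<close>, and the directions of
its points x converge to a unit vector d in C. Write the translated cubic as
\<open>T x x x + B x x + L x\<close> plus a constant, with T and B symmetric and multilinear.

What the absence of rays gives. By Dirichlet's theorem every ray from an integer point y of C in a
direction D of C has integer points of C arbitrarily close to it and arbitrarily far out, and the error
can be taken tangent to the face of D. Hence the leading coefficient of the polynomial f(y + t D) in t is
never negative: \<open>T D D D \<ge> 0\<close>; if this vanishes, \<open>3 T D D y + B D D \<ge> 0\<close>; and if this vanishes too, the
remaining coefficient \<open>slope D y\<close> is nonnegative (\<open>cubic_term_nonneg\<close>, \<open>quadratic_term_nonneg\<close>,
\<open>slope_nonneg\<close>). For the limit direction, \<open>T d d d = B d d = 0\<close>. These are the only consequences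
of the absence of rays that are used: D ranges over all directions near d, and y is mostly the point x itself.

Three cases. Let S be the linear space cut out by the constraints that are tight at d; it contains d.

 \<^item> All points of the sequence lie in S (\<open>lineal_contradiction\<close>, in any dimension). Then C is a neighbourhood
   of d in S, so the conditions on D hold near d on all sides. They force f, up to terms that are dominated,
   to be \<open>slope D x \<ge> 0\<close> plus positive definite terms, where D is the projection of x to the directions
   in which both \<open>T d\<close> and B degenerate.
 \<^item> S is a line (\<open>integral_direction_contradiction\<close>, in any dimension). Then d is proportional to an integer
   vector z. Splitting x along a Hilbert basis of C shows that f(x - z) \<open>\<le>\<close> f(x) far out, against the minimality
   of the norm.
 \<^item> Otherwise S is a plane in three-dimensional space and C is a half-space near d
   (\<open>half_space_contradiction\<close>). In coordinates x = t d + s u + r v with t much larger than s and r, and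
   r tending to infinity, the conditions on D leave only finitely many sign patterns of the coefficients of f,
   and in each of them f is bounded below.

This is where the dimension enters: with four variables S can be a plane of codimension two, and C need
not be a half-space near d.\<close>

section \<open>Cubic polynomials as sums of symmetric multilinear forms\<close>

text \<open>Working with the polarised forms makes Taylor expansions along arbitrary, possibly irrational, directions
a matter of multilinearity. A common bound M on the forms is part of the structure, so that all error
estimates are uniform.\<close>

locale cubic_form =
  fixes T :: "'a::euclidean_space \<Rightarrow> 'a \<Rightarrow> 'a \<Rightarrow> real"
    and B :: "'a \<Rightarrow> 'a \<Rightarrow> real"
    and L :: "'a \<Rightarrow> real"
    and M :: real
  assumes T_swap12: "T x y z = T y x z"
    and T_swap23: "T x y z = T x z y"
    and T_add: "T (x + x') y z = T x y z + T x' y z"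
    and T_scale: "T (c *\<^sub>R x) y z = c * T x y z"
    and T_bound: "\<bar>T x y z\<bar> \<le> M * norm x * norm y * norm z"
    and B_swap: "B x y = B y x"
    and B_add: "B (x + x') y = B x y + B x' y"
    and B_scale: "B (c *\<^sub>R x) y = c * B x y"
    and B_bound: "\<bar>B x y\<bar> \<le> M * norm x * norm y"
    and L_add: "L (x + x') = L x + L x'"
    and L_scale: "L (c *\<^sub>R x) = c * L x"
    and L_bound: "\<bar>L x\<bar> \<le> M * norm x"
    and M_nonneg: "M \<ge> 0"

context cubic_form
begin

definition cubic :: "'a \<Rightarrow> real" where
  "cubic x = T x x x + B x x + L x"

lemma T_swap13: "T x y z = T z y x"
  by (metis T_swap12 T_swap23)

lemma T_add2: "T x (y + y') z = T x y z + T x y' z"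
  by (metis T_swap12 T_add)

lemma T_add3: "T x y (z + z') = T x y z + T x y z'"
  by (metis T_swap23 T_add2)

lemma T_scale2: "T x (c *\<^sub>R y) z = c * T x y z"
  by (metis T_swap12 T_scale)

lemma T_scale3: "T x y (c *\<^sub>R z) = c * T x y z"
  by (metis T_swap23 T_scale2)

lemma B_add2: "B x (y + y') = B x y + B x y'"
  by (metis B_swap B_add)

lemma B_scale2: "B x (c *\<^sub>R y) = c * B x y"
  by (metis B_swap B_scale)

lemmas form_linear = T_add T_add2 T_add3 T_scale T_scale2 T_scale3 B_add B_add2 B_scale B_scale2
  L_add L_scale

lemmas form_swap = T_swap12 T_swap23 B_swap

lemma T_minus: "T (- x) y z = - T x y z" "T x (- y) z = - T x y z" "T x y (- z) = - T x y z"
  using T_scale[of "-1" x y z] T_scale2[of x "-1" y z] T_scale3[of x y "-1" z] by auto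

lemma B_minus: "B (- x) y = - B x y" "B x (- y) = - B x y"
  using B_scale[of "-1" x y] B_scale2[of x "-1" y] by auto

lemma L_minus: "L (- x) = - L x"
  using L_scale[of "-1" x] by auto

lemma form_diff: "T (x - x') y z = T x y z - T x' y z" "T x (y - y') z = T x y z - T x y' z"
  "T x y (z - z') = T x y z - T x y z'" "B (x - x') y = B x y - B x' y"
  "B x (y - y') = B x y - B x y'" "L (x - x') = L x - L x'"
  using T_add[of x "-x'"] T_add2[of _ y "-y'"] T_add3[of _ _ z "-z'"] B_add[of x "-x'"]
    B_add2[of _ y "-y'"] L_add[of x "-x'"] by (simp_all add: T_minus B_minus L_minus)

lemma form_zero [simp]: "T 0 y z = 0" "T x 0 z = 0" "T x y 0 = 0" "B 0 y = 0" "B x 0 = 0" "L 0 = 0"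
  using form_linear(4,5,6)[where c=0] B_scale[of 0] B_scale2[of _ 0] L_scale[of 0] by auto

text \<open>The coefficient of t in f(y + t d); it is what decides about the ray once the coefficients of t^3 and t^2
vanish.\<close>

definition slope :: "'a \<Rightarrow> 'a \<Rightarrow> real" where
  "slope d y = 3 * T d y y + 2 * B d y + L d"

lemma cubic_add_scaled:
  "cubic (y + t *\<^sub>R d) = t ^ 3 * T d d d + t\<^sup>2 * (3 * T d d y + B d d) + t * slope d y + cubic y"
  unfolding cubic_def slope_def
  by (simp add: form_linear power2_eq_square power3_eq_cube algebra_simps form_swap)

lemma cubic_bound:
  assumes "norm x \<le> r" "r \<ge> 0"
  shows "\<bar>cubic x\<bar> \<le> M * r ^ 3 + M * r\<^sup>2 + M * r"
proof -
  have "\<bar>T x x x\<bar> \<le> M * r ^ 3"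
    by (rule order_trans[OF T_bound])
      (use assms M_nonneg in \<open>auto simp: power3_eq_cube mult.assoc intro!: mult_left_mono mult_mono\<close>)
  moreover have "\<bar>B x x\<bar> \<le> M * r\<^sup>2"
    by (rule order_trans[OF B_bound])
      (use assms M_nonneg in \<open>auto simp: power2_eq_square mult.assoc intro!: mult_left_mono mult_mono\<close>)
  moreover have "\<bar>L x\<bar> \<le> M * r"
    by (rule order_trans[OF L_bound]) (use assms M_nonneg in \<open>auto intro!: mult_left_mono\<close>)
  ultimately show ?thesis unfolding cubic_def by linarith
qed

lemma bounded_linear_T: "bounded_linear (\<lambda>x. T x y z)"
  by (rule bounded_linear_intro[where K="M * norm y * norm z"])
    (use T_bound[of _ y z] in \<open>auto simp: T_add T_scale mult_ac\<close>)

lemma bounded_linear_B: "bounded_linear (\<lambda>x. B x y)"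
  by (rule bounded_linear_intro[where K="M * norm y"])
    (use B_bound[of _ y] in \<open>auto simp: B_add B_scale mult_ac\<close>)

lemma bounded_bilinear_T: "bounded_bilinear (T d)"
  by (rule bounded_bilinear.intro)
   (auto simp: form_linear intro!: exI[of _ "M * norm d"] order_trans[OF T_bound] simp: mult_ac)

lemma bounded_bilinear_B: "bounded_bilinear B"
  by (rule bounded_bilinear.intro)
   (auto simp: form_linear intro!: exI[of _ "M"] order_trans[OF B_bound] simp: mult_ac)

lemma tendsto_T:
  assumes "(x \<longlongrightarrow> a) F" "(y \<longlongrightarrow> b) F" "(z \<longlongrightarrow> c) F"
  shows "((\<lambda>j. T (x j) (y j) (z j)) \<longlongrightarrow> T a b c) F"
proof -
  have 1: "((\<lambda>j. T a (y j) (z j)) \<longlongrightarrow> T a b c) F"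
    by (rule bounded_bilinear.tendsto[OF bounded_bilinear_T assms(2,3)])
  have 2: "((\<lambda>j. T (x j - a) (y j) (z j)) \<longlongrightarrow> 0) F"
  proof (rule tendsto_rabs_zero_cancel, rule tendsto_sandwich[OF _ _ tendsto_const])
    show "\<forall>\<^sub>F j in F. \<bar>T (x j - a) (y j) (z j)\<bar> \<le> M * norm (x j - a) * norm (y j) * norm (z j)"
      using T_bound by simp
    have "((\<lambda>j. M * norm (x j - a) * norm (y j) * norm (z j)) \<longlongrightarrow> M * norm (a - a) * norm b * norm c) F"
      by (intro tendsto_intros assms)
    then show "((\<lambda>j. M * norm (x j - a) * norm (y j) * norm (z j)) \<longlongrightarrow> 0) F" by simp
  qed simp
  show ?thesis using tendsto_add[OF 1 2] by (simp add: form_diff)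
qed

lemma tendsto_B:
  assumes "(x \<longlongrightarrow> a) F" "(y \<longlongrightarrow> b) F"
  shows "((\<lambda>j. B (x j) (y j)) \<longlongrightarrow> B a b) F"
  by (rule bounded_bilinear.tendsto[OF bounded_bilinear_B assms])

end

text \<open>Polynomials of total degree at most three, without reference to coordinates.\<close>

definition cubic_polynomial :: "('a::euclidean_space \<Rightarrow> real) \<Rightarrow> bool" where
  "cubic_polynomial f \<longleftrightarrow> (\<exists>T B L M k. cubic_form T B L M \<and> (\<forall>x. f x = cubic_form.cubic T B L x + k))"

lemma cubic_polynomialI:
  assumes "cubic_form T B L M" "\<And>x. f x = T x x x + B x x + L x + k"
  shows "cubic_polynomial f"
  unfolding cubic_polynomial_def using assms cubic_form.cubic_def[OF assms(1)] by metis

lemma cubic_polynomial_add: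
  assumes "cubic_polynomial f" "cubic_polynomial g"
  shows "cubic_polynomial (\<lambda>x. f x + g x)"
proof -
  obtain T B L M k where f: "cubic_form T B L M" "\<And>x. f x = cubic_form.cubic T B L x + k"
    using assms(1) unfolding cubic_polynomial_def by blast
  obtain T' B' L' M' k' where g: "cubic_form T' B' L' M'" "\<And>x. g x = cubic_form.cubic T' B' L' x + k'"
    using assms(2) unfolding cubic_polynomial_def by blast
  interpret f: cubic_form T B L M by fact
  interpret g: cubic_form T' B' L' M' by fact
  show ?thesis
  proof (rule cubic_polynomialI)
    show "cubic_form (\<lambda>x y z. T x y z + T' x y z) (\<lambda>x y. B x y + B' x y) (\<lambda>x. L x + L' x) (M + M')"
    proof
      show "\<bar>T x y z + T' x y z\<bar> \<le> (M + M') * norm x * norm y * norm z" for x y z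
        using f.T_bound[of x y z] g.T_bound[of x y z] by (simp add: algebra_simps)
      show "\<bar>B x y + B' x y\<bar> \<le> (M + M') * norm x * norm y" for x y
        using f.B_bound[of x y] g.B_bound[of x y] by (simp add: algebra_simps)
      show "\<bar>L x + L' x\<bar> \<le> (M + M') * norm x" for x
        using f.L_bound[of x] g.L_bound[of x] by (simp add: algebra_simps)
      show "T x y z + T' x y z = T y x z + T' y x z" for x y z
        using f.T_swap12 g.T_swap12 by metis
      show "T x y z + T' x y z = T x z y + T' x z y" for x y z
        using f.T_swap23 g.T_swap23 by metis
      show "B x y + B' x y = B y x + B' y x" for x y
        using f.B_swap g.B_swap by metis
      show "0 \<le> M + M'" using f.M_nonneg g.M_nonneg by simp
    qed (simp_all add: f.form_linear g.form_linear algebra_simps)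
    show "f x + g x = T x x x + T' x x x + (B x x + B' x x) + (L x + L' x) + (k + k')" for x
      by (simp add: f g f.cubic_def g.cubic_def)
  qed
qed

lemma cubic_polynomial_scale:
  assumes "cubic_polynomial f"
  shows "cubic_polynomial (\<lambda>x. c * f x)"
proof -
  obtain T B L M k where f: "cubic_form T B L M" "\<And>x. f x = cubic_form.cubic T B L x + k"
    using assms(1) unfolding cubic_polynomial_def by blast
  interpret f: cubic_form T B L M by fact
  show ?thesis
  proof (rule cubic_polynomialI)
    show "cubic_form (\<lambda>x y z. c * T x y z) (\<lambda>x y. c * B x y) (\<lambda>x. c * L x) (\<bar>c\<bar> * M)"
    proof
      show "\<bar>c * T x y z\<bar> \<le> (\<bar>c\<bar> * M) * norm x * norm y * norm z" for x y z
        using mult_left_mono[OF f.T_bound[of x y z], of "\<bar>c\<bar>"] by (simp add: abs_mult mult_ac)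
      show "\<bar>c * B x y\<bar> \<le> (\<bar>c\<bar> * M) * norm x * norm y" for x y
        using mult_left_mono[OF f.B_bound[of x y], of "\<bar>c\<bar>"] by (simp add: abs_mult mult_ac)
      show "\<bar>c * L x\<bar> \<le> (\<bar>c\<bar> * M) * norm x" for x
        using mult_left_mono[OF f.L_bound[of x], of "\<bar>c\<bar>"] by (simp add: abs_mult mult_ac)
      show "c * T x y z = c * T y x z" for x y z
        using f.T_swap12 by metis
      show "c * T x y z = c * T x z y" for x y z
        using f.T_swap23 by metis
      show "c * B x y = c * B y x" for x y
        using f.B_swap by metis
      show "0 \<le> \<bar>c\<bar> * M" using f.M_nonneg by simp
    qed (simp_all add: f.form_linear algebra_simps)
    show "c * f x = c * T x x x + c * B x x + c * L x + c * k" for x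
      by (simp add: f f.cubic_def algebra_simps)
  qed
qed

lemma cubic_polynomial_const: "cubic_polynomial (\<lambda>x. c)"
  by (rule cubic_polynomialI[of "\<lambda>_ _ _. 0" "\<lambda>_ _. 0" "\<lambda>_. 0" 0 _ c]) (auto intro!: cubic_form.intro)

lemma cubic_polynomial_sum:
  assumes "\<And>i. i \<in> I \<Longrightarrow> cubic_polynomial (f i)"
  shows "cubic_polynomial (\<lambda>x. \<Sum>i\<in>I. f i x)"
  using assms by (induction I rule: infinite_finite_induct)
    (auto intro: cubic_polynomial_add cubic_polynomial_const)

lemma cubic_polynomial_linear:
  fixes l :: "'a::euclidean_space \<Rightarrow> real"
  assumes "bounded_linear l"
  shows "cubic_polynomial l"
proof -
  interpret l: bounded_linear l by fact
  obtain K where K: "K \<ge> 0" "\<And>x. norm (l x) \<le> norm x * K" using l.nonneg_bounded by blast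
  show ?thesis
    by (rule cubic_polynomialI[of "\<lambda>_ _ _. 0" "\<lambda>_ _. 0" l K _ 0])
     (use K in \<open>auto intro!: cubic_form.intro simp: l.add l.scaleR mult_ac\<close>)
qed

lemma cubic_polynomial_linear_mult2:
  fixes l :: "'a::euclidean_space \<Rightarrow> real"
  assumes "bounded_linear l" "bounded_linear l'"
  shows "cubic_polynomial (\<lambda>x. l x * l' x)"
proof -
  interpret l: bounded_linear l by fact
  interpret l': bounded_linear l' by fact
  obtain K where K: "K \<ge> 0" "\<And>x. \<bar>l x\<bar> \<le> norm x * K" using l.nonneg_bounded by auto
  obtain K' where K': "K' \<ge> 0" "\<And>x. \<bar>l' x\<bar> \<le> norm x * K'" using l'.nonneg_bounded by auto
  have bd: "\<bar>l x * l' y\<bar> \<le> K * K' * norm x * norm y" for x y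
    using mult_mono[OF K(2)[of x] K'(2)[of y]] K(1) by (simp add: abs_mult mult_ac)
  show ?thesis
  proof (rule cubic_polynomialI[of "\<lambda>_ _ _. 0" "\<lambda>x y. (l x * l' y + l y * l' x)/2" "\<lambda>_. 0" "K * K'" _ 0])
    show "cubic_form (\<lambda>_ _ _. 0) (\<lambda>x y. (l x * l' y + l y * l' x) / 2) (\<lambda>_. 0) (K * K')"
    proof
      show "\<bar>(l x * l' y + l y * l' x) / 2\<bar> \<le> K * K' * norm x * norm y" for x y
        using bd[of x y] bd[of y x] by (simp add: mult_ac)
    qed (use K K' in \<open>auto simp: l.add l.scaleR l'.add l'.scaleR field_simps\<close>)
  qed auto
qed

lemma cubic_polynomial_linear_mult3:
  fixes l :: "'a::euclidean_space \<Rightarrow> real"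
  assumes "bounded_linear l" "bounded_linear l'" "bounded_linear l''"
  shows "cubic_polynomial (\<lambda>x. l x * l' x * l'' x)"
proof -
  interpret l: bounded_linear l by fact
  interpret l': bounded_linear l' by fact
  interpret l'': bounded_linear l'' by fact
  obtain K where K: "K \<ge> 0" "\<And>x. \<bar>l x\<bar> \<le> norm x * K" using l.nonneg_bounded by auto
  obtain K' where K': "K' \<ge> 0" "\<And>x. \<bar>l' x\<bar> \<le> norm x * K'" using l'.nonneg_bounded by auto
  obtain K'' where K'': "K'' \<ge> 0" "\<And>x. \<bar>l'' x\<bar> \<le> norm x * K''" using l''.nonneg_bounded by auto
  have bd: "\<bar>l x * l' y * l'' z\<bar> \<le> K * K' * K'' * norm x * norm y * norm z" for x y z
    using mult_mono[OF mult_mono[OF K(2)[of x] K'(2)[of y]] K''(2)[of z]] K(1) K'(1)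
    by (simp add: abs_mult mult_ac)
  show ?thesis
  proof (rule cubic_polynomialI[of "\<lambda>x y z. (l x * l' y * l'' z + l x * l' z * l'' y + l y * l' x * l'' z
    + l y * l' z * l'' x + l z * l' x * l'' y + l z * l' y * l'' x) / 6" "\<lambda>_ _. 0" "\<lambda>_. 0" "K * K' * K''" _ 0])
    show "cubic_form (\<lambda>x y z. (l x * l' y * l'' z + l x * l' z * l'' y + l y * l' x * l'' z
    + l y * l' z * l'' x + l z * l' x * l'' y + l z * l' y * l'' x) / 6) (\<lambda>_ _. 0) (\<lambda>_. 0) (K * K' * K'')"
    proof
      show "\<bar>(l x * l' y * l'' z + l x * l' z * l'' y + l y * l' x * l'' z
        + l y * l' z * l'' x + l z * l' x * l'' y + l z * l' y * l'' x) / 6\<bar>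
        \<le> K * K' * K'' * norm x * norm y * norm z" for x y z
        using bd[of x y z] bd[of x z y] bd[of y x z] bd[of y z x] bd[of z x y] bd[of z y x]
        by (simp add: mult_ac)
    qed (use K K' K'' in \<open>auto simp: l.add l.scaleR l'.add l'.scaleR l''.add l''.scaleR field_simps\<close>)
  qed auto
qed

lemma cubic_polynomial_translate:
  assumes "cubic_polynomial f"
  shows "cubic_polynomial (\<lambda>x. f (a + x))"
proof -
  obtain T B L M k where f: "cubic_form T B L M" "\<And>x. f x = cubic_form.cubic T B L x + k"
    using assms(1) unfolding cubic_polynomial_def by blast
  interpret f: cubic_form T B L M by fact
  have 1: "cubic_polynomial (\<lambda>x. f.cubic x)"
    by (rule cubic_polynomialI[OF f(1), of _ 0]) (simp add: f.cubic_def)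
  have 2: "cubic_polynomial (\<lambda>x. 3 * T a x x)"
  proof (rule cubic_polynomialI[where T="\<lambda>_ _ _. 0" and B="\<lambda>x y. 3 * T a x y" and L="\<lambda>_. 0" and M="3 * (M * norm a)" and k=0])
    show "cubic_form (\<lambda>_ _ _. 0) (\<lambda>x y. 3 * T a x y) (\<lambda>_. 0) (3 * (M * norm a))"
      using f.M_nonneg f.T_bound[of a] 
      by unfold_locales (auto simp: f.form_linear abs_mult mult_ac f.T_swap23)
  qed simp
  have 3: "cubic_polynomial (\<lambda>x. 3 * T x a a)"
    by (rule cubic_polynomial_scale[OF cubic_polynomial_linear[OF f.bounded_linear_T]])
  have 4: "cubic_polynomial (\<lambda>x. 2 * B x a)"
    by (rule cubic_polynomial_scale[OF cubic_polynomial_linear[OF f.bounded_linear_B]])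
  have eq: "f (a + x) = (f.cubic x + (3 * T a x x + (3 * T x a a + 2 * B x a))) + (f.cubic a + k)" for x
    by (simp add: f(2) f.cubic_def f.form_linear f.T_swap12 f.T_swap23 f.B_swap[of a x])
  show ?thesis unfolding eq
    by (intro cubic_polynomial_add 1 2 3 4 cubic_polynomial_const)
qed

text \<open>A monomial of degree n is a product of n linear forms; for n at most three these can then be
symmetrised.\<close>

lemma monomial_cases:
  fixes e :: "'n::finite \<Rightarrow> nat"
  assumes "(\<Sum>i\<in>UNIV. e i) = n"
  shows "\<exists>is. length is = n \<and> (\<forall>x::'n \<Rightarrow> real. (\<Prod>i\<in>UNIV. x i ^ e i) = prod_list (map x is))"
  using assms
proof (induction n arbitrary: e)
  case 0
  then show ?case by (intro exI[of _ "[]"]) simp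
next
  case (Suc n)
  then obtain i where i: "e i > 0" by (metis not_gr_zero sum.neutral nat.distinct(1))
  define e' where "e' = e(i := e i - 1)"
  have s: "(\<Sum>j\<in>UNIV. e j) = e i + (\<Sum>j\<in>UNIV-{i}. e j)" for e :: "'n \<Rightarrow> nat"
    by (simp add: sum.remove[of UNIV i])
  have p: "(\<Prod>j\<in>UNIV. x j ^ e j) = x i ^ e i * (\<Prod>j\<in>UNIV-{i}. x j ^ e j)" for x :: "'n \<Rightarrow> real" and e
    by (simp add: prod.remove[of UNIV i])
  have "(\<Sum>j\<in>UNIV. e' j) = n"
    using Suc.prems i unfolding s[of e] s[of e'] by (simp add: e'_def)
  from Suc.IH[OF this] obtain is' where is': "length is' = n"
    "\<And>x::'n \<Rightarrow> real. (\<Prod>i\<in>UNIV. x i ^ e' i) = prod_list (map x is')" by blast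
  have "(\<Prod>j\<in>UNIV. x j ^ e j) = x i * (\<Prod>j\<in>UNIV. x j ^ e' j)" for x :: "'n \<Rightarrow> real"
    unfolding p[of x e] p[of x e'] using i by (simp add: e'_def power_eq_if)
  then show ?case using is' by (intro exI[of _ "i # is'"]) simp
qed

lemma cubic_polynomial_eval_mpoly:
  fixes p :: "'n::finite real_mpoly"
  assumes "total_degree p \<le> 3"
  shows "cubic_polynomial (eval_mpoly p)"
proof -
  have "cubic_polynomial (\<lambda>x. Poly_Mapping.lookup p e * (\<Prod>i\<in>UNIV. (x $ i) ^ Poly_Mapping.lookup e i))"
    if e: "e \<in> Poly_Mapping.keys p" for e
  proof (rule cubic_polynomial_scale)
    have lin: "bounded_linear (\<lambda>x. x $ i)" for i :: 'n by (rule bounded_linear_vec_nth)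
    define n where "n = (\<Sum>i\<in>UNIV. Poly_Mapping.lookup e i)"
    have "n \<le> total_degree p"
      unfolding total_degree_def n_def using e by (intro Max_ge) auto
    then have n: "n \<le> 3" using assms by simp
    obtain "is" where is_len: "length is = n" and prod_eq:
      "\<And>x :: 'n \<Rightarrow> real. (\<Prod>i\<in>UNIV. x i ^ Poly_Mapping.lookup e i) = prod_list (map x is)"
      using monomial_cases[of "Poly_Mapping.lookup e" n] n_def by blast
    consider "is = []" | i where "is = [i]" | i j where "is = [i, j]" | i j k where "is = [i, j, k]"
    proof -
      have "n = 0 \<or> n = 1 \<or> n = 2 \<or> n = 3" using n by linarith
      then show thesis using is_len that
        by (auto simp: length_Suc_conv numeral_2_eq_2 numeral_3_eq_3)
    qed
    then show "cubic_polynomial (\<lambda>x. \<Prod>i\<in>UNIV. (x $ i) ^ Poly_Mapping.lookup e i)"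
      unfolding prod_eq[of "\<lambda>i. _ $ i"]
    proof cases
      case (4 i j k)
      then show "cubic_polynomial (\<lambda>x. prod_list (map (($) x) is))"
        using cubic_polynomial_linear_mult3[OF lin[of i] lin[of j] lin[of k]]
        by (simp add: mult.assoc)
    qed (auto intro: cubic_polynomial_const cubic_polynomial_linear[OF lin]
        cubic_polynomial_linear_mult2[OF lin lin])
  qed
  then show ?thesis
    unfolding eval_mpoly_def[abs_def] by (rule cubic_polynomial_sum)
qed

section \<open>Integer points near the rays of a rational cone\<close>

lemma integer_points_0 [simp]: "0 \<in> integer_points"
  and integer_points_add: "x \<in> integer_points \<Longrightarrow> y \<in> integer_points \<Longrightarrow> x + y \<in> integer_points"
  and integer_points_diff: "x \<in> integer_points \<Longrightarrow> y \<in> integer_points \<Longrightarrow> x - y \<in> integer_points"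
  by (auto simp: integer_points_def)

lemma integer_points_inner: "x \<in> integer_points \<Longrightarrow> y \<in> integer_points \<Longrightarrow> x \<bullet> y \<in> \<int>"
  unfolding integer_points_def inner_vec_def by (auto intro!: Ints_sum)

text \<open>Dirichlet's simultaneous approximation theorem, applied to a multiple of d so that t also exceeds any
prescribed bound.\<close>

lemma integer_point_near_multiple:
  fixes d :: "real ^ 'n"
  assumes "\<eta> > 0"
  obtains t z where "t \<ge> R" "z \<in> integer_points" "norm (z - t *\<^sub>R d) < \<eta>"
proof -
  define n where "n = CARD('n)"
  obtain h where h: "bij_betw h {0..<n} (UNIV :: 'n set)"
    using ex_bij_betw_nat_finite[of "UNIV :: 'n set"] unfolding n_def by auto
  obtain N :: nat where N: "real n / \<eta> < real N" using reals_Archimedean2 by blast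
  then have N0: "N > 0" using assms by (cases N) (auto simp: field_simps)
  define R' where "R' = max R 1"
  obtain q p where q: "0 < q" and
    qp: "\<And>i. i < n \<Longrightarrow> \<bar>of_int q * (R' * d $ h i) - of_int (p i)\<bar> < 1 / N"
    using Dirichlet_approx_simult[OF N0, of n "\<lambda>i. R' * d $ h i"] by metis
  define z :: "real ^ 'n" where "z = (\<chi> j. of_int (p (inv_into {0..<n} h j)))"
  define t where "t = of_int q * R'"
  have comp: "\<bar>(z - t *\<^sub>R d) $ j\<bar> < 1 / N" for j
  proof -
    define i where "i = inv_into {0..<n} h j"
    have "j \<in> h ` {0..<n}" using h by (simp add: bij_betw_def)
    then have i: "i < n" "h i = j"
      unfolding i_def using inv_into_into[of j h "{0..<n}"] f_inv_into_f[of j h "{0..<n}"] by auto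
    show ?thesis using qp[OF i(1)] i(2)
      by (simp add: z_def t_def i_def[symmetric] abs_minus_commute mult.assoc)
  qed
  show thesis
  proof
    show "t \<ge> R"
    proof -
      have "real_of_int q \<ge> 1" using q by linarith
      then have "real_of_int q * R' \<ge> 1 * R'" unfolding R'_def by (intro mult_right_mono) auto
      then show ?thesis unfolding t_def R'_def by linarith
    qed
    show "z \<in> integer_points" by (simp add: integer_points_def z_def)
    have "norm (z - t *\<^sub>R d) \<le> (\<Sum>j\<in>UNIV. \<bar>(z - t *\<^sub>R d) $ j\<bar>)" by (rule norm_le_l1_cart)
    also have "\<dots> \<le> (\<Sum>j\<in>(UNIV::'n set). 1 / N)"
      using comp by (intro sum_mono) (simp add: less_imp_le)
    also have "\<dots> = n / N" by (simp add: n_def)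
    also have "\<dots> < \<eta>" using N N0 assms by (simp add: field_simps)
    finally show "norm (z - t *\<^sub>R d) < \<eta>" .
  qed
qed

definition poly_cone :: "(nat \<Rightarrow> 'a::euclidean_space) \<Rightarrow> nat \<Rightarrow> 'a set" where
  "poly_cone a m = {x. \<forall>i<m. a i \<bullet> x \<le> 0}"

text \<open>The tangent cone at d, cut out by the constraints that are tight at d, and its lineality space.\<close>

definition tangent :: "(nat \<Rightarrow> 'a::euclidean_space) \<Rightarrow> nat \<Rightarrow> 'a \<Rightarrow> 'a set" where
  "tangent a m d = {w. \<forall>i<m. a i \<bullet> d = 0 \<longrightarrow> a i \<bullet> w \<le> 0}"

definition lineal :: "(nat \<Rightarrow> 'a::euclidean_space) \<Rightarrow> nat \<Rightarrow> 'a \<Rightarrow> 'a set" where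
  "lineal a m d = {w. \<forall>i<m. a i \<bullet> d = 0 \<longrightarrow> a i \<bullet> w = 0}"

lemma poly_cone_0 [simp]: "0 \<in> poly_cone a m"
  by (simp add: poly_cone_def)

lemma poly_cone_add: "x \<in> poly_cone a m \<Longrightarrow> y \<in> poly_cone a m \<Longrightarrow> x + y \<in> poly_cone a m"
  by (force simp: poly_cone_def inner_add_right)

lemma poly_cone_scale: "x \<in> poly_cone a m \<Longrightarrow> c \<ge> 0 \<Longrightarrow> c *\<^sub>R x \<in> poly_cone a m"
  by (auto simp: poly_cone_def mult_nonneg_nonpos)

lemma subspace_lineal: "subspace (lineal a m d)"
  by (auto simp: subspace_def lineal_def inner_add_right)

lemma lineal_self: "d \<in> lineal a m d"
  by (simp add: lineal_def)

lemma lineal_tangent: "w \<in> lineal a m d \<Longrightarrow> w \<in> tangent a m d"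
  by (simp add: tangent_def lineal_def)

lemma poly_cone_tangent: "w \<in> poly_cone a m \<Longrightarrow> w \<in> tangent a m d"
  by (simp add: tangent_def poly_cone_def)

lemma tangent_scale: "w \<in> tangent a m d \<Longrightarrow> c \<ge> 0 \<Longrightarrow> c *\<^sub>R w \<in> tangent a m d"
  by (auto simp: tangent_def mult_nonneg_nonpos)

text \<open>The constraints that are not tight at d have positive slack there, so only the tight ones matter near d.\<close>

lemma poly_cone_tangent_nbhd:
  assumes "d \<in> poly_cone a m"
  obtains \<eta> where "\<eta> > 0" "\<And>w. norm w \<le> \<eta> \<Longrightarrow> w \<in> tangent a m d \<Longrightarrow> d + w \<in> poly_cone a m"
proof -
  define I where "I = {i. i < m \<and> a i \<bullet> d < 0}"
  define \<eta> where "\<eta> = Min (insert 1 ((\<lambda>i. - (a i \<bullet> d) / (norm (a i) + 1)) ` I))"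
  have fin: "finite I" by (simp add: I_def)
  have pos: "norm (a i) + 1 > 0" for i using norm_ge_zero[of "a i"] by linarith
  have "\<eta> > 0" unfolding \<eta>_def using fin pos by (subst Min_gr_iff) (auto simp: I_def intro!: divide_neg_pos)
  moreover have "d + w \<in> poly_cone a m" if w: "norm w \<le> \<eta>" "w \<in> tangent a m d" for w
    unfolding poly_cone_def
  proof (intro CollectI allI impI)
    fix i assume i: "i < m"
    show "a i \<bullet> (d + w) \<le> 0"
    proof (cases "a i \<bullet> d = 0")
      case True
      then show ?thesis using i w by (simp add: tangent_def inner_add_right)
    next
      case False
      then have "i \<in> I" using assms i by (force simp: poly_cone_def I_def)
      then have "\<eta> \<le> - (a i \<bullet> d) / (norm (a i) + 1)" unfolding \<eta>_def using fin by auto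
      then have "norm w * (norm (a i) + 1) \<le> - (a i \<bullet> d)"
        using w(1) pos[of i] by (meson order_trans pos_le_divide_eq)
      moreover have "a i \<bullet> w \<le> norm w * (norm (a i) + 1)"
        using norm_cauchy_schwarz[of "a i" w] by (simp add: algebra_simps add_increasing)
      ultimately show ?thesis by (simp add: inner_add_right)
    qed
  qed
  ultimately show thesis using that by blast
qed

text \<open>The error of a good approximation is orthogonal to the normals that are tight at d: the inner product is
an integer, because the normal is an integer vector and its inner product with d vanishes, and it is
smaller than one. So the approximant violates no tight constraint, and it satisfies the others far out.\<close>

lemma integer_point_near_cone_ray:
  fixes a :: "nat \<Rightarrow> real ^ 'n"
  assumes "\<And>i. i < m \<Longrightarrow> a i \<in> integer_points" and d: "d \<in> poly_cone a m" and "\<eta> > 0"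
  obtains t \<delta> where "t \<ge> R" "norm \<delta> \<le> \<eta>" "\<delta> \<in> lineal a m d" "t *\<^sub>R d + \<delta> \<in> integer_points"
    "t *\<^sub>R d + \<delta> \<in> poly_cone a m"
proof -
  obtain \<eta>' where \<eta>': "\<eta>' > 0" "\<And>w. norm w \<le> \<eta>' \<Longrightarrow> w \<in> tangent a m d \<Longrightarrow> d + w \<in> poly_cone a m"
    using poly_cone_tangent_nbhd[OF d] by blast
  define A where "A = (\<Sum>i<m. norm (a i)) + 1"
  have A: "A \<ge> 1" unfolding A_def by (simp add: sum_nonneg)
  have nA: "norm (a i) < A" if "i < m" for i
    unfolding A_def using member_le_sum[of i "{..<m}" "\<lambda>i. norm (a i)"] that by auto
  define \<epsilon> where "\<epsilon> = min \<eta> (min \<eta>' (1 / A))"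
  have \<epsilon>: "\<epsilon> > 0" using assms(3) \<eta>'(1) A by (simp add: \<epsilon>_def)
  obtain t z where t: "t \<ge> max R 1" and z: "z \<in> integer_points" "norm (z - t *\<^sub>R d) < \<epsilon>"
    using integer_point_near_multiple[OF \<epsilon>] by blast
  define \<delta> where "\<delta> = z - t *\<^sub>R d"
  have lin: "\<delta> \<in> lineal a m d" unfolding lineal_def
  proof (intro CollectI allI impI)
    fix i assume i: "i < m" "a i \<bullet> d = 0"
    have "a i \<bullet> \<delta> = a i \<bullet> z" using i by (simp add: \<delta>_def inner_diff_right)
    then have int: "a i \<bullet> \<delta> \<in> \<int>" using integer_points_inner[OF assms(1)[OF i(1)] z(1)] by simp
    have "\<bar>a i \<bullet> \<delta>\<bar> \<le> norm (a i) * norm \<delta>" by (rule Cauchy_Schwarz_ineq2)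
    also have "\<dots> \<le> norm (a i) * (1 / A)"
      using z(2) by (intro mult_left_mono) (auto simp: \<delta>_def \<epsilon>_def)
    also have "\<dots> < 1" using nA[OF i(1)] A by (simp add: field_simps)
    finally show "a i \<bullet> \<delta> = 0" using int by (metis Ints_nonzero_abs_less1)
  qed
  have nd: "norm \<delta> \<le> \<eta>" "norm \<delta> \<le> \<eta>'" using z(2) by (auto simp: \<delta>_def \<epsilon>_def)
  have "norm ((1 / t) *\<^sub>R \<delta>) \<le> norm \<delta>"
    using t by (simp add: divide_le_eq mult_right_le_one_le) (metis le_numeral_extra(4) mult_le_cancel_left1 norm_ge_zero not_less)
  then have "d + (1 / t) *\<^sub>R \<delta> \<in> poly_cone a m"
    using nd t by (intro \<eta>'(2) tangent_scale lineal_tangent[OF lin]) auto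
  then have "t *\<^sub>R (d + (1 / t) *\<^sub>R \<delta>) \<in> poly_cone a m" using t by (intro poly_cone_scale) auto
  then have "t *\<^sub>R d + \<delta> \<in> poly_cone a m" using t by (simp add: scaleR_add_right)
  then show thesis using that[of t \<delta>] t nd lin z by (simp add: \<delta>_def)
qed

definition has_descending_ray :: "(real ^ 'n \<Rightarrow> real) \<Rightarrow> (real ^ 'n) set \<Rightarrow> bool" where
  "has_descending_ray f P \<longleftrightarrow> (\<exists>y d. d \<noteq> 0 \<and> ray y d \<subseteq> P \<and>
      (\<forall>\<epsilon>>0. unbounded_below_on f (P \<inter> integer_points \<inter> (ray y d + cball 0 \<epsilon>))))"

section \<open>Cubics without descending rays\<close>

lemma eventually_linear_below:
  fixes a :: real
  assumes "a < 0"
  shows "eventually (\<lambda>t. t * a + b < c) at_top"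
proof -
  have "(\<lambda>t. t * a + b < c) = (\<lambda>t. t > (c - b) / a)"
    using assms by (auto simp: fun_eq_iff field_simps)
  then show ?thesis using eventually_gt_at_top by simp
qed

lemma eventually_quadratic_below:
  fixes a :: real
  assumes "a < 0"
  shows "eventually (\<lambda>t. t\<^sup>2 * a + t * b + e < c) at_top"
  using eventually_linear_below[OF assms, of b "-1"] eventually_gt_at_top[of "\<bar>e - c\<bar>"]
proof eventually_elim
  case (elim t)
  then have "t * (t * a + b) \<le> t * (- 1)" by (intro mult_left_mono) auto
  then show ?case using elim by (simp add: power2_eq_square algebra_simps)
qed

lemma eventually_cubic_below:
  fixes a :: real
  assumes "a < 0"
  shows "eventually (\<lambda>t. t ^ 3 * a + t\<^sup>2 * b + t * e + g < c) at_top"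
  using eventually_quadratic_below[OF assms, of b e "-1"] eventually_gt_at_top[of "\<bar>g - c\<bar>"]
proof eventually_elim
  case (elim t)
  then have "t * (t\<^sup>2 * a + t * b + e) \<le> t * (- 1)" by (intro mult_left_mono) auto
  then show ?case using elim by (simp add: power2_eq_square power3_eq_cube algebra_simps)
qed

text \<open>The first-order condition at a boundary minimum of a cubic.\<close>

lemma first_order_nonneg:
  fixes a b c \<eta> :: real
  assumes "\<eta> > 0" "\<And>e. 0 < e \<Longrightarrow> e \<le> \<eta> \<Longrightarrow> e * a + e\<^sup>2 * b + e ^ 3 * c \<ge> 0"
  shows "a \<ge> 0"
proof (rule tendsto_lowerbound)
  have "((\<lambda>e. a + e * b + e\<^sup>2 * c) \<longlongrightarrow> a + 0 * b + 0\<^sup>2 * c) (at_right 0)"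
    by (intro tendsto_intros)
  then show "((\<lambda>e. a + e * b + e\<^sup>2 * c) \<longlongrightarrow> a) (at_right 0)" by simp
  show "\<forall>\<^sub>F e in at_right 0. 0 \<le> a + e * b + e\<^sup>2 * c"
    unfolding eventually_at_right_field
  proof (intro exI[of _ \<eta>] conjI allI impI)
    fix e assume e: "0 < e" "e < \<eta>"
    have "0 \<le> e * (a + e * b + e\<^sup>2 * c)"
      using assms(2)[of e] e by (simp add: power2_eq_square power3_eq_cube algebra_simps)
    then show "0 \<le> a + e * b + e\<^sup>2 * c" using e by (simp add: zero_le_mult_iff)
  qed (use assms in auto)
qed simp

text \<open>The constant term of the cubic is immaterial for boundedness and is left out.\<close>

locale rayless_cubic = cubic_form T B L M
  for T :: "real ^ 'n \<Rightarrow> real ^ 'n \<Rightarrow> real ^ 'n \<Rightarrow> real" and B L M +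
  fixes a :: "nat \<Rightarrow> real ^ 'n" and m :: nat
  assumes a_int: "i < m \<Longrightarrow> a i \<in> integer_points"
    and rayless: "\<not> has_descending_ray cubic (poly_cone a m)"
begin

abbreviation "C \<equiv> poly_cone a m"

text \<open>The only place where the absence of descending rays is used directly. If f fell below every c uniformly
near the ray from y in direction D, the approximants of the ray would be the points that a descending ray
asks for.\<close>

lemma not_below_near_ray:
  assumes y: "y \<in> C" "y \<in> integer_points" and D: "D \<in> C" "D \<noteq> 0" and "\<eta> > 0"
  shows "\<exists>c. \<forall>R. \<exists>t\<ge>R. \<exists>\<delta>\<in>lineal a m D. norm \<delta> \<le> \<eta> \<and> cubic (y + \<delta> + t *\<^sub>R D) \<ge> c"
proof (rule ccontr)
  assume "\<not> ?thesis"
  then have below: "\<exists>R. \<forall>t\<ge>R. \<forall>\<delta>\<in>lineal a m D. norm \<delta> \<le> \<eta> \<longrightarrow> cubic (y + \<delta> + t *\<^sub>R D) < c" for c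
    by (meson not_le)
  have "has_descending_ray cubic C"
    unfolding has_descending_ray_def unbounded_below_on_def
  proof (intro exI conjI allI impI)
    show "ray y D \<subseteq> C"
      using y D by (auto simp: ray_def intro!: poly_cone_add poly_cone_scale)
    fix \<epsilon> :: real and c assume "\<epsilon> > 0"
    obtain R where R: "\<And>t \<delta>. t \<ge> R \<Longrightarrow> \<delta> \<in> lineal a m D \<Longrightarrow> norm \<delta> \<le> \<eta> \<Longrightarrow> cubic (y + \<delta> + t *\<^sub>R D) < c"
      using below by blast
    obtain t \<delta> where t: "t \<ge> max R 0" "norm \<delta> \<le> min \<epsilon> \<eta>" "\<delta> \<in> lineal a m D"
      "t *\<^sub>R D + \<delta> \<in> integer_points" "t *\<^sub>R D + \<delta> \<in> C"
      using integer_point_near_cone_ray[OF a_int D(1), of "min \<epsilon> \<eta>"] \<open>\<epsilon> > 0\<close> \<open>\<eta> > 0\<close> by (metis min_less_iff_conj)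
    have "y + (t *\<^sub>R D + \<delta>) \<in> ray y D + cball 0 \<epsilon>"
      unfolding add.assoc[symmetric] using t by (intro set_plus_intro) (auto simp: ray_def)
    moreover have "cubic (y + (t *\<^sub>R D + \<delta>)) < c"
      using R[of t \<delta>] t by (simp add: add_ac)
    ultimately show "\<exists>x\<in>C \<inter> integer_points \<inter> (ray y D + cball 0 \<epsilon>). cubic x < c"
      using poly_cone_add[OF y(1) t(5)] integer_points_add[OF y(2) t(4)] by blast
  qed fact
  then show False using rayless by contradiction
qed

text \<open>Replacing y by a nearby point changes the coefficient of t^2 exactly by \<open>3 T D D \<delta>\<close>, which vanishes for
the errors of interest once \<open>T D D D = 0\<close>, and the lower coefficients by a bounded amount.\<close>

lemma cubic_near_ray_le:
  obtains K where "K \<ge> 0" "\<And>t \<delta>. t \<ge> 0 \<Longrightarrow> norm \<delta> \<le> 1 \<Longrightarrow> cubic (y + \<delta> + t *\<^sub>R D) \<le>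
    t ^ 3 * T D D D + t\<^sup>2 * (3 * T D D y + B D D + 3 * T D D \<delta>) + t * (slope D y + K * norm \<delta>) + K"
proof -
  define h where "h = 6 * (M * norm D * norm y) + 3 * (M * norm D) + 2 * (M * norm D)"
  define r where "r = norm y + 1"
  define g where "g = M * r ^ 3 + M * r\<^sup>2 + M * r"
  have r: "r \<ge> 0" by (simp add: r_def)
  have hg: "h \<ge> 0" "g \<ge> 0" unfolding h_def g_def using M_nonneg r by simp_all
  show thesis
  proof (rule that)
    show "h + g \<ge> 0" using hg by simp
    fix t :: real and \<delta> :: "real ^ 'n" assume t: "t \<ge> 0" and \<delta>: "norm \<delta> \<le> 1"
    have "norm (y + \<delta>) \<le> r" using norm_triangle_ineq[of y \<delta>] \<delta> by (simp add: r_def)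
    from cubic_bound[OF this r] have 0: "cubic (y + \<delta>) \<le> h + g" using hg unfolding g_def by linarith
    have "M * norm D * norm \<delta> * norm \<delta> \<le> M * norm D * norm \<delta>"
      using \<delta> M_nonneg by (simp add: mult_left_le)
    then have "T D \<delta> \<delta> \<le> M * norm D * norm \<delta>" using T_bound[of D \<delta> \<delta>] by linarith
    moreover have "T D y \<delta> \<le> M * norm D * norm y * norm \<delta>" using T_bound[of D y \<delta>] by simp
    moreover have "B D \<delta> \<le> M * norm D * norm \<delta>" using B_bound[of D \<delta>] by simp
    moreover have "slope D (y + \<delta>) = slope D y + 6 * T D y \<delta> + 3 * T D \<delta> \<delta> + 2 * B D \<delta>"
      by (simp add: slope_def form_linear T_swap23[of D \<delta> y])
    ultimately have "slope D (y + \<delta>) \<le> slope D y + h * norm \<delta>"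
      unfolding h_def by (simp add: algebra_simps)
    also have "\<dots> \<le> slope D y + (h + g) * norm \<delta>" using hg by (simp add: mult_right_mono)
    finally have "t * slope D (y + \<delta>) \<le> t * (slope D y + (h + g) * norm \<delta>)" using t by (rule mult_left_mono)
    with 0 show "cubic (y + \<delta> + t *\<^sub>R D) \<le> t ^ 3 * T D D D + t\<^sup>2 * (3 * T D D y + B D D + 3 * T D D \<delta>)
      + t * (slope D y + (h + g) * norm \<delta>) + (h + g)"
      unfolding cubic_add_scaled by (simp add: form_linear algebra_simps)
  qed
qed

lemma cubic_term_nonneg:
  assumes D: "D \<in> C"
  shows "T D D D \<ge> 0"
proof (rule ccontr)
  assume neg: "\<not> T D D D \<ge> 0"
  then have "D \<noteq> 0" by auto
  from not_below_near_ray[OF _ _ D this, of 0 1] obtain c where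
    c: "\<And>R. \<exists>t\<ge>R. \<exists>\<delta>\<in>lineal a m D. norm \<delta> \<le> 1 \<and> cubic (0 + \<delta> + t *\<^sub>R D) \<ge> c" by auto
  obtain K where K: "K \<ge> 0" "\<And>t \<delta>. t \<ge> 0 \<Longrightarrow> norm \<delta> \<le> 1 \<Longrightarrow> cubic (0 + \<delta> + t *\<^sub>R D) \<le>
    t ^ 3 * T D D D + t\<^sup>2 * (3 * T D D 0 + B D D + 3 * T D D \<delta>) + t * (slope D 0 + K * norm \<delta>) + K"
    using cubic_near_ray_le[of 0 D] by blast
  define b where "b = B D D + 3 * (M * norm D * norm D)"
  have "eventually (\<lambda>t. t ^ 3 * T D D D + t\<^sup>2 * b + t * (slope D 0 + K) + K < c) at_top"
    using neg by (intro eventually_cubic_below) auto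
  then obtain R where R: "\<And>t. t \<ge> R \<Longrightarrow> t ^ 3 * T D D D + t\<^sup>2 * b + t * (slope D 0 + K) + K < c"
    unfolding eventually_at_top_linorder by blast
  obtain t \<delta> where t: "t \<ge> max R 0" "norm \<delta> \<le> 1" "cubic (0 + \<delta> + t *\<^sub>R D) \<ge> c"
    using c[of "max R 0"] by blast
  have "M * norm D * norm D * norm \<delta> \<le> M * norm D * norm D"
    using t(2) M_nonneg by (simp add: mult_left_le)
  then have "T D D \<delta> \<le> M * norm D * norm D" using T_bound[of D D \<delta>] by linarith
  then have "t\<^sup>2 * (3 * T D D 0 + B D D + 3 * T D D \<delta>) \<le> t\<^sup>2 * b"
    by (intro mult_left_mono) (auto simp: b_def)
  moreover have "t * (slope D 0 + K * norm \<delta>) \<le> t * (slope D 0 + K)"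
    using t K(1) by (intro mult_left_mono) (auto simp: mult_left_le)
  ultimately show False using K(2)[of t \<delta>] R[of t] t by simp
qed

text \<open>The cubic form is nonnegative on C and vanishes at D, so D is a boundary minimum; this is the first- and
the second-order condition there.\<close>

lemma T_tangent_nonneg:
  assumes D: "D \<in> C" and "T D D D = 0" and w: "w \<in> tangent a m D"
  shows "T D D w \<ge> 0" and "T D D w = 0 \<Longrightarrow> T D w w \<ge> 0"
proof -
  obtain \<eta> where \<eta>: "\<eta> > 0" "\<And>w. norm w \<le> \<eta> \<Longrightarrow> w \<in> tangent a m D \<Longrightarrow> D + w \<in> C"
    using poly_cone_tangent_nbhd[OF D] by blast
  define \<eta>' where "\<eta>' = \<eta> / (norm w + 1)"
  have pos: "norm w + 1 > 0" using norm_ge_zero[of w] by linarith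
  then have \<eta>': "\<eta>' > 0" using \<eta> by (simp add: \<eta>'_def)
  have *: "e * (3 * T D D w) + e\<^sup>2 * (3 * T D w w) + e ^ 3 * T w w w \<ge> 0"
    if e: "0 < e" "e \<le> \<eta>'" for e
  proof -
    have "e * norm w \<le> \<eta>' * (norm w + 1)" using e by (intro mult_mono) auto
    then have "norm (e *\<^sub>R w) \<le> \<eta>" using e pos by (simp add: \<eta>'_def)
    then have "T (D + e *\<^sub>R w) (D + e *\<^sub>R w) (D + e *\<^sub>R w) \<ge> 0"
      using e by (intro cubic_term_nonneg \<eta>(2) tangent_scale w) auto
    then show ?thesis using assms(2)
      by (simp add: form_linear form_swap power2_eq_square power3_eq_cube algebra_simps)
  qed
  show "T D D w \<ge> 0" using first_order_nonneg[OF \<eta>' *] by simp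
  assume z: "T D D w = 0"
  have "e * (3 * T D w w) + e\<^sup>2 * T w w w + e ^ 3 * 0 \<ge> 0" if e: "0 < e" "e \<le> \<eta>'" for e
  proof -
    have "e * (e * (3 * T D w w) + e\<^sup>2 * T w w w) \<ge> 0"
      using *[OF e] z by (simp add: power2_eq_square power3_eq_cube algebra_simps)
    then show ?thesis using e by (simp add: zero_le_mult_iff)
  qed
  from first_order_nonneg[OF \<eta>' this] show "T D w w \<ge> 0" by simp
qed

lemma T_lineal_zero:
  assumes "D \<in> C" "T D D D = 0" "w \<in> lineal a m D"
  shows "T D D w = 0"
proof -
  have "- w \<in> lineal a m D" using assms(3) subspace_neg subspace_lineal by blast
  then show ?thesis
    using T_tangent_nonneg(1)[OF assms(1,2)] assms(3) lineal_tangent T_minus(3)[of D D w]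
    by (metis neg_0_le_iff_le antisym)
qed

lemma quadratic_term_nonneg:
  assumes D: "D \<in> C" "T D D D = 0" and y: "y \<in> C" "y \<in> integer_points"
  shows "3 * T D D y + B D D \<ge> 0"
proof (rule ccontr)
  assume neg: "\<not> 3 * T D D y + B D D \<ge> 0"
  then have "D \<noteq> 0" by auto
  from not_below_near_ray[OF y D(1) this, of 1] obtain c where
    c: "\<And>R. \<exists>t\<ge>R. \<exists>\<delta>\<in>lineal a m D. norm \<delta> \<le> 1 \<and> cubic (y + \<delta> + t *\<^sub>R D) \<ge> c" by auto
  obtain K where K: "K \<ge> 0" "\<And>t \<delta>. t \<ge> 0 \<Longrightarrow> norm \<delta> \<le> 1 \<Longrightarrow> cubic (y + \<delta> + t *\<^sub>R D) \<le>
    t ^ 3 * T D D D + t\<^sup>2 * (3 * T D D y + B D D + 3 * T D D \<delta>) + t * (slope D y + K * norm \<delta>) + K"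
    using cubic_near_ray_le by blast
  have "eventually (\<lambda>t. t\<^sup>2 * (3 * T D D y + B D D) + t * (slope D y + K) + K < c) at_top"
    using neg by (intro eventually_quadratic_below) auto
  then obtain R where R: "\<And>t. t \<ge> R \<Longrightarrow> t\<^sup>2 * (3 * T D D y + B D D) + t * (slope D y + K) + K < c"
    unfolding eventually_at_top_linorder by blast
  obtain t \<delta> where t: "t \<ge> max R 0" "norm \<delta> \<le> 1" "\<delta> \<in> lineal a m D" "cubic (y + \<delta> + t *\<^sub>R D) \<ge> c"
    using c[of "max R 0"] by blast
  have "t * (slope D y + K * norm \<delta>) \<le> t * (slope D y + K)"
    using t K(1) by (intro mult_left_mono) (auto simp: mult_left_le)
  then show False using K(2)[of t \<delta>] R[of t] t D T_lineal_zero[OF D t(3)] by simp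
qed

text \<open>If the slope were negative, f would tend to minus infinity linearly along approximants of the ray that are
close enough not to spoil the sign.\<close>

lemma slope_nonneg:
  assumes D: "D \<in> C" "T D D D = 0" and y: "y \<in> C" "y \<in> integer_points"
    and zero: "3 * T D D y + B D D = 0"
  shows "slope D y \<ge> 0"
proof (cases "D = 0")
  case False
  show ?thesis
  proof (rule ccontr)
    assume neg: "\<not> slope D y \<ge> 0"
    obtain K where K: "K \<ge> 0" "\<And>t \<delta>. t \<ge> 0 \<Longrightarrow> norm \<delta> \<le> 1 \<Longrightarrow> cubic (y + \<delta> + t *\<^sub>R D) \<le>
      t ^ 3 * T D D D + t\<^sup>2 * (3 * T D D y + B D D + 3 * T D D \<delta>) + t * (slope D y + K * norm \<delta>) + K"
      using cubic_near_ray_le by blast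
    \<comment> \<open>Approximants this close to the ray perturb the negative slope by at most one half of it.\<close>
    define \<eta> where "\<eta> = min 1 (- slope D y / (2 * (K + 1)))"
    have \<eta>: "\<eta> > 0" using K(1) neg by (auto simp: \<eta>_def intro!: divide_neg_pos)
    from not_below_near_ray[OF y D(1) False \<eta>] obtain c where
      c: "\<And>R. \<exists>t\<ge>R. \<exists>\<delta>\<in>lineal a m D. norm \<delta> \<le> \<eta> \<and> cubic (y + \<delta> + t *\<^sub>R D) \<ge> c" by auto
    have "eventually (\<lambda>t. t * (slope D y / 2) + K < c) at_top"
      using neg by (intro eventually_linear_below) auto
    then obtain R where R: "\<And>t. t \<ge> R \<Longrightarrow> t * (slope D y / 2) + K < c"
      unfolding eventually_at_top_linorder by blast
    obtain t \<delta> where t: "t \<ge> max R 0" "norm \<delta> \<le> \<eta>" "\<delta> \<in> lineal a m D" "cubic (y + \<delta> + t *\<^sub>R D) \<ge> c"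
      using c[of "max R 0"] by blast
    have \<delta>1: "norm \<delta> \<le> 1" and "(K + 1) * norm \<delta> \<le> - slope D y / 2"
      using t(2) K(1) by (auto simp: \<eta>_def field_simps)
    then have "K * norm \<delta> \<le> - slope D y / 2" using norm_ge_zero[of \<delta>] unfolding distrib_right by linarith
    then have "t * (slope D y + K * norm \<delta>) \<le> t * (slope D y / 2)"
      using t(1) by (intro mult_left_mono) auto
    then show False using K(2)[of t \<delta>] R[of t] t \<delta>1 D zero T_lineal_zero[OF D t(3)] by simp
  qed
qed (simp add: slope_def)

lemma B_nonneg:
  assumes "D \<in> C" "T D D D = 0"
  shows "B D D \<ge> 0"
  using quadratic_term_nonneg[OF assms, of 0] by simp

end

section \<open>Sequences along which the cubic descends\<close>

text \<open>Typical use: a positive semidefinite form that vanishes at w has w in its kernel.\<close>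

lemma zero_if_affine_nonneg:
  fixes p q :: real
  assumes "\<And>c. p + c * q \<ge> 0"
  shows "q = 0"
proof (rule ccontr)
  assume "q \<noteq> 0"
  then show False using assms[of "- (p + 1) / q"] by simp
qed

text \<open>The form attains a positive minimum on the compact unit sphere of U.\<close>

lemma pos_def_lower_bound:
  fixes b :: "'a::euclidean_space \<Rightarrow> 'a \<Rightarrow> real"
  assumes "bounded_bilinear b" "subspace U" "\<And>p. p \<in> U \<Longrightarrow> p \<noteq> 0 \<Longrightarrow> b p p > 0"
  obtains c where "c > 0" "\<And>p. p \<in> U \<Longrightarrow> b p p \<ge> c * (norm p)\<^sup>2"
proof -
  interpret b: bounded_bilinear b by fact
  define K where "K = sphere 0 1 \<inter> U"
  have K: "compact K" unfolding K_def
    by (intro compact_Int_closed compact_sphere closed_subspace assms)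
  have cont: "continuous_on K (\<lambda>p. b p p)" by (intro b.continuous_on continuous_intros)
  have scale: "b p p = (norm p)\<^sup>2 * b (p /\<^sub>R norm p) (p /\<^sub>R norm p)" if "p \<noteq> 0" for p
    using that by (simp add: b.scaleR_left b.scaleR_right power2_eq_square field_simps)
  have inK: "p /\<^sub>R norm p \<in> K" if "p \<in> U" "p \<noteq> 0" for p
    using that assms(2) by (simp add: K_def subspace_scale)
  show thesis
  proof (cases "K = {}")
    case True
    then show thesis using inK that[of 1] by (metis b.zero_left empty_iff le_numeral_extra(3) mult_zero_right norm_zero zero_less_one zero_power2)
  next
    case False
    from continuous_attains_inf[OF K False cont] obtain p0 where
      p0: "p0 \<in> K" "\<And>p. p \<in> K \<Longrightarrow> b p0 p0 \<le> b p p" by blast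
    show thesis
    proof (rule that)
      show "b p0 p0 > 0" using p0(1) assms(3)[of p0] by (cases "p0 = 0") (auto simp: K_def)
      show "b p p \<ge> b p0 p0 * (norm p)\<^sup>2" if "p \<in> U" for p
      proof (cases "p = 0")
        case False
        show ?thesis unfolding scale[OF False]
          using mult_left_mono[OF p0(2)[OF inK[OF that False]], of "(norm p)\<^sup>2"]
          by (simp add: mult.commute)
      qed (simp add: b.zero_left)
    qed
  qed
qed

lemma poly_cone_lineal_nbhd:
  assumes "d \<in> poly_cone a m"
  obtains \<eta> where "\<eta> > 0"
    "\<And>w. norm w \<le> \<eta> \<Longrightarrow> w \<in> lineal a m d \<Longrightarrow> d + w \<in> poly_cone a m \<and> lineal a m d \<subseteq> lineal a m (d + w)"
proof -
  obtain \<eta> where \<eta>: "\<eta> > 0" "\<And>w. norm w \<le> \<eta> \<Longrightarrow> w \<in> tangent a m d \<Longrightarrow> d + w \<in> poly_cone a m"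
    using poly_cone_tangent_nbhd[OF assms] by blast
  have "d + w \<in> poly_cone a m \<and> lineal a m d \<subseteq> lineal a m (d + w)"
    if w: "norm w \<le> \<eta> / 2" "w \<in> lineal a m d" for w
  proof -
    have 2: "d + 2 *\<^sub>R w \<in> poly_cone a m"
      using w \<eta> by (intro \<eta>(2) lineal_tangent subspace_scale[OF subspace_lineal]) auto
    have "a i \<bullet> d = 0" if "i < m" "a i \<bullet> (d + w) = 0" for i
    proof -
      have "a i \<bullet> d \<le> 0" "a i \<bullet> d + 2 * (a i \<bullet> w) \<le> 0"
        using 2 assms that(1) by (auto simp: poly_cone_def inner_add_right)
      then show ?thesis using that(2) by (simp add: inner_add_right)
    qed
    then show ?thesis using w \<eta>
      by (auto intro!: \<eta>(2) lineal_tangent) (auto simp: lineal_def)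
  qed
  then show thesis using that[of "\<eta> / 2"] \<eta>(1) by simp
qed

text \<open>The numerical part of \<open>lineal_contradiction\<close>. There N is the size of the point, \<pi> and \<nu> are the sizes of two small
components, and q is a slope. If \<pi> is large, the quadratic lower bound for q dominates all other terms;
if \<pi> is bounded, \<open>q \<ge> 0\<close> and the definite term in \<nu> take over.\<close>

lemma lineality_bound:
  fixes c c' M :: real
  assumes "c > 0" "c' > 0" "M \<ge> 0"
  shows "\<exists>\<delta>>0. \<exists>K. \<forall>N q \<pi> \<nu>. 0 \<le> N \<longrightarrow> 0 \<le> \<pi> \<longrightarrow> 0 \<le> \<nu> \<longrightarrow> \<pi> \<le> \<delta> * N \<longrightarrow> \<nu> \<le> \<delta> * N \<longrightarrow>
    0 \<le> q \<longrightarrow> c * N * \<pi>\<^sup>2 - 2 * M * N * \<pi> - M * N \<le> q \<longrightarrow>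
    K \<le> q - 3 * M * \<nu> * \<pi>\<^sup>2 - M * \<pi> ^ 3 + c' * \<nu>\<^sup>2 - 2 * M * \<nu> * \<pi> - M * \<pi>\<^sup>2 - M * \<nu> - M * \<pi>"
proof -
  define P where "P = 1 + 6 * M / c"
  have P: "P \<ge> 1" using assms by (simp add: P_def)
  define \<delta> where "\<delta> = c / (18 * M + 1)"
  have \<delta>: "\<delta> > 0" using assms by (simp add: \<delta>_def)
  have \<delta>c: "9 * M * \<delta> \<le> c / 2" using assms by (simp add: \<delta>_def field_simps)
  define h where "h = 3 * M * P\<^sup>2 + 2 * M * P + M"
  have h: "h \<ge> 0" unfolding h_def using assms P by (intro add_nonneg_nonneg mult_nonneg_nonneg) auto
  define K where "K = min 0 (- h\<^sup>2 / (4 * c') - (M * P ^ 3 + M * P\<^sup>2 + M * P))"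
  show ?thesis
  proof (rule exI[of _ \<delta>], rule conjI[OF \<delta>], rule exI[of _ K], intro allI impI)
    fix N q \<pi> \<nu> :: real
    assume N: "0 \<le> N" and \<pi>: "0 \<le> \<pi>" "\<pi> \<le> \<delta> * N" and \<nu>: "0 \<le> \<nu>" "\<nu> \<le> \<delta> * N" and
      q: "0 \<le> q" "c * N * \<pi>\<^sup>2 - 2 * M * N * \<pi> - M * N \<le> q"
    let ?rest = "- 3 * M * \<nu> * \<pi>\<^sup>2 - M * \<pi> ^ 3 - 2 * M * \<nu> * \<pi> - M * \<pi>\<^sup>2 - M * \<nu> - M * \<pi>"
    show "K \<le> q - 3 * M * \<nu> * \<pi>\<^sup>2 - M * \<pi> ^ 3 + c' * \<nu>\<^sup>2 - 2 * M * \<nu> * \<pi> - M * \<pi>\<^sup>2 - M * \<nu> - M * \<pi>"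
    proof (cases "\<pi> \<le> P")
      case True
      have "M * \<nu> * \<pi>\<^sup>2 \<le> M * \<nu> * P\<^sup>2" "M * \<pi> ^ 3 \<le> M * P ^ 3" "M * \<nu> * \<pi> \<le> M * \<nu> * P"
        "M * \<pi>\<^sup>2 \<le> M * P\<^sup>2" "M * \<pi> \<le> M * P"
        using True \<pi> \<nu> assms by (auto intro!: mult_left_mono power_mono)
      moreover have "h * \<nu> = 3 * (M * \<nu> * P\<^sup>2) + 2 * (M * \<nu> * P) + M * \<nu>"
        by (simp add: h_def algebra_simps)
      ultimately have "?rest \<ge> - h * \<nu> - (M * P ^ 3 + M * P\<^sup>2 + M * P)" by linarith
      moreover have "c' * \<nu>\<^sup>2 - h * \<nu> \<ge> - h\<^sup>2 / (4 * c')"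
      proof -
        have "0 \<le> (2 * c' * \<nu> - h)\<^sup>2 / (4 * c')" using assms by simp
        also have "\<dots> = c' * \<nu>\<^sup>2 - h * \<nu> + h\<^sup>2 / (4 * c')"
          using assms by (simp add: field_simps power2_eq_square)
        finally show ?thesis by simp
      qed
      ultimately show ?thesis using q(1) unfolding K_def by linarith
    next
      case False
      define G where "G = N * \<pi>\<^sup>2"
      have \<pi>1: "\<pi> \<ge> 1" using False P by simp
      then have sq: "1 \<le> \<pi>\<^sup>2" "\<pi> \<le> \<pi>\<^sup>2" by (simp_all add: self_le_power)
      have "3 * M * \<pi> \<le> c / 2 * (\<pi> * \<pi>)"
      proof -
        have "6 * M / c \<le> \<pi>" using False by (simp add: P_def)
        then have "6 * M \<le> c * \<pi>" using assms by (simp add: field_simps)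
        then have "6 * M * \<pi> \<le> c * \<pi> * \<pi>" using \<pi> by (intro mult_right_mono) auto
        then show ?thesis by simp
      qed
      then have "2 * M * \<pi> + M \<le> c / 2 * \<pi>\<^sup>2"
        using mult_left_mono[OF \<pi>1 assms(3)] unfolding power2_eq_square by linarith
      from mult_left_mono[OF this N] have qG: "q \<ge> c / 2 * G"
        using q(2) by (simp add: G_def algebra_simps)
      have \<nu>\<pi>: "\<nu> * \<pi>\<^sup>2 \<le> \<delta> * G" using mult_right_mono[OF \<nu>(2), of "\<pi>\<^sup>2"] by (simp add: G_def mult.assoc)
      have \<pi>3: "\<pi> ^ 3 \<le> \<delta> * G"
        using mult_right_mono[OF \<pi>(2), of "\<pi>\<^sup>2"] by (simp add: G_def mult.assoc power2_eq_square power3_eq_cube)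
      have 1: "\<nu> * \<pi> \<le> \<nu> * \<pi>\<^sup>2" "\<nu> \<le> \<nu> * \<pi>\<^sup>2" using sq \<nu> by (auto intro: mult_left_mono simp: mult_le_cancel_left1)
      have 2: "\<pi>\<^sup>2 \<le> \<pi> ^ 3" "\<pi> \<le> \<pi> ^ 3" using \<pi>1 by (simp_all add: power_increasing self_le_power)
      have "M * (\<nu> * \<pi>\<^sup>2) \<le> M * (\<delta> * G)" "M * \<pi> ^ 3 \<le> M * (\<delta> * G)" "M * (\<nu> * \<pi>) \<le> M * (\<delta> * G)"
        "M * \<pi>\<^sup>2 \<le> M * (\<delta> * G)" "M * \<pi> \<le> M * (\<delta> * G)" "M * \<nu> \<le> M * (\<delta> * G)"
        using \<nu>\<pi> \<pi>3 1 2 assms(3) by (auto intro!: mult_left_mono)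
      moreover have "9 * (M * (\<delta> * G)) \<le> c / 2 * G"
        using mult_right_mono[OF \<delta>c, of G] N by (simp add: G_def algebra_simps)
      moreover have "0 \<le> c' * \<nu>\<^sup>2" using assms by simp
      moreover have "K \<le> 0" by (simp add: K_def)
      ultimately show ?thesis using qG by (simp add: mult.assoc)
    qed
  qed
qed

text \<open>The situation after the reduction to a cone, except for the minimality of the points, which only one
case needs.\<close>

locale rayless_sequence = rayless_cubic T B L M a m
  for T :: "real ^ 'n \<Rightarrow> real ^ 'n \<Rightarrow> real ^ 'n \<Rightarrow> real" and B L M a m +
  fixes x :: "nat \<Rightarrow> real ^ 'n" and d :: "real ^ 'n"
  assumes x_cone: "x j \<in> C" and x_int: "x j \<in> integer_points"
    and norm_x: "filterlim (\<lambda>j. norm (x j)) at_top sequentially"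
    and dir: "(\<lambda>j. x j /\<^sub>R norm (x j)) \<longlonglongrightarrow> d"
    and cubic_x: "filterlim (\<lambda>j. cubic (x j)) at_bot sequentially"
    and constraint_x: "i < m \<Longrightarrow> (\<forall>j. a i \<bullet> x j = 0) \<or> filterlim (\<lambda>j. a i \<bullet> x j) at_bot sequentially"
begin

lemma eventually_norm_ge: "\<forall>\<^sub>F j in sequentially. norm (x j) \<ge> c"
  using norm_x by (simp add: filterlim_at_top)

lemma eventually_bounded_below_False:
  assumes "\<forall>\<^sub>F j in sequentially. c \<le> cubic (x j)"
  shows False
proof -
  have "\<forall>\<^sub>F j in sequentially. cubic (x j) < c"
    using cubic_x by (simp add: filterlim_at_bot_dense)
  with assms have "\<forall>\<^sub>F j in sequentially. False" by eventually_elim auto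
  then show False by simp
qed

lemma norm_d: "norm d = 1"
proof (rule LIMSEQ_unique)
  show "(\<lambda>j. norm (x j /\<^sub>R norm (x j))) \<longlonglongrightarrow> norm d" by (intro tendsto_norm dir)
  have "\<forall>\<^sub>F j in sequentially. 1 = norm (x j /\<^sub>R norm (x j))"
    using eventually_norm_ge[of 1]
  proof eventually_elim
    case (elim j)
    then have "norm (x j) \<noteq> 0" by linarith
    then show ?case by simp
  qed
  then show "(\<lambda>j. norm (x j /\<^sub>R norm (x j))) \<longlonglongrightarrow> 1" by (rule Lim_transform_eventually[OF tendsto_const])
qed

lemma d_cone: "d \<in> C"
  unfolding poly_cone_def
proof (intro CollectI allI impI)
  fix i assume "i < m"
  have "(\<lambda>j. a i \<bullet> (x j /\<^sub>R norm (x j))) \<longlonglongrightarrow> a i \<bullet> d" by (intro tendsto_intros dir)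
  then show "a i \<bullet> d \<le> 0"
    by (rule tendsto_upperbound)
      (use x_cone \<open>i < m\<close> in \<open>auto intro!: always_eventually mult_nonneg_nonpos simp: poly_cone_def\<close>)
qed

lemma x_near_dir:
  assumes "\<delta> > 0"
  shows "\<forall>\<^sub>F j in sequentially. norm (x j - norm (x j) *\<^sub>R d) \<le> \<delta> * norm (x j)"
proof -
  have "\<forall>\<^sub>F j in sequentially. dist (x j /\<^sub>R norm (x j)) d < \<delta>"
    by (rule tendstoD[OF dir assms])
  then show ?thesis using eventually_norm_ge[of 1]
  proof eventually_elim
    case (elim j)
    have "norm (x j) \<noteq> 0" using elim by linarith
    then have "x j - norm (x j) *\<^sub>R d = norm (x j) *\<^sub>R (x j /\<^sub>R norm (x j) - d)"
      by (simp add: scaleR_diff_right)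
    then have "norm (x j - norm (x j) *\<^sub>R d) = norm (x j) * norm (x j /\<^sub>R norm (x j) - d)" by simp
    then show ?case
      using elim mult_left_mono[of "norm (x j /\<^sub>R norm (x j) - d)" \<delta> "norm (x j)"]
      by (simp add: dist_norm mult.commute)
  qed
qed

lemma cubic_unit: "cubic y = (norm y) ^ 3 * T (y /\<^sub>R norm y) (y /\<^sub>R norm y) (y /\<^sub>R norm y)
  + (norm y)\<^sup>2 * B (y /\<^sub>R norm y) (y /\<^sub>R norm y) + norm y * L (y /\<^sub>R norm y)"
proof (cases "y = 0")
  case False
  then show ?thesis
    unfolding cubic_def form_linear by (simp add: power2_eq_square power3_eq_cube field_simps)
qed (simp add: cubic_def)

lemma norm_unit_le: "norm (y /\<^sub>R norm y) \<le> 1" for y :: "real ^ 'n"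
  by (cases "y = 0") auto

lemma unit_bounds:
  assumes "norm u \<le> 1"
  shows "\<bar>B u u\<bar> \<le> M" "\<bar>L u\<bar> \<le> M"
proof -
  have "M * norm u * norm u \<le> M * 1 * 1" "M * norm u \<le> M * 1"
    using assms M_nonneg by (intro mult_mono; simp)+
  then show "\<bar>B u u\<bar> \<le> M" "\<bar>L u\<bar> \<le> M"
    using B_bound[of u u] L_bound[of u] by linarith+
qed

text \<open>If \<open>T d d d\<close> were positive, the cubic term would make f tend to infinity along the sequence.\<close>

lemma Tddd: "T d d d = 0"
proof (rule ccontr)
  assume "T d d d \<noteq> 0"
  then have pos: "T d d d > 0" using cubic_term_nonneg[OF d_cone] by linarith
  let ?u = "\<lambda>j. x j /\<^sub>R norm (x j)"
  have "\<forall>\<^sub>F j in sequentially. T (?u j) (?u j) (?u j) > T d d d / 2"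
    using order_tendstoD(1)[OF tendsto_T[OF dir dir dir], of "T d d d / 2"] pos by simp
  then have "\<forall>\<^sub>F j in sequentially. 0 \<le> cubic (x j)"
    using eventually_norm_ge[of "max 1 (4 * M / T d d d)"]
  proof eventually_elim
    case (elim j)
    define N where "N = norm (x j)"
    have N: "N \<ge> 1" "4 * M \<le> N * T d d d" using elim(2) pos by (auto simp: N_def field_simps)
    note unit_bounds[OF norm_unit_le[of "x j"]]
    then have "N\<^sup>2 * B (?u j) (?u j) \<ge> N\<^sup>2 * (- M)" "N * L (?u j) \<ge> N * (- M)"
      using N by (intro mult_left_mono; simp)+
    moreover have "N ^ 3 * T (?u j) (?u j) (?u j) \<ge> N ^ 3 * (T d d d / 2)"
      using N elim(1) by (intro mult_left_mono) auto
    moreover have "N ^ 3 * (T d d d / 2) \<ge> N\<^sup>2 * (2 * M)"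
      using mult_left_mono[OF N(2), of "N\<^sup>2"] by (simp add: power2_eq_square power3_eq_cube mult_ac)
    moreover have "N * M \<le> N\<^sup>2 * M"
      using N M_nonneg by (intro mult_right_mono) (auto simp: power2_eq_square mult_le_cancel_left1)
    ultimately show ?case unfolding cubic_unit[of "x j"] N_def[symmetric] by simp
  qed
  then show False by (rule eventually_bounded_below_False)
qed

text \<open>The cubic term is nonnegative on the whole cone, so a positive \<open>B d d\<close> would again make f tend to infinity.\<close>

lemma Bdd: "B d d = 0"
proof (rule ccontr)
  assume "B d d \<noteq> 0"
  then have pos: "B d d > 0" using B_nonneg[OF d_cone Tddd] by linarith
  let ?u = "\<lambda>j. x j /\<^sub>R norm (x j)"
  have "\<forall>\<^sub>F j in sequentially. B (?u j) (?u j) > B d d / 2"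
    using order_tendstoD(1)[OF tendsto_B[OF dir dir], of "B d d / 2"] pos by simp
  then have "\<forall>\<^sub>F j in sequentially. 0 \<le> cubic (x j)"
    using eventually_norm_ge[of "max 1 (2 * M / B d d)"]
  proof eventually_elim
    case (elim j)
    define N where "N = norm (x j)"
    have N: "N \<ge> 1" "2 * M \<le> N * B d d" using elim(2) pos by (auto simp: N_def field_simps)
    note unit_bounds(2)[OF norm_unit_le[of "x j"]]
    then have "N * L (?u j) \<ge> N * (- M)"
      using N by (intro mult_left_mono) auto
    moreover have "N\<^sup>2 * B (?u j) (?u j) \<ge> N\<^sup>2 * (B d d / 2)"
      using N elim(1) by (intro mult_left_mono) auto
    moreover have "N\<^sup>2 * (B d d / 2) \<ge> N * M"
      using mult_left_mono[OF N(2), of "N"] N by (simp add: power2_eq_square mult_ac)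
    moreover have "N ^ 3 * T (?u j) (?u j) (?u j) \<ge> 0"
      using N by (intro mult_nonneg_nonneg cubic_term_nonneg poly_cone_scale x_cone) auto
    ultimately show ?case unfolding cubic_unit[of "x j"] N_def[symmetric] by simp
  qed
  then show False by (rule eventually_bounded_below_False)
qed

lemma Tdd_tangent: "w \<in> tangent a m d \<Longrightarrow> T d d w \<ge> 0"
  by (rule T_tangent_nonneg(1)[OF d_cone Tddd])

lemma Tdd_lineal: "w \<in> lineal a m d \<Longrightarrow> T d d w = 0"
  by (rule T_lineal_zero[OF d_cone Tddd])

text \<open>Here C is a neighbourhood of d in the lineality space S, so d is an interior minimum of the cubic form on S
and \<open>T d\<close> is positive semidefinite on S. Let N be the kernel of \<open>T d\<close> and N1 the kernel of B on N. Perturbing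
d within N gives directions in which the cubic form vanishes as well; this yields \<open>T n n p = 0\<close> for n in N, and
\<open>B d n = 0\<close>. Write x = n1 + n2 + p orthogonally with n1 in N1 and n1 + n2 in N. Then n1 is an
admissible direction near d with vanishing cubic and quadratic coefficients, and f(x) is \<open>slope n1 x \<ge> 0\<close> plus
terms in n2 and p that \<open>lineality_bound\<close> controls, since B is definite on the n2 and \<open>T d\<close> on
the p.\<close>

lemma lineal_contradiction:
  assumes xS: "\<And>j. x j \<in> lineal a m d"
  shows False
proof -
  define S where "S = lineal a m d"
  have S: "subspace S" unfolding S_def by (rule subspace_lineal)
  have dS: "d \<in> S" unfolding S_def by (rule lineal_self)
  have Tdd: "T d d w = 0" if "w \<in> S" for w using that Tdd_lineal unfolding S_def by blast
  have Td: "T d w w \<ge> 0" if "w \<in> S" for w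
    using T_tangent_nonneg(2)[OF d_cone Tddd] that Tdd lineal_tangent unfolding S_def by blast
  obtain \<eta> where \<eta>: "\<eta> > 0" "\<And>w. norm w \<le> \<eta> \<Longrightarrow> w \<in> S \<Longrightarrow> d + w \<in> C \<and> S \<subseteq> lineal a m (d + w)"
    using poly_cone_lineal_nbhd[OF d_cone] unfolding S_def by blast
  define N where "N = {w \<in> S. T d w w = 0}"
  have NS: "w \<in> S" if "w \<in> N" for w using that by (simp add: N_def)
  have ker: "T d w w' = 0" if w: "w \<in> N" "w' \<in> S" for w w'
  proof -
    have "T d w' w' + c * (2 * T d w w') \<ge> 0" for c
    proof -
      have "w' + c *\<^sub>R w \<in> S" using w NS S by (intro subspace_add subspace_scale) auto
      from Td[OF this] show ?thesis using w by (simp add: N_def form_linear T_swap23[of d w' w])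
    qed
    from zero_if_affine_nonneg[OF this] show ?thesis by simp
  qed
  have N: "subspace N"
    unfolding subspace_def
  proof (intro conjI ballI allI)
    show "0 \<in> N" using S by (simp add: N_def subspace_0)
    show "v + w \<in> N" if "v \<in> N" "w \<in> N" for v w
      using that ker[of v w] ker[of w v] S by (simp add: N_def form_linear subspace_add)
    show "c *\<^sub>R v \<in> N" if "v \<in> N" for c v
      using that S by (simp add: N_def form_linear subspace_scale)
  qed
  have dN: "d \<in> N" using dS by (simp add: N_def Tddd)
  have small: "\<exists>e0>0. \<forall>e. \<bar>e\<bar> \<le> e0 \<longrightarrow> norm (e *\<^sub>R n) \<le> \<eta>" for n :: "real ^ 'n"
  proof (intro exI[of _ "\<eta> / (norm n + 1)"] conjI allI impI)
    have pos: "norm n + 1 > 0" using norm_ge_zero[of n] by linarith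
    then show "\<eta> / (norm n + 1) > 0" using \<eta>(1) by simp
    fix e assume "\<bar>e\<bar> \<le> \<eta> / (norm n + 1)"
    then have "\<bar>e\<bar> * (norm n + 1) \<le> \<eta>" using pos by (simp add: field_simps)
    then show "norm (e *\<^sub>R n) \<le> \<eta>" by (simp add: algebra_simps)
  qed
  have DDD: "T (d + e *\<^sub>R n) (d + e *\<^sub>R n) (d + e *\<^sub>R n) = e ^ 3 * T n n n" if "n \<in> N" for e n
  proof -
    have "T d n n = 0" "T d d n = 0" using that Tdd[OF NS] by (auto simp: N_def)
    moreover have "T n d n = T d n n" "T n n d = T d n n" "T d n d = T d d n" "T n d d = T d d n"
      by (simp_all add: T_swap12 T_swap23)
    ultimately show ?thesis by (simp add: form_linear Tddd power3_eq_cube)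
  qed
  have nnn: "T n n n = 0" if n: "n \<in> N" for n
  proof -
    obtain e0 where e0: "e0 > 0" "\<And>e. \<bar>e\<bar> \<le> e0 \<Longrightarrow> norm (e *\<^sub>R n) \<le> \<eta>" using small by blast
    have "e ^ 3 * T n n n \<ge> 0" if "\<bar>e\<bar> \<le> e0" for e
    proof -
      have "d + e *\<^sub>R n \<in> C" using \<eta>(2)[OF e0(2)[OF that]] S NS[OF n] by (simp add: subspace_scale)
      from cubic_term_nonneg[OF this] show ?thesis by (simp add: DDD[OF n])
    qed
    from this[of e0] this[of "- e0"] e0(1) have "e0 ^ 3 * T n n n = 0" by simp
    then show ?thesis using e0(1) by simp
  qed
  have perturb: "\<exists>e0>0. \<forall>e. \<bar>e\<bar> \<le> e0 \<longrightarrow> d + e *\<^sub>R n \<in> C \<and> S \<subseteq> lineal a m (d + e *\<^sub>R n)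
      \<and> T (d + e *\<^sub>R n) (d + e *\<^sub>R n) (d + e *\<^sub>R n) = 0" if n: "n \<in> N" for n
  proof -
    obtain e0 where e0: "e0 > 0" "\<And>e. \<bar>e\<bar> \<le> e0 \<Longrightarrow> norm (e *\<^sub>R n) \<le> \<eta>" using small by blast
    have "d + e *\<^sub>R n \<in> C \<and> S \<subseteq> lineal a m (d + e *\<^sub>R n)" if "\<bar>e\<bar> \<le> e0" for e
      using \<eta>(2)[OF e0(2)[OF that]] S NS[OF n] by (simp add: subspace_scale)
    then show ?thesis using e0(1) by (intro exI[of _ e0]) (simp add: DDD[OF n] nnn[OF n])
  qed
  have perturb1: "\<exists>e>0. d + e *\<^sub>R n \<in> C \<and> S \<subseteq> lineal a m (d + e *\<^sub>R n)
      \<and> T (d + e *\<^sub>R n) (d + e *\<^sub>R n) (d + e *\<^sub>R n) = 0" if n: "n \<in> N" for n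
    using perturb[OF n] by (metis abs_of_pos order_refl)
  have nnp: "T n n p = 0" if n: "n \<in> N" and p: "p \<in> S" for n p
  proof -
    obtain e where e: "e > 0" "d + e *\<^sub>R n \<in> C" "S \<subseteq> lineal a m (d + e *\<^sub>R n)"
      "T (d + e *\<^sub>R n) (d + e *\<^sub>R n) (d + e *\<^sub>R n) = 0" using perturb1[OF n] by blast
    have "T (d + e *\<^sub>R n) (d + e *\<^sub>R n) p = 0" using T_lineal_zero[OF e(2,4)] e(3) p by blast
    then have "e * (e * T n n p) = 0" using Tdd[OF p] ker[OF n p]
      by (simp add: form_linear T_swap12[of n d])
    then show ?thesis using e(1) by simp
  qed
  have nnp': "T n n' p = 0" if "n \<in> N" "n' \<in> N" "p \<in> S" for n n' p
    using nnp[OF subspace_add[OF N that(1,2)] that(3)] nnp[of n p] nnp[of n' p] that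
    by (simp add: form_linear T_swap12[of n' n])
  have Bdn_nonneg: "B d n \<ge> 0" if n: "n \<in> N" for n
  proof -
    obtain e0 where e0: "e0 > 0" "\<And>e. \<bar>e\<bar> \<le> e0 \<Longrightarrow> d + e *\<^sub>R n \<in> C \<and>
        T (d + e *\<^sub>R n) (d + e *\<^sub>R n) (d + e *\<^sub>R n) = 0" using perturb[OF n] by blast
    have "e * (2 * B d n) + e\<^sup>2 * B n n + e ^ 3 * 0 \<ge> 0" if "0 < e" "e \<le> e0" for e
    proof -
      have "B (d + e *\<^sub>R n) (d + e *\<^sub>R n) \<ge> 0" using e0(2)[of e] that by (intro B_nonneg) auto
      then show ?thesis by (simp add: form_linear Bdd B_swap[of n d] power2_eq_square algebra_simps)
    qed
    from first_order_nonneg[OF e0(1) this] show ?thesis by simp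
  qed
  have Bdn: "B d n = 0" if "n \<in> N" for n
    using Bdn_nonneg[OF that] Bdn_nonneg[OF subspace_neg[OF N that]] by (simp add: B_minus)
  have Bnn: "B n n \<ge> 0" if n: "n \<in> N" for n
  proof -
    obtain e where e: "e > 0" "d + e *\<^sub>R n \<in> C"
      "T (d + e *\<^sub>R n) (d + e *\<^sub>R n) (d + e *\<^sub>R n) = 0" using perturb1[OF n] by blast
    have "B (d + e *\<^sub>R n) (d + e *\<^sub>R n) \<ge> 0" using e by (intro B_nonneg) auto
    then show ?thesis using e(1)
      by (simp add: form_linear Bdd Bdn[OF n] B_swap[of n d] zero_le_mult_iff)
  qed
  \<comment> \<open>Where the perturbed directions d + e n are degenerate for B as well.\<close>
  define N1 where "N1 = {n \<in> N. B n n = 0}"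
  have kerB: "B w w' = 0" if w: "w \<in> N1" "w' \<in> N" for w w'
  proof -
    have "B w' w' + c * (2 * B w w') \<ge> 0" for c
    proof -
      have "w' + c *\<^sub>R w \<in> N" using w N by (intro subspace_add subspace_scale) (auto simp: N1_def)
      from Bnn[OF this] show ?thesis using w by (simp add: N1_def form_linear B_swap[of w' w])
    qed
    from zero_if_affine_nonneg[OF this] show ?thesis by simp
  qed
  have N1: "subspace N1"
    unfolding subspace_def
  proof (intro conjI ballI allI)
    show "0 \<in> N1" using N by (simp add: N1_def subspace_0)
    show "v + w \<in> N1" if "v \<in> N1" "w \<in> N1" for v w
      using that kerB[of v w] kerB[of w v] N by (simp add: N1_def form_linear subspace_add)
    show "c *\<^sub>R v \<in> N1" if "v \<in> N1" for c v
      using that N by (simp add: N1_def form_linear subspace_scale)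
  qed
  have dN1: "d \<in> N1" using dN by (simp add: N1_def Bdd)
  have N1N: "n \<in> N" if "n \<in> N1" for n using that by (simp add: N1_def)
  define P where "P = {p \<in> S. \<forall>n\<in>N. orthogonal p n}"
  define N2 where "N2 = {p \<in> N. \<forall>n\<in>N1. orthogonal p n}"
  have P: "subspace P" using S by (auto simp: P_def subspace_def orthogonal_clauses)
  have N2: "subspace N2" using N by (auto simp: N2_def subspace_def orthogonal_clauses)
  have "\<exists>n1 n2 p. n1 \<in> N1 \<and> n2 \<in> N2 \<and> p \<in> P \<and> x j = n1 + (n2 + p)" for j
  proof -
    obtain n1 r where n1: "n1 \<in> span N1" "\<And>w. w \<in> span N1 \<Longrightarrow> orthogonal r w" "x j = n1 + r"
      using orthogonal_subspace_decomp_exists[of N1 "x j"] by metis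
    obtain n2 p where n2: "n2 \<in> span N" "\<And>w. w \<in> span N \<Longrightarrow> orthogonal p w" "r = n2 + p"
      using orthogonal_subspace_decomp_exists[of N r] by metis
    have sp: "span N1 = N1" "span N = N" using N N1 by (simp_all add: span_eq_iff)
    have "p = x j - n1 - n2" using n1(3) n2(3) by simp
    then have "p \<in> S" using xS NS N1N n1(1) n2(1) S unfolding sp S_def[symmetric]
      by (metis subspace_diff)
    then have "p \<in> P" using n2(2) by (simp add: P_def sp)
    moreover have "n2 \<in> N2"
    proof -
      have "orthogonal n2 n" if "n \<in> N1" for n
      proof -
        have "orthogonal (r - p) n"
          using n1(2)[of n] n2(2)[of n] that N1N by (simp add: sp orthogonal_clauses)
        then show ?thesis using n2(3) by simp
      qed
      then show ?thesis using n2(1) by (simp add: N2_def sp)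
    qed
    ultimately show ?thesis using n1 n2(3) by (auto simp: sp)
  qed
  then obtain n1 n2 p where n1: "\<And>j. n1 j \<in> N1" and n2: "\<And>j. n2 j \<in> N2" and p: "\<And>j. p j \<in> P"
    and xj: "\<And>j. x j = n1 j + (n2 j + p j)" by metis
  obtain c where c: "c > 0" "\<And>p. p \<in> P \<Longrightarrow> T d p p \<ge> c * (norm p)\<^sup>2"
  proof (rule pos_def_lower_bound[OF bounded_bilinear_T P, of d])
    show "T d p p > 0" if "p \<in> P" "p \<noteq> 0" for p
    proof (rule ccontr)
      assume "\<not> T d p p > 0"
      then have "p \<in> N" using Td[of p] that(1) by (simp add: N_def P_def)
      then have "orthogonal p p" using that(1) unfolding P_def by blast
      then show False using that(2) by (simp add: orthogonal_self)
    qed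
  qed auto
  obtain c' where c': "c' > 0" "\<And>p. p \<in> N2 \<Longrightarrow> B p p \<ge> c' * (norm p)\<^sup>2"
  proof (rule pos_def_lower_bound[OF bounded_bilinear_B N2])
    show "B p p > 0" if "p \<in> N2" "p \<noteq> 0" for p
    proof (rule ccontr)
      assume "\<not> B p p > 0"
      then have "p \<in> N1" using Bnn[of p] that(1) by (simp add: N1_def N2_def)
      then have "orthogonal p p" using that(1) unfolding N2_def by blast
      then show False using that(2) by (simp add: orthogonal_self)
    qed
  qed auto
  obtain \<delta>' K where \<delta>': "\<delta>' > 0" and K: "\<And>N q \<pi> \<nu>. 0 \<le> N \<Longrightarrow> 0 \<le> \<pi> \<Longrightarrow> 0 \<le> \<nu> \<Longrightarrow> \<pi> \<le> \<delta>' * N \<Longrightarrow>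
    \<nu> \<le> \<delta>' * N \<Longrightarrow> 0 \<le> q \<Longrightarrow> c * N * \<pi>\<^sup>2 - 2 * M * N * \<pi> - M * N \<le> q \<Longrightarrow>
    K \<le> q - 3 * M * \<nu> * \<pi>\<^sup>2 - M * \<pi> ^ 3 + c' * \<nu>\<^sup>2 - 2 * M * \<nu> * \<pi> - M * \<pi>\<^sup>2 - M * \<nu> - M * \<pi>"
    using lineality_bound[OF c(1) c'(1) M_nonneg] by metis
  define \<delta> where "\<delta> = min (min \<delta>' \<eta>) (min 1 (c / (3 * M + 1)))"
  have \<delta>: "\<delta> > 0" "\<delta> \<le> \<delta>'" "\<delta> \<le> \<eta>" "\<delta> \<le> 1" using \<delta>' \<eta>(1) c(1) M_nonneg by (auto simp: \<delta>_def)
  have "\<delta> \<le> c / (3 * M + 1)" by (simp add: \<delta>_def)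
  then have "\<delta> * (3 * M + 1) \<le> c" using M_nonneg by (simp add: pos_le_divide_eq)
  then have \<delta>c: "3 * M * \<delta> \<le> c" using \<delta>(1) by (simp add: algebra_simps)
  have half: "\<delta> / 2 > 0" using \<delta>(1) by simp
  have "\<forall>\<^sub>F j in sequentially. K \<le> cubic (x j)"
    using x_near_dir[OF half] eventually_norm_ge[of 1]
  proof eventually_elim
    case (elim j)
    define X where "X = norm (x j)"
    define r where "r = n2 j + p j"
    have X: "X \<ge> 1" using elim by (simp add: X_def)
    have n2N: "n2 j \<in> N" and pS: "p j \<in> S" and n1N: "n1 j \<in> N"
      using n1 n2 p N1N by (auto simp: N2_def P_def)
    have rS: "r \<in> S" unfolding r_def using n2N NS pS S by (simp add: subspace_add)
    have orth_r: "orthogonal n r" if "n \<in> N1" for n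
    proof -
      have "orthogonal (n2 j) n" "orthogonal (p j) n"
        using n2[of j] p[of j] N1N[OF that] that unfolding N2_def P_def by blast+
      then show ?thesis unfolding r_def orthogonal_def by (simp add: inner_add_right inner_commute)
    qed
    have xd: "norm (x j - X *\<^sub>R d) \<le> \<delta> / 2 * X" using elim \<delta> by (simp add: X_def)
    have decomp: "x j - X *\<^sub>R d = (n1 j - X *\<^sub>R d) + r" by (simp add: xj r_def)
    have "n1 j - X *\<^sub>R d \<in> N1" using n1 dN1 N1 by (intro subspace_diff subspace_scale) auto
    from norm_add_Pythagorean[OF orth_r[OF this]]
    have pyth: "(norm (x j - X *\<^sub>R d))\<^sup>2 = (norm (n1 j - X *\<^sub>R d))\<^sup>2 + (norm r)\<^sup>2"
      unfolding decomp .
    have "norm (n1 j - X *\<^sub>R d) \<le> norm (x j - X *\<^sub>R d)" "norm r \<le> norm (x j - X *\<^sub>R d)"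
      unfolding pyth by (rule power2_le_imp_le; simp add: pyth)+
    then have nd: "norm (n1 j - X *\<^sub>R d) \<le> \<delta> / 2 * X" and nr: "norm r \<le> \<delta> / 2 * X"
      using xd by linarith+
    have "orthogonal (n2 j) (p j)" using p[of j] n2N by (simp add: P_def orthogonal_commute)
    from norm_add_Pythagorean[OF this] have pyth2: "(norm r)\<^sup>2 = (norm (n2 j))\<^sup>2 + (norm (p j))\<^sup>2"
      by (simp add: r_def)
    have n2r: "norm (n2 j) \<le> norm r" and pr: "norm (p j) \<le> norm r"
      by (rule power2_le_imp_le; simp add: pyth2)+
    have n1X: "norm (n1 j) \<le> X"
    proof -
      have xr: "x j = n1 j + r" by (simp add: xj r_def)
      have "X\<^sup>2 = (norm (n1 j))\<^sup>2 + (norm r)\<^sup>2"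
        unfolding X_def xr by (rule norm_add_Pythagorean[OF orth_r[OF n1[of j]]])
      then have "(norm (n1 j))\<^sup>2 \<le> X\<^sup>2" by simp
      then show ?thesis by (rule power2_le_imp_le) (use X in simp)
    qed
    define \<pi> where "\<pi> = norm (p j)"
    define \<nu> where "\<nu> = norm (n2 j)"
    define q where "q = slope (n1 j) (x j)"
    \<comment> \<open>The projection n1 has the same limit direction as x and lies in S, so it is in C eventually.\<close>
    have n1C: "n1 j \<in> C"
    proof -
      define w where "w = (1 / X) *\<^sub>R (n1 j - X *\<^sub>R d)"
      have "norm w = norm (n1 j - X *\<^sub>R d) / X" using X by (simp only: w_def norm_scaleR) simp
      also have "\<dots> \<le> (\<delta> / 2 * X) / X" using nd X by (intro divide_right_mono) auto
      also have "\<dots> \<le> \<eta>" using X \<delta> by simp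
      finally have "norm w \<le> \<eta>" .
      moreover have "w \<in> S"
        unfolding w_def using S NS[OF n1N] dS by (intro subspace_scale subspace_diff)
      ultimately have "X *\<^sub>R (d + w) \<in> C" using \<eta>(2) X by (intro poly_cone_scale) auto
      moreover have "X *\<^sub>R (d + w) = n1 j" using X by (simp add: w_def scaleR_add_right)
      ultimately show ?thesis by simp
    qed
    have xSj: "x j \<in> S" using xS by (simp add: S_def)
    have q0: "q \<ge> 0" unfolding q_def
      using n1[of j] by (intro slope_nonneg n1C nnn n1N x_cone x_int) (simp add: nnp[OF n1N xSj] N1_def)
    have q_eq: "q = 3 * T (n1 j) (p j) (p j) + 2 * B (n1 j) (p j) + L (n1 j)"
      using nnn[OF n1N] nnp[OF n1N NS[OF n2N]] nnp[OF n1N pS] nnp'[OF n1N n2N pS] nnp[OF n2N NS[OF n1N]]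
        kerB[OF n1 n2N] kerB[OF n1 n1N]
      unfolding q_def slope_def xj
      by (simp add: form_linear T_swap23[of "n1 j" "n2 j" "n1 j"] T_swap23[of "n1 j" "p j" "n1 j"]
          T_swap23[of "n1 j" "p j" "n2 j"] T_swap12[of "n1 j" "n2 j" "n2 j"] T_swap23[of "n2 j" "n1 j" "n2 j"])
    have f_eq: "cubic (x j) = q + 3 * T (n2 j) (p j) (p j) + T (p j) (p j) (p j) + B (n2 j) (n2 j)
        + 2 * B (n2 j) (p j) + B (p j) (p j) + L (n2 j) + L (p j)"
    proof -
      let ?a = "n1 j" and ?b = "n2 j" and ?c = "p j"
      have z: "T ?a ?a ?a = 0" "T ?a ?a ?b = 0" "T ?a ?a ?c = 0" "T ?a ?b ?b = 0" "T ?a ?b ?c = 0"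
        "T ?b ?b ?b = 0" "T ?b ?b ?c = 0" "B ?a ?a = 0" "B ?a ?b = 0"
        using nnn[OF n1N] nnp[OF n1N NS[OF n2N]] nnp[OF n1N pS] nnp'[OF n1N n2N pS]
          nnp[OF n2N NS[OF n1N]] nnn[OF n2N] nnp[OF n2N pS] kerB[OF n1 n2N] kerB[OF n1 n1N]
        by (simp_all add: T_swap12[of "n1 j" "n2 j" "n2 j"] T_swap23[of "n2 j" "n1 j" "n2 j"])
      have sw: "T ?a ?b ?a = T ?a ?a ?b" "T ?b ?a ?a = T ?a ?a ?b" "T ?a ?c ?a = T ?a ?a ?c"
        "T ?c ?a ?a = T ?a ?a ?c" "T ?b ?a ?b = T ?a ?b ?b" "T ?b ?b ?a = T ?a ?b ?b"
        "T ?b ?c ?b = T ?b ?b ?c" "T ?c ?b ?b = T ?b ?b ?c"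
        "T ?c ?a ?c = T ?a ?c ?c" "T ?c ?c ?a = T ?a ?c ?c" "T ?c ?b ?c = T ?b ?c ?c" "T ?c ?c ?b = T ?b ?c ?c"
        "T ?a ?c ?b = T ?a ?b ?c" "T ?b ?a ?c = T ?a ?b ?c" "T ?b ?c ?a = T ?a ?b ?c"
        "T ?c ?a ?b = T ?a ?b ?c" "T ?c ?b ?a = T ?a ?b ?c"
        "B ?b ?a = B ?a ?b" "B ?c ?a = B ?a ?c" "B ?c ?b = B ?b ?c"
        by (simp_all add: T_swap12 T_swap23 B_swap)
      show ?thesis unfolding cubic_def q_eq xj by (simp add: form_linear z sw)
    qed
    have TdP: "T (n1 j) (p j) (p j) \<ge> c / 2 * X * \<pi>\<^sup>2"
    proof -
      have "T (n1 j) (p j) (p j) = X * T d (p j) (p j) + T (n1 j - X *\<^sub>R d) (p j) (p j)"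
        by (simp add: form_linear form_diff)
      moreover have "X * T d (p j) (p j) \<ge> X * (c * \<pi>\<^sup>2)"
        using c(2)[OF p] X by (intro mult_left_mono) (auto simp: \<pi>_def)
      moreover have "\<bar>T (n1 j - X *\<^sub>R d) (p j) (p j)\<bar> \<le> c / 2 * X * \<pi>\<^sup>2"
      proof -
        have "\<bar>T (n1 j - X *\<^sub>R d) (p j) (p j)\<bar> \<le> M * norm (n1 j - X *\<^sub>R d) * \<pi> * \<pi>"
          using T_bound[of "n1 j - X *\<^sub>R d" "p j" "p j"] by (simp add: \<pi>_def)
        also have "\<dots> \<le> M * (\<delta> / 2 * X) * \<pi> * \<pi>"
          using nd M_nonneg by (intro mult_right_mono mult_left_mono) (auto simp: \<pi>_def)
        also have "\<dots> = (M * \<delta>) / 2 * X * \<pi>\<^sup>2" by (simp add: power2_eq_square)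
        also have "\<dots> \<le> c / 2 * X * \<pi>\<^sup>2"
        proof -
          have "0 \<le> M * \<delta>" using M_nonneg \<delta>(1) by simp
          then have "M * \<delta> / 2 \<le> c / 2" using \<delta>c by simp
          then show ?thesis using X by (intro mult_right_mono) auto
        qed
        finally show ?thesis .
      qed
      moreover have "X * (c * \<pi>\<^sup>2) = 2 * (c / 2 * X * \<pi>\<^sup>2)" by simp
      ultimately show ?thesis by linarith
    qed
    have B1: "B (n1 j) (p j) \<ge> - (M * X * \<pi>)" "L (n1 j) \<ge> - (M * X)"
    proof -
      have "M * norm (n1 j) * \<pi> \<le> M * X * \<pi>" "M * norm (n1 j) \<le> M * X"
        using n1X M_nonneg by (auto intro!: mult_right_mono mult_left_mono simp: \<pi>_def)
      then show "B (n1 j) (p j) \<ge> - (M * X * \<pi>)" "L (n1 j) \<ge> - (M * X)"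
        using B_bound[of "n1 j" "p j"] L_bound[of "n1 j"] unfolding \<pi>_def by linarith+
    qed
    have q1: "c * X * \<pi>\<^sup>2 - 2 * M * X * \<pi> - M * X \<le> q"
    proof -
      have "0 \<le> c * X * \<pi>\<^sup>2" using c(1) X by simp
      then show ?thesis using TdP B1 unfolding q_eq by (simp add: mult.assoc)
    qed
    have "\<pi> \<le> \<delta>' * X" "\<nu> \<le> \<delta>' * X"
    proof -
      have "\<delta> / 2 * X \<le> \<delta>' * X" using \<delta> X by (intro mult_right_mono) auto
      then show "\<pi> \<le> \<delta>' * X" "\<nu> \<le> \<delta>' * X" using nr n2r pr by (auto simp: \<pi>_def \<nu>_def)
    qed
    then have Kle: "K \<le> q - 3 * M * \<nu> * \<pi>\<^sup>2 - M * \<pi> ^ 3 + c' * \<nu>\<^sup>2 - 2 * M * \<nu> * \<pi> - M * \<pi>\<^sup>2 - M * \<nu> - M * \<pi>"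
      using X q0 q1 by (intro K) (auto simp: \<pi>_def \<nu>_def)
    have "T (n2 j) (p j) (p j) \<ge> - (M * \<nu> * \<pi>\<^sup>2)" "T (p j) (p j) (p j) \<ge> - (M * \<pi> ^ 3)"
      "B (n2 j) (p j) \<ge> - (M * \<nu> * \<pi>)" "B (p j) (p j) \<ge> - (M * \<pi>\<^sup>2)" "L (n2 j) \<ge> - (M * \<nu>)" "L (p j) \<ge> - (M * \<pi>)"
      using T_bound[of "n2 j" "p j" "p j"] T_bound[of "p j" "p j" "p j"] B_bound[of "n2 j" "p j"]
        B_bound[of "p j" "p j"] L_bound[of "n2 j"] L_bound[of "p j"]
      by (auto simp: \<pi>_def \<nu>_def power2_eq_square power3_eq_cube mult.assoc)
    moreover have "B (n2 j) (n2 j) \<ge> c' * \<nu>\<^sup>2" using c'(2)[OF n2] by (simp add: \<nu>_def)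
    ultimately show ?case using Kle unfolding f_eq by simp
  qed
  then show False by (rule eventually_bounded_below_False)
qed

end

section \<open>Limit directions proportional to an integer vector\<close>

text \<open>What every sequence of natural numbers becomes on a subsequence. Common monotone subsequences are Dickson's
lemma; the dichotomy is what separates constraints along which the sequence stays from those that it
leaves.\<close>

definition steady :: "(nat \<Rightarrow> nat) \<Rightarrow> bool" where
  "steady s \<longleftrightarrow> incseq s \<and> ((\<forall>j. s j = s 0) \<or> filterlim s at_top sequentially)"

lemma steady_subseq:
  assumes "steady s" "strict_mono r"
  shows "steady (\<lambda>j. s (r j))"
  using assms filterlim_compose[OF _ filterlim_subseq[OF assms(2)], of s at_top]
  unfolding steady_def incseq_def by (metis strict_mono_less_eq)

lemma steady_subsequence:
  fixes s :: "nat \<Rightarrow> nat"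
  obtains r where "strict_mono r" "steady (\<lambda>j. s (r j))"
proof (cases "finite (range s)")
  case True
  then obtain v where "infinite {j. s j = v}"
    using pigeonhole_infinite[of "UNIV :: nat set" s] by auto
  then obtain r :: "nat \<Rightarrow> nat" where "strict_mono r" "\<And>j. r j \<in> {j. s j = v}"
    by (metis infinite_enumerate)
  then show thesis using that[of r] by (simp add: steady_def incseq_def)
next
  case False
  have "\<exists>j'>j. s j < s j'" for j
  proof (rule ccontr)
    assume "\<not> ?thesis"
    then have after: "s i \<le> s j" if "i > j" for i using that by (metis not_le)
    have "s i \<le> Max (s ` {..j})" for i
    proof (cases "i \<le> j")
      case False
      have "s j \<le> Max (s ` {..j})" by simp
      then show ?thesis using after[of i] False by linarith
    qed auto
    then have "range s \<subseteq> {..Max (s ` {..j})}" by auto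
    then show False using False finite_subset by blast
  qed
  then obtain g where g: "\<And>j. g j > j" "\<And>j. s j < s (g j)" by metis
  define r where "r j = (g ^^ j) 0" for j
  have r: "r (Suc j) > r j" "s (r (Suc j)) > s (r j)" for j by (simp_all add: r_def g)
  have mono: "strict_mono (\<lambda>j. s (r j))" using r(2) by (simp add: strict_mono_Suc_iff)
  then have "filterlim (\<lambda>j. s (r j)) at_top sequentially" by (rule filterlim_subseq)
  moreover have "strict_mono r" using r(1) by (simp add: strict_mono_Suc_iff)
  ultimately show thesis using that[of r] mono strict_mono_mono by (auto simp: steady_def)
qed

lemma common_steady_subsequence:
  fixes s :: "nat \<Rightarrow> 'a"
  assumes "finite \<Omega>"
  shows "\<exists>r. strict_mono r \<and> (\<forall>\<phi>\<in>\<Omega>. steady (\<lambda>j. \<phi> (s (r j))))"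
  using assms
proof (induction \<Omega>)
  case empty
  then show ?case using strict_mono_id by auto
next
  case (insert \<phi> \<Omega>)
  then obtain r where r: "strict_mono r" "\<And>\<phi>. \<phi> \<in> \<Omega> \<Longrightarrow> steady (\<lambda>j. \<phi> (s (r j)))" by blast
  obtain r' where r': "strict_mono r'" "steady (\<lambda>j. \<phi> (s (r (r' j))))"
    by (rule steady_subsequence[of "\<lambda>j. \<phi> (s (r j))"])
  have "strict_mono (\<lambda>j. r (r' j))" using r(1) r'(1) by (simp add: strict_mono_def)
  then show ?case
    using r'(2) steady_subseq[OF r(2) r'(1)] by blast
qed

text \<open>Gordan's lemma: the integer points of a rational cone are generated by the finitely many elements that are
minimal and nonzero in the order that compares positive parts, negative parts and slacks. By Dickson's
lemma an infinite set of integer points contains two comparable ones, so there are only finitely many minimal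
ones. The conclusion is stated as a descent step, with a measure, because it is used for induction.\<close>

lemma hilbert_basis:
  fixes a :: "nat \<Rightarrow> real ^ 'n"
  assumes a: "\<And>i. i < m \<Longrightarrow> a i \<in> integer_points"
  shows "\<exists>H (\<mu> :: real ^ 'n \<Rightarrow> nat). finite H \<and> H \<subseteq> poly_cone a m \<inter> integer_points \<and>
    (\<forall>y\<in>poly_cone a m \<inter> integer_points. y \<noteq> 0 \<longrightarrow>
      (\<exists>v\<in>H. y - v \<in> poly_cone a m \<inter> integer_points \<and> \<mu> (y - v) < \<mu> y))"
proof -
  define K where "K = poly_cone a m \<inter> integer_points"
  define pos where "pos i x = nat \<lfloor>x $ i\<rfloor>" for i :: 'n and x :: "real ^ 'n"
  define neg where "neg i x = nat \<lfloor>- x $ i\<rfloor>" for i :: 'n and x :: "real ^ 'n"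
  define slk where "slk i x = nat \<lfloor>- (a i \<bullet> x)\<rfloor>" for i and x :: "real ^ 'n"
  define \<Omega> where "\<Omega> = range pos \<union> range neg \<union> slk ` {..<m}"
  have fin: "finite \<Omega>" by (simp add: \<Omega>_def)
  define \<mu> where "\<mu> x = (\<Sum>\<phi>\<in>\<Omega>. \<phi> x)" for x
  define le where "le x y \<longleftrightarrow> (\<forall>\<phi>\<in>\<Omega>. \<phi> x \<le> \<phi> y)" for x y
  have coord: "x $ i = real (pos i x) - real (neg i x)" if "x \<in> integer_points" for x i
  proof -
    have "x $ i \<in> \<int>" using that by (simp add: integer_points_def)
    then obtain k where "x $ i = of_int k" by (rule Ints_cases)
    then show ?thesis by (simp add: pos_def neg_def)
  qed
  have eqI: "x = y" if "x \<in> integer_points" "y \<in> integer_points" "\<And>\<phi>. \<phi> \<in> \<Omega> \<Longrightarrow> \<phi> x = \<phi> y" for x y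
  proof -
    have "pos i x = pos i y" "neg i x = neg i y" for i using that(3) by (auto simp: \<Omega>_def)
    then show ?thesis using coord[OF that(1)] coord[OF that(2)] by (simp add: vec_eq_iff)
  qed
  have \<mu>_less: "\<mu> x < \<mu> y" if xy: "x \<in> integer_points" "y \<in> integer_points" "le x y" "x \<noteq> y" for x y
  proof -
    obtain \<phi> where "\<phi> \<in> \<Omega>" "\<phi> x \<noteq> \<phi> y" using eqI xy by blast
    then show ?thesis unfolding \<mu>_def
      using xy(3) fin by (intro sum_strict_mono_ex1) (auto simp: le_def intro!: bexI[of _ \<phi>] le_neq_implies_less)
  qed
  define H where "H = {v \<in> K - {0}. \<forall>w\<in>K - {0}. le w v \<longrightarrow> w = v}"
  have below: "\<exists>v\<in>H. le v y" if "y \<in> K - {0}" for y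
    using that
  proof (induction "\<mu> y" arbitrary: y rule: less_induct)
    case less
    show ?case
    proof (cases "y \<in> H")
      case True
      then show ?thesis by (auto simp: le_def)
    next
      case False
      then obtain w where w: "w \<in> K - {0}" "le w y" "w \<noteq> y" using less.prems by (auto simp: H_def)
      have "\<mu> w < \<mu> y" using w less.prems by (intro \<mu>_less) (auto simp: K_def)
      from less.hyps[OF this w(1)] show ?thesis using w(2) by (auto simp: le_def intro: order_trans)
    qed
  qed
  have "finite H"
  proof (rule ccontr)
    assume "infinite H"
    then obtain s :: "nat \<Rightarrow> real ^ 'n" where s: "inj s" "range s \<subseteq> H" using infinite_countable_subset by blast
    obtain r where r: "strict_mono r" "\<And>\<phi>. \<phi> \<in> \<Omega> \<Longrightarrow> incseq (\<lambda>j. \<phi> (s (r j)))"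
      using common_steady_subsequence[OF fin, of s] unfolding steady_def by blast
    have "le (s (r 0)) (s (r 1))" using r(2) by (simp add: le_def incseq_def)
    moreover have "s (r 0) \<in> H" "s (r 1) \<in> H" using s(2) by auto
    ultimately have "s (r 0) = s (r 1)" unfolding H_def by blast
    then have "r 0 = r 1" using s(1) by (simp add: inj_eq)
    then show False using r(1) by (metis strict_mono_eq zero_neq_one)
  qed
  moreover have "H \<subseteq> K" by (auto simp: H_def)
  moreover have "\<exists>v\<in>H. y - v \<in> K \<and> \<mu> (y - v) < \<mu> y" if y: "y \<in> K" "y \<noteq> 0" for y
  proof -
    obtain v where v: "v \<in> H" "le v y" using below y by blast
    have vK: "v \<in> K" "v \<noteq> 0" using v(1) by (auto simp: H_def)
    have yi: "y \<in> integer_points" and vi: "v \<in> integer_points" using y vK by (auto simp: K_def)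
    have pn: "pos i (y - v) \<le> pos i y" "neg i (y - v) \<le> neg i y" for i
    proof -
      obtain k l where kl: "y $ i = of_int k" "v $ i = of_int l"
        using yi vi unfolding integer_points_def by (metis (mono_tags) Ints_cases mem_Collect_eq)
      have "pos i v \<le> pos i y" "neg i v \<le> neg i y" using v(2) by (auto simp: le_def \<Omega>_def)
      then show "pos i (y - v) \<le> pos i y" "neg i (y - v) \<le> neg i y"
        unfolding pos_def neg_def vector_minus_component kl of_int_diff[symmetric] of_int_minus[symmetric] floor_of_int
        by linarith+
    qed
    have slack: "a i \<bullet> v \<ge> a i \<bullet> y \<and> slk i (y - v) \<le> slk i y" if i: "i < m" for i
    proof -
      obtain k l where kl: "a i \<bullet> y = of_int k" "a i \<bullet> v = of_int l"
        using integer_points_inner[OF a[OF i] yi] integer_points_inner[OF a[OF i] vi]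
        by (metis Ints_cases)
      have "slk i v \<le> slk i y" using v(2) i by (auto simp: le_def \<Omega>_def)
      moreover have "a i \<bullet> y \<le> 0" "a i \<bullet> v \<le> 0" using y vK i by (auto simp: K_def poly_cone_def)
      ultimately show ?thesis
        unfolding slk_def inner_diff_right kl of_int_diff[symmetric] of_int_minus[symmetric] floor_of_int
        by simp linarith
    qed
    have yv: "y - v \<in> K"
      using slack integer_points_diff[OF yi vi] by (auto simp: K_def poly_cone_def inner_diff_right)
    have "le (y - v) y" using pn slack by (auto simp: le_def \<Omega>_def)
    then have "\<mu> (y - v) < \<mu> y" using yv yi vK by (intro \<mu>_less) (auto simp: K_def)
    then show ?thesis using v(1) yv by blast
  qed
  ultimately show ?thesis unfolding K_def by blast
qed

text \<open>An integer version of Hoffman's error bound. Expand x in the Hilbert basis; y collects the generators on which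
the functional vanishes, and e the others, whose norms are proportional to their values.\<close>

lemma hoffman_integer_decomposition:
  fixes a :: "nat \<Rightarrow> real ^ 'n" and \<theta> :: "real ^ 'n \<Rightarrow> real"
  assumes a: "\<And>i. i < m \<Longrightarrow> a i \<in> integer_points"
    and add: "\<And>v w. \<theta> (v + w) = \<theta> v + \<theta> w"
    and nonneg: "\<And>v. v \<in> poly_cone a m \<Longrightarrow> v \<in> integer_points \<Longrightarrow> \<theta> v \<ge> 0"
  shows "\<exists>c\<ge>0. \<forall>x\<in>poly_cone a m \<inter> integer_points.
    \<exists>y e. x = y + e \<and> y \<in> poly_cone a m \<and> y \<in> integer_points \<and> \<theta> y = 0 \<and> norm e \<le> c * \<theta> e"
proof -
  obtain H and \<mu> :: "real ^ 'n \<Rightarrow> nat" where H: "finite H" "H \<subseteq> poly_cone a m \<inter> integer_points"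
    and step: "\<And>y. y \<in> poly_cone a m \<inter> integer_points \<Longrightarrow> y \<noteq> 0 \<Longrightarrow>
      \<exists>v\<in>H. y - v \<in> poly_cone a m \<inter> integer_points \<and> \<mu> (y - v) < \<mu> y"
    using hilbert_basis[of m a, OF a] by blast
  define c where "c = (\<Sum>v\<in>H. norm v / \<theta> v)"
  have \<theta>H: "\<theta> v \<ge> 0" if "v \<in> H" for v using nonneg that H(2) by blast
  have c: "norm v \<le> c * \<theta> v" if "v \<in> H" "\<theta> v \<noteq> 0" for v
  proof -
    have "norm v / \<theta> v \<le> c" unfolding c_def
      using H(1) that(1) \<theta>H by (intro member_le_sum) auto
    then show ?thesis using \<theta>H[OF that(1)] that(2) by (simp add: field_simps)
  qed
  have \<theta>0: "\<theta> 0 = 0" using add[of 0 0] by simp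
  have "\<exists>y e. x = y + e \<and> y \<in> poly_cone a m \<and> y \<in> integer_points \<and> \<theta> y = 0 \<and> norm e \<le> c * \<theta> e"
    if "x \<in> poly_cone a m \<inter> integer_points" for x
    using that
  proof (induction "\<mu> x" arbitrary: x rule: less_induct)
    case less
    show ?case
    proof (cases "x = 0")
      case True
      then show ?thesis by (intro exI[of _ 0]) (simp add: \<theta>0)
    next
      case False
      obtain v where v: "v \<in> H" "x - v \<in> poly_cone a m \<inter> integer_points" "\<mu> (x - v) < \<mu> x"
        using step[OF less.prems False] by blast
      obtain y e where ye: "x - v = y + e" "y \<in> poly_cone a m" "y \<in> integer_points" "\<theta> y = 0"
        "norm e \<le> c * \<theta> e" using less.hyps[OF v(3,2)] by blast
      show ?thesis
      proof (cases "\<theta> v = 0")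
        case True
        then show ?thesis using ye v(1) H(2)
          by (intro exI[of _ "y + v"] exI[of _ e])
            (auto simp: add algebra_simps intro: poly_cone_add integer_points_add)
      next
        case False
        have "norm (e + v) \<le> c * \<theta> (e + v)"
          using norm_triangle_ineq[of e v] ye(5) c[OF v(1) False] by (simp add: add algebra_simps)
        then show ?thesis using ye
          by (intro exI[of _ y] exI[of _ "e + v"]) (auto simp: algebra_simps)
      qed
    qed
  qed
  moreover have "c \<ge> 0" unfolding c_def using \<theta>H by (intro sum_nonneg) auto
  ultimately show ?thesis by blast
qed

context rayless_sequence
begin

text \<open>With z the integer vector along d, f(x) - f(x - z) equals \<open>slope z x - 3 T z z x\<close>. If \<open>T z z x = 0\<close> this is
nonnegative by \<open>slope_nonneg\<close>. In general \<open>T z z\<close> is nonnegative on C; split x = y + e with \<open>T z z y = 0\<close> and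
e no larger than a multiple of \<open>T z z x\<close>. Then \<open>slope z y \<ge> 0\<close>, and the leading contribution of e is
\<open>T z z x\<close> times the norm of x, up to a positive factor, which outweighs everything else. So a step by -z
does not increase f, against \<open>descent\<close>.\<close>

lemma integral_direction_contradiction:
  assumes z: "z = \<rho> *\<^sub>R d" "\<rho> > 0"
    and descent: "\<forall>\<^sub>F j in sequentially. cubic (x j) < cubic (x j - z)"
  shows False
proof -
  have zC: "z \<in> C" using z d_cone by (simp add: poly_cone_scale)
  have Tzzz: "T z z z = 0" and Bzz: "B z z = 0" by (simp_all add: z form_linear Tddd Bdd)
  define \<theta> where "\<theta> = T z z"
  have \<theta>_nonneg: "\<theta> v \<ge> 0" if "v \<in> C" for v
    unfolding \<theta>_def using that by (intro T_tangent_nonneg(1) zC Tzzz poly_cone_tangent)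
  obtain c where c: "c \<ge> 0" and dec: "\<And>x. x \<in> C \<Longrightarrow> x \<in> integer_points \<Longrightarrow>
    \<exists>y e. x = y + e \<and> y \<in> C \<and> y \<in> integer_points \<and> \<theta> y = 0 \<and> norm e \<le> c * \<theta> e"
  proof -
    have "\<theta> (v + w) = \<theta> v + \<theta> w" for v w by (simp add: \<theta>_def form_linear)
    from hoffman_integer_decomposition[of m a \<theta>, OF a_int this \<theta>_nonneg] show thesis
      using that by (metis IntI)
  qed
  define h where "h = M * norm z"
  have h: "h \<ge> 0" using M_nonneg by (simp add: h_def)
  define C1 where "C1 = 6 * h * c + 3 * h * c * (c * (h * norm z))"
  have C1: "C1 \<ge> 0" using h c by (simp add: C1_def)
  define \<delta> where "\<delta> = 3 / (\<rho> * (C1 + 1))"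
  have \<delta>: "\<delta> > 0" using z C1 by (simp add: \<delta>_def)
  have \<delta>C1: "\<delta> * C1 \<le> 3 / \<rho>"
  proof -
    have "\<delta> * C1 \<le> \<delta> * (C1 + 1)" using \<delta> by simp
    also have "\<dots> = 3 / \<rho>"
      using z(2) C1 nonzero_mult_divide_mult_cancel_right[of "C1 + 1" 3 \<rho>] by (simp add: \<delta>_def)
    finally show ?thesis .
  qed
  define R where "R = max 1 (\<rho> * (2 * h * c + 3) / 3)"
  have "\<forall>\<^sub>F j in sequentially. False"
    using descent x_near_dir[OF \<delta>] eventually_norm_ge[of R]
  proof eventually_elim
    case (elim j)
    define X where "X = norm (x j)"
    define w where "w = x j - X *\<^sub>R d"
    have X: "X \<ge> 1" "X \<ge> \<rho> * (2 * h * c + 3) / 3" using elim by (auto simp: R_def X_def)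
    have w: "norm w \<le> \<delta> * X" using elim by (simp add: w_def X_def)
    obtain y e where ye: "x j = y + e" "y \<in> C" "y \<in> integer_points" "\<theta> y = 0" "norm e \<le> c * \<theta> e"
      using dec[OF x_cone x_int] by blast
    define t where "t = \<theta> e"
    have \<theta>x: "\<theta> (x j) = t" using ye by (simp add: t_def \<theta>_def form_linear)
    have t0: "t \<ge> 0" using \<theta>_nonneg[OF x_cone, of j] \<theta>x by simp
    have e: "norm e \<le> c * t" using ye by (simp add: t_def)
    have "T z z d = 0" using z Tddd by (simp add: form_linear)
    then have "t = T z z w" using \<theta>x by (simp add: w_def form_diff form_linear \<theta>_def)
    also have "\<dots> \<le> h * norm z * norm w" using T_bound[of z z w] by (simp add: h_def)
    also have "\<dots> \<le> h * norm z * (\<delta> * X)" using w h by (intro mult_left_mono) auto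
    finally have tX: "t \<le> h * norm z * (\<delta> * X)" .
    have slope_eq: "slope z (x j) = slope z y + 6 * T z (x j) e - 3 * T z e e + 2 * B z e"
      using ye(1) by (simp add: slope_def form_linear T_swap23[of z e y])
    have Tze: "T z (x j) e = X / \<rho> * t + T z w e"
    proof -
      have "x j = (X / \<rho>) *\<^sub>R z + w" using z by (simp add: w_def)
      then show ?thesis by (simp add: form_linear t_def \<theta>_def)
    qed
    have "h * norm w * norm e \<le> h * (\<delta> * X) * (c * t)" "h * norm e * norm e \<le> h * (c * t) * (c * (h * norm z * (\<delta> * X)))"
      "h * norm e \<le> h * (c * t)"
    proof -
      have "norm e \<le> c * (h * norm z * (\<delta> * X))"
        using e mult_left_mono[OF tX c] by linarith
      then show "h * norm w * norm e \<le> h * (\<delta> * X) * (c * t)"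
        "h * norm e * norm e \<le> h * (c * t) * (c * (h * norm z * (\<delta> * X)))"
        "h * norm e \<le> h * (c * t)"
        using w e h c t0 \<delta> X by (auto intro!: mult_mono mult_nonneg_nonneg)
    qed
    moreover define b1 b2 b3 where "b1 = h * (\<delta> * X) * (c * t)"
      and "b2 = h * (c * t) * (c * (h * norm z * (\<delta> * X)))" and "b3 = h * (c * t)"
    ultimately have "T z w e \<ge> - b1" "T z e e \<le> b2" "B z e \<ge> - b3"
      using T_bound[of z w e] T_bound[of z e e] B_bound[of z e] unfolding h_def by linarith+
    moreover have "slope z y \<ge> 0"
      using ye(4) by (intro slope_nonneg zC Tzzz ye(2,3)) (simp add: Bzz \<theta>_def)
    ultimately have "slope z (x j) \<ge> 6 * (X / \<rho> * t) - 6 * b1 - 3 * b2 - 2 * b3"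
      unfolding slope_eq Tze by argo
    also have "6 * (X / \<rho> * t) - 6 * b1 - 3 * b2 - 2 * b3 = t * (6 / \<rho> * X - \<delta> * C1 * X - 2 * h * c)"
      by (simp add: C1_def b1_def b2_def b3_def algebra_simps)
    finally have "slope z (x j) \<ge> t * (6 / \<rho> * X - \<delta> * C1 * X - 2 * h * c)" .
    moreover have "6 / \<rho> * X - \<delta> * C1 * X - 2 * h * c \<ge> 3"
    proof -
      have "\<delta> * C1 * X \<le> 3 / \<rho> * X" using \<delta>C1 X by (intro mult_right_mono) auto
      moreover have "3 / \<rho> * X \<ge> 2 * h * c + 3" using X(2) z by (simp add: field_simps)
      moreover have "6 / \<rho> * X = 2 * (3 / \<rho> * X)" by simp
      ultimately show ?thesis by linarith
    qed
    ultimately have "slope z (x j) \<ge> 3 * t"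
      using mult_left_mono[OF _ t0, of 3] by (smt (verit, best) mult.commute)
    moreover have "cubic (x j - z) - cubic (x j) = 3 * t - slope z (x j)"
      using cubic_add_scaled[of "x j" "-1" z] \<theta>x by (simp add: Tzzz Bzz \<theta>_def)
    ultimately show False using elim(1) by linarith
  qed
  then show False by simp
qed

end

section \<open>Lower bounds for ternary cubics far out along an axis\<close>

text \<open>For small \<delta> this says that t is much larger than s and r, and that r is large. It holds eventually, for
every \<delta>, for the coordinates of a sequence with limit direction d.\<close>

definition region :: "real \<Rightarrow> real \<Rightarrow> real \<Rightarrow> real \<Rightarrow> bool" where
  "region \<delta> t s r \<longleftrightarrow> \<bar>s\<bar> \<le> \<delta> * t \<and> 0 \<le> r \<and> r \<le> \<delta> * t \<and> 1 \<le> \<delta> * r"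

lemma region_mono:
  assumes "region \<delta> t s r" "0 < \<delta>" "\<delta> \<le> \<delta>'"
  shows "region \<delta>' t s r"
proof -
  have "t \<ge> 0" using assms by (auto simp: region_def) (meson order_trans zero_le_mult_iff not_less)
  then have "\<delta> * t \<le> \<delta>' * t" "\<delta> * r \<le> \<delta>' * r" using assms by (auto simp: region_def intro!: mult_right_mono)
  then show ?thesis using assms(1) unfolding region_def by linarith
qed

lemma regionD:
  assumes "region \<delta> t s r" "0 < \<delta>" "\<delta> \<le> 1"
  shows "t \<ge> 1" "r \<ge> 1" "1 \<le> \<delta> * t" "1 \<le> \<delta> * r" "\<bar>s\<bar> \<le> \<delta> * t" "r \<le> \<delta> * t" "\<bar>s\<bar> \<le> t" "r \<le> t"
proof -
  have a: "\<bar>s\<bar> \<le> \<delta> * t" "0 \<le> r" "r \<le> \<delta> * t" "1 \<le> \<delta> * r" using assms(1) by (auto simp: region_def)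
  have "\<delta> * r \<le> 1 * r" using a assms by (intro mult_right_mono) auto
  then have r: "r \<ge> 1" using a by linarith
  then have dt: "1 \<le> \<delta> * t" using a by linarith
  then have "t > 0" using assms(2) by (smt (verit) mult_nonneg_nonpos)
  then have dt': "\<delta> * t \<le> 1 * t" using assms by (intro mult_right_mono) auto
  show "t \<ge> 1" "r \<ge> 1" "1 \<le> \<delta> * t" "1 \<le> \<delta> * r" "\<bar>s\<bar> \<le> \<delta> * t" "r \<le> \<delta> * t" "\<bar>s\<bar> \<le> t" "r \<le> t"
    using a r dt dt' by linarith+
qed

text \<open>The filter of these regions as \<delta> tends to zero. It turns domination arguments into limits: dividing a cubic by its
dominating monomial leaves a polynomial in the four ratios defined below, which all tend to zero, so only
the coefficient of the dominating monomial survives.\<close>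

definition far_out :: "(real \<times> real \<times> real) filter" where
  "far_out = (INF \<delta>\<in>{0<..}. principal {(t, s, r). region \<delta> t s r})"

lemma eventually_far_out:
  "eventually (\<lambda>(t, s, r). P t s r) far_out \<longleftrightarrow> (\<exists>\<delta>>0. \<forall>t s r. region \<delta> t s r \<longrightarrow> P t s r)"
  unfolding far_out_def
proof (subst eventually_INF_base)
  fix \<delta> \<delta>' :: real assume "\<delta> \<in> {0<..}" "\<delta>' \<in> {0<..}"
  then show "\<exists>\<epsilon>\<in>{0<..}. principal {(t, s, r). region \<epsilon> t s r} \<le>
      inf (principal {(t, s, r). region \<delta> t s r}) (principal {(t, s, r). region \<delta>' t s r})"
    using region_mono[of "min \<delta> \<delta>'"] by (intro bexI[of _ "min \<delta> \<delta>'"]) auto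
qed (auto simp: eventually_principal)

lemma far_out_pos: "\<forall>\<^sub>F (t, s, r) in far_out. 0 < t \<and> 0 < r"
  unfolding eventually_far_out using regionD(1,2)[of 1] by (intro exI[of _ 1]) force

definition st :: "real \<times> real \<times> real \<Rightarrow> real" where "st = (\<lambda>(t, s, r). s / t)"
definition rt :: "real \<times> real \<times> real \<Rightarrow> real" where "rt = (\<lambda>(t, s, r). r / t)"
definition it :: "real \<times> real \<times> real \<Rightarrow> real" where "it = (\<lambda>(t, s, r). 1 / t)"
definition ir :: "real \<times> real \<times> real \<Rightarrow> real" where "ir = (\<lambda>(t, s, r). 1 / r)"

lemmas ratio_defs = st_def rt_def it_def ir_def

lemma ratio_limits:
  "(st \<longlongrightarrow> 0) far_out" "(rt \<longlongrightarrow> 0) far_out" "(it \<longlongrightarrow> 0) far_out" "(ir \<longlongrightarrow> 0) far_out"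
proof -
  have *: "((\<lambda>(t, s, r). f t s r / g t s r) \<longlongrightarrow> 0) far_out"
    if fg: "\<And>\<delta> t s r. region \<delta> t s r \<Longrightarrow> 0 < \<delta> \<Longrightarrow> \<delta> \<le> 1 \<Longrightarrow> \<bar>f t s r\<bar> \<le> \<delta> * g t s r \<and> g t s r \<ge> 1"
    for f g :: "real \<Rightarrow> real \<Rightarrow> real \<Rightarrow> real"
  proof (rule tendstoI)
    fix e :: real assume e: "e > 0"
    define \<delta> where "\<delta> = min 1 (e / 2)"
    have \<delta>: "0 < \<delta>" "\<delta> \<le> 1" "\<delta> < e" using e by (auto simp: \<delta>_def)
    have "\<forall>\<^sub>F (t, s, r) in far_out. \<bar>f t s r / g t s r\<bar> < e"
      unfolding eventually_far_out
    proof (intro exI[of _ \<delta>] conjI allI impI)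
      fix t s r assume "region \<delta> t s r"
      from fg[OF this \<delta>(1,2)] have "\<bar>f t s r / g t s r\<bar> \<le> \<delta>" by (simp add: divide_le_eq)
      then show "\<bar>f t s r / g t s r\<bar> < e" using \<delta> by linarith
    qed (use \<delta> in simp)
    then show "\<forall>\<^sub>F p in far_out. dist (case p of (t, s, r) \<Rightarrow> f t s r / g t s r) 0 < e"
      by eventually_elim (auto simp: dist_norm)
  qed
  show "(st \<longlongrightarrow> 0) far_out" unfolding st_def by (rule *) (use regionD in blast)
  show "(rt \<longlongrightarrow> 0) far_out" unfolding rt_def by (rule *) (use regionD in fastforce)
  show "(it \<longlongrightarrow> 0) far_out" unfolding it_def by (rule *) (use regionD in fastforce)
  show "(ir \<longlongrightarrow> 0) far_out" unfolding ir_def by (rule *) (use regionD in fastforce)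
qed

text \<open>The term \<open>t s\<^sup>2\<close> need not be dominated by \<open>t\<^sup>2 r\<close>, but it has the right sign and takes care of \<open>s ^ 3\<close>.\<close>

lemma dominated_by_ttr:
  fixes c :: real
  assumes "c > 0" "p1 \<ge> 0" "p1 = 0 \<Longrightarrow> q1 = 0"
  shows "\<exists>\<delta>>0. \<forall>t s r. region \<delta> t s r \<longrightarrow> 0 \<le> c * (t\<^sup>2 * r) + p1 * (t * s\<^sup>2) + p2 * (t * s * r) + p3 * (t * r\<^sup>2)
    + q1 * s ^ 3 + q2 * (s\<^sup>2 * r) + q3 * (s * r\<^sup>2) + q4 * r ^ 3 + b1 * (t * s) + b2 * (t * r)
    + e1 * s\<^sup>2 + e2 * (s * r) + e3 * r\<^sup>2 + l1 * t + l2 * s + l3 * r"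
proof -
  have 1: "((\<lambda>p. c + p2 * st p + p3 * rt p + q2 * (st p)\<^sup>2 + q3 * (st p * rt p) + q4 * (rt p)\<^sup>2
    + b1 * (st p * ir p) + b2 * it p + e1 * ((st p)\<^sup>2 * ir p) + e2 * (st p * it p) + e3 * (rt p * it p)
    + l1 * (it p * ir p) + l2 * (st p * it p * ir p) + l3 * (it p)\<^sup>2) \<longlongrightarrow> c) far_out"
    by (auto intro!: tendsto_eq_intros ratio_limits)
  have 2: "\<forall>\<^sub>F p in far_out. 0 \<le> p1 + q1 * st p"
  proof (cases "p1 = 0")
    case False
    have "((\<lambda>p. p1 + q1 * st p) \<longlongrightarrow> p1) far_out" by (auto intro!: tendsto_eq_intros ratio_limits)
    moreover have "0 < p1" using False assms(2) by simp
    ultimately have "\<forall>\<^sub>F p in far_out. 0 < p1 + q1 * st p" by (rule order_tendstoD(1))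
    then show ?thesis by eventually_elim simp
  qed (use assms in simp)
  from order_tendstoD(1)[OF 1 assms(1)] 2 far_out_pos show ?thesis
    unfolding eventually_far_out[symmetric]
  proof eventually_elim
    case (elim p)
    obtain t s r where p: "p = (t, s, r)" by (cases p) auto
    have "0 \<le> t\<^sup>2 * r" "0 \<le> t * s\<^sup>2" using elim(3) by (auto simp: p)
    from mult_nonneg_nonneg[OF this(1) less_imp_le[OF elim(1)]] mult_nonneg_nonneg[OF this(2) elim(2)]
    show ?case
      using elim(3) by (simp add: p ratio_defs field_simps power2_eq_square power3_eq_cube)
  qed
qed

text \<open>The ratio of s and r is not controlled. Divided by t, the cubic is a quadratic form in s and r whose coefficients
tend to those of a positive definite form.\<close>

lemma dominated_by_tss_trr:
  fixes p1 p3 :: real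
  assumes "p1 > 0" "p3 > 0"
  shows "\<exists>\<delta>>0. \<forall>t s r. region \<delta> t s r \<longrightarrow> 0 \<le> p1 * (t * s\<^sup>2) + p3 * (t * r\<^sup>2)
    + q1 * s ^ 3 + q2 * (s\<^sup>2 * r) + q3 * (s * r\<^sup>2) + q4 * r ^ 3 + b1 * (t * s) + b2 * (t * r)
    + e1 * s\<^sup>2 + e2 * (s * r) + e3 * r\<^sup>2 + l1 * t + l2 * s + l3 * r"
proof -
  let ?a = "\<lambda>p. p1 + q1 * st p + q2 * rt p + e1 * it p"
  let ?b = "\<lambda>p. q3 * rt p + b1 * ir p + e2 * it p + l2 * (it p * ir p)"
  let ?c = "\<lambda>p. p3 + q4 * rt p + b2 * ir p + e3 * it p + l1 * (ir p)\<^sup>2 + l3 * (it p * ir p)"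
  have a: "(?a \<longlongrightarrow> p1) far_out" and disc: "((\<lambda>p. 4 * ?a p * ?c p - (?b p)\<^sup>2) \<longlongrightarrow> 4 * p1 * p3) far_out"
    by (auto intro!: tendsto_eq_intros ratio_limits)
  have "4 * p1 * p3 > 0" using assms by simp
  from order_tendstoD(1)[OF a assms(1)] order_tendstoD(1)[OF disc this] far_out_pos show ?thesis
    unfolding eventually_far_out[symmetric]
  proof eventually_elim
    case (elim p)
    obtain t s r where p: "p = (t, s, r)" by (cases p) auto
    define \<alpha> \<beta> \<gamma> where "\<alpha> = ?a p" and "\<beta> = ?b p" and "\<gamma> = ?c p"
    have \<alpha>: "\<alpha> > 0" and disc: "4 * \<alpha> * \<gamma> - \<beta>\<^sup>2 > 0" using elim(1,2) by (simp_all add: \<alpha>_def \<beta>_def \<gamma>_def)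
    have "0 \<le> ((2 * \<alpha> * s + \<beta> * r)\<^sup>2 + (4 * \<alpha> * \<gamma> - \<beta>\<^sup>2) * r\<^sup>2) / (4 * \<alpha>)" using \<alpha> disc by simp
    also have "\<dots> = \<alpha> * s\<^sup>2 + \<beta> * (s * r) + \<gamma> * r\<^sup>2" using \<alpha> by (simp add: field_simps power2_eq_square)
    finally have "0 \<le> t * (\<alpha> * s\<^sup>2 + \<beta> * (s * r) + \<gamma> * r\<^sup>2)" using elim(3) by (simp add: p)
    then show ?case
      using elim(3) by (simp add: p ratio_defs \<alpha>_def \<beta>_def \<gamma>_def field_simps power2_eq_square power3_eq_cube)
  qed
qed

text \<open>The monomials \<open>s\<^sup>2 r\<close> and \<open>s\<^sup>2\<close> need not be dominated by \<open>t r\<^sup>2\<close>; hence the sign conditions on them.\<close>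

lemma dominated_by_trr:
  fixes p3 :: real
  assumes "p3 > 0" "q2 \<ge> 0" "e1 \<ge> 0"
  shows "\<exists>\<delta>>0. \<forall>t s r. region \<delta> t s r \<longrightarrow> 0 \<le> p3 * (t * r\<^sup>2)
    + q2 * (s\<^sup>2 * r) + q3 * (s * r\<^sup>2) + q4 * r ^ 3 + b2 * (t * r)
    + e1 * s\<^sup>2 + e2 * (s * r) + e3 * r\<^sup>2 + l1 * t + l2 * s + l3 * r"
proof -
  have "((\<lambda>p. p3 + q3 * st p + q4 * rt p + b2 * ir p + e2 * (st p * ir p) + e3 * it p + l1 * (ir p)\<^sup>2
      + l2 * (st p * (ir p)\<^sup>2) + l3 * (it p * ir p)) \<longlongrightarrow> p3) far_out"
    by (auto intro!: tendsto_eq_intros ratio_limits)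
  from order_tendstoD(1)[OF this assms(1)] far_out_pos show ?thesis
    unfolding eventually_far_out[symmetric]
  proof eventually_elim
    case (elim p)
    obtain t s r where p: "p = (t, s, r)" by (cases p) auto
    have "0 \<le> t * r\<^sup>2" "0 \<le> q2 * (s\<^sup>2 * r) + e1 * s\<^sup>2" using elim(2) assms by (auto simp: p)
    from mult_nonneg_nonneg[OF this(1) less_imp_le[OF elim(1)]] this(2) show ?case
      using elim(2) by (simp add: p ratio_defs field_simps power2_eq_square power3_eq_cube)
  qed
qed

lemma dominated_by_tr:
  fixes b2 :: real
  assumes "b2 > 0" "e1 \<ge> 0"
  shows "\<exists>\<delta>>0. \<forall>t s r. region \<delta> t s r \<longrightarrow> 0 \<le> b2 * (t * r)
    + e1 * s\<^sup>2 + e2 * (s * r) + e3 * r\<^sup>2 + l1 * t + l2 * s + l3 * r"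
proof -
  have "((\<lambda>p. b2 + e2 * st p + e3 * rt p + l1 * ir p + l2 * (st p * ir p) + l3 * it p) \<longlongrightarrow> b2) far_out"
    by (auto intro!: tendsto_eq_intros ratio_limits)
  from order_tendstoD(1)[OF this assms(1)] far_out_pos show ?thesis
    unfolding eventually_far_out[symmetric]
  proof eventually_elim
    case (elim p)
    obtain t s r where p: "p = (t, s, r)" by (cases p) auto
    have "0 \<le> t * r" "0 \<le> e1 * s\<^sup>2" using elim(2) assms by (auto simp: p)
    from mult_nonneg_nonneg[OF this(1) less_imp_le[OF elim(1)]] this(2) show ?case
      using elim(2) by (simp add: p ratio_defs field_simps power2_eq_square)
  qed
qed

lemma r_dominates:
  fixes q4 :: real
  assumes "q4 > 0 \<or> (q4 = 0 \<and> e3 > 0)"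
  shows "\<exists>\<delta>>0. \<forall>t s r. region \<delta> t s r \<longrightarrow> 0 \<le> q4 * r ^ 3 + e3 * r\<^sup>2 + l3 * r"
proof -
  have "\<forall>\<^sub>F p in far_out. 0 < q4 + e3 * ir p + l3 * (ir p)\<^sup>2 \<or> q4 = 0 \<and> 0 < e3 + l3 * ir p"
  proof (cases "q4 > 0")
    case True
    have "((\<lambda>p. q4 + e3 * ir p + l3 * (ir p)\<^sup>2) \<longlongrightarrow> q4) far_out" by (auto intro!: tendsto_eq_intros ratio_limits)
    from order_tendstoD(1)[OF this True] show ?thesis by eventually_elim simp
  next
    case False
    have "((\<lambda>p. e3 + l3 * ir p) \<longlongrightarrow> e3) far_out" by (auto intro!: tendsto_eq_intros ratio_limits)
    moreover have "e3 > 0" "q4 = 0" using assms False by auto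
    ultimately have "\<forall>\<^sub>F p in far_out. 0 < e3 + l3 * ir p" by (auto dest: order_tendstoD(1))
    then show ?thesis by eventually_elim (simp add: \<open>q4 = 0\<close>)
  qed
  from this far_out_pos show ?thesis
    unfolding eventually_far_out[symmetric]
  proof eventually_elim
    case (elim p)
    obtain t s r where p: "p = (t, s, r)" by (cases p) auto
    have "0 < r ^ 3" "0 < r\<^sup>2" using elim(2) by (auto simp: p)
    then have "0 \<le> r ^ 3 * (q4 + e3 * ir p + l3 * (ir p)\<^sup>2) \<or> q4 = 0 \<and> 0 \<le> r\<^sup>2 * (e3 + l3 * ir p)"
      using elim(1) by auto
    then show ?case
      using elim(2) by (auto simp: p ratio_defs field_simps power2_eq_square power3_eq_cube)
  qed
qed

lemma coeff_bound:
  fixes \<alpha> :: real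
  assumes "\<bar>\<alpha>\<bar> \<le> A" "\<bar>\<mu>\<bar> \<le> g"
  shows "- (A * g) \<le> \<alpha> * \<mu>"
proof -
  have "\<bar>\<alpha> * \<mu>\<bar> \<le> A * g" using assms by (simp add: abs_mult mult_mono)
  then show ?thesis by linarith
qed

lemma mult_bound: "\<bar>\<mu>\<bar> \<le> g \<Longrightarrow> \<bar>\<nu>\<bar> \<le> h \<Longrightarrow> \<bar>\<mu> * \<nu>\<bar> \<le> g * (h::real)"
  by (simp add: abs_mult mult_mono)

lemma small_constant:
  fixes A c n :: real
  assumes "A \<ge> 0" "c > 0" "n > 0"
  obtains \<delta> where "0 < \<delta>" "\<delta> \<le> 1" "n * A * \<delta> \<le> c"
proof
  show "0 < min 1 (c / (n * A + 1))" "min 1 (c / (n * A + 1)) \<le> 1" using assms by (auto simp: add_nonneg_pos)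
  have "n * A * min 1 (c / (n * A + 1)) \<le> (n * A + 1) * (c / (n * A + 1))"
    using assms by (intro mult_mono) auto
  also have "\<dots> = c" using assms by (simp add: add_nonneg_pos order_less_imp_not_eq2)
  finally show "n * A * min 1 (c / (n * A + 1)) \<le> c" .
qed

text \<open>Once s exceeds a constant, \<open>t s\<^sup>2\<close> dominates every monomial other than \<open>s r\<^sup>2\<close>, \<open>r ^ 3\<close>, \<open>t r\<close> and \<open>r\<^sup>2\<close>.\<close>

lemma transversal_large:
  fixes p1 :: real
  assumes "p1 > 0"
  shows "\<exists>S\<ge>1. \<exists>\<delta>>0. \<forall>t s r. region \<delta> t s r \<longrightarrow> S \<le> \<bar>s\<bar> \<longrightarrow> p1 / 4 * (t * s\<^sup>2) \<le> p1 * (t * s\<^sup>2)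
    + b1 * (t * s) + l1 * t + q1 * s ^ 3 + q2 * (s\<^sup>2 * r) + e1 * s\<^sup>2 + e2 * (s * r) + l2 * s + l3 * r"
proof -
  define A where "A = \<bar>q1\<bar> + \<bar>q2\<bar> + \<bar>e1\<bar> + \<bar>e2\<bar> + \<bar>l2\<bar> + \<bar>l3\<bar>"
  have A: "A \<ge> 0" by (simp add: A_def)
  have p4: "p1 / 4 > 0" using assms by simp
  obtain \<delta> where \<delta>: "0 < \<delta>" "\<delta> \<le> 1" and \<delta>A: "6 * A * \<delta> \<le> p1 / 4" using small_constant[OF A p4, of 6] by auto
  define S where "S = 1 + 2 * (\<bar>b1\<bar> + \<bar>l1\<bar>) / p1"
  have S: "S \<ge> 1" using assms by (simp add: S_def)
  show ?thesis
  proof (rule exI[of _ S], rule conjI[OF S], rule exI[of _ \<delta>], rule conjI[OF \<delta>(1)], intro allI impI)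
    fix t s r assume reg: "region \<delta> t s r" and s: "S \<le> \<bar>s\<bar>"
    note R = regionD[OF reg \<delta>]
    have s1: "1 \<le> \<bar>s\<bar>" using s S by linarith
    define G where "G = t * s\<^sup>2"
    have G: "G \<ge> 0" using R by (simp add: G_def)
    have ss: "\<bar>s\<bar> \<le> s\<^sup>2" using mult_left_mono[OF s1, of "\<bar>s\<bar>"] by (simp add: power2_eq_square)
    have "\<bar>s * s\<^sup>2\<bar> \<le> \<delta> * t * s\<^sup>2" "\<bar>s\<^sup>2 * r\<bar> \<le> s\<^sup>2 * (\<delta> * t)" "\<bar>1 * s\<^sup>2\<bar> \<le> \<delta> * t * s\<^sup>2" "\<bar>s * r\<bar> \<le> s\<^sup>2 * (\<delta> * t)"
      "\<bar>1 * r\<bar> \<le> s\<^sup>2 * (\<delta> * t)"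
      by (rule mult_bound; use R ss s1 in simp)+
    then have 1: "\<bar>s ^ 3\<bar> \<le> \<delta> * G" "\<bar>s\<^sup>2 * r\<bar> \<le> \<delta> * G" "\<bar>s\<^sup>2\<bar> \<le> \<delta> * G" "\<bar>s * r\<bar> \<le> \<delta> * G" "\<bar>s\<bar> \<le> \<delta> * G" "\<bar>r\<bar> \<le> \<delta> * G"
      using ss by (simp_all add: G_def power2_eq_square power3_eq_cube mult_ac)
    have coef: "\<bar>q1\<bar> \<le> A" "\<bar>q2\<bar> \<le> A" "\<bar>e1\<bar> \<le> A" "\<bar>e2\<bar> \<le> A" "\<bar>l2\<bar> \<le> A" "\<bar>l3\<bar> \<le> A"
      by (simp_all add: A_def)
    have "6 * (A * (\<delta> * G)) \<le> p1 / 4 * G" using mult_right_mono[OF \<delta>A G] by (simp add: mult.assoc)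
    moreover note coeff_bound[OF coef(1) 1(1)] coeff_bound[OF coef(2) 1(2)] coeff_bound[OF coef(3) 1(3)]
      coeff_bound[OF coef(4) 1(4)] coeff_bound[OF coef(5) 1(5)] coeff_bound[OF coef(6) 1(6)]
    moreover have "b1 * (t * s) + l1 * t \<ge> - (p1 / 2 * G)"
    proof -
      have "2 * (\<bar>b1\<bar> + \<bar>l1\<bar>) / p1 \<le> \<bar>s\<bar>" using s by (simp add: S_def)
      then have "(\<bar>b1\<bar> + \<bar>l1\<bar>) \<le> p1 / 2 * \<bar>s\<bar>" using assms by (simp add: field_simps)
      then have "(\<bar>b1\<bar> + \<bar>l1\<bar>) * (t * \<bar>s\<bar>) \<le> p1 / 2 * \<bar>s\<bar> * (t * \<bar>s\<bar>)" using R by (intro mult_right_mono) auto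
      also have "\<dots> = p1 / 2 * G" by (simp add: G_def power2_eq_square)
      finally have "(\<bar>b1\<bar> + \<bar>l1\<bar>) * (t * \<bar>s\<bar>) \<le> p1 / 2 * G" .
      moreover have "- (\<bar>b1\<bar> * (t * \<bar>s\<bar>)) \<le> b1 * (t * s)" "- (\<bar>l1\<bar> * (t * \<bar>s\<bar>)) \<le> l1 * t"
        using R s1 by (intro coeff_bound; simp add: abs_mult)+
      ultimately show ?thesis by (simp add: algebra_simps)
    qed
    ultimately show "p1 / 4 * (t * s\<^sup>2) \<le> p1 * (t * s\<^sup>2)
      + b1 * (t * s) + l1 * t + q1 * s ^ 3 + q2 * (s\<^sup>2 * r) + e1 * s\<^sup>2 + e2 * (s * r) + l2 * s + l3 * r"
      unfolding G_def[symmetric] by linarith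
  qed
qed

text \<open>The delicate case: \<open>t s\<^sup>2\<close> is positive, but s may stay bounded, and then the growth has to come from the
first nonvanishing among the coefficients of \<open>r ^ 3\<close>, \<open>t r\<close> and \<open>r\<^sup>2\<close>, while the factor of t is only
known to be nonnegative. If all three vanish, the second nonnegativity hypothesis, which is a slope in a
perturbed direction, leaves a polynomial in s alone.\<close>

lemma transversal_bound:
  fixes p1 :: real
  assumes p1: "p1 > 0" and q4: "q4 \<ge> 0" and b2: "b2 \<ge> 0" and q3: "q4 = 0 \<Longrightarrow> q3 = 0"
    and e3: "q4 = 0 \<Longrightarrow> b2 = 0 \<Longrightarrow> e3 \<ge> 0"
  shows "\<exists>K. \<exists>\<delta>>0. \<forall>t s r. region \<delta> t s r \<longrightarrow> 0 \<le> p1 * s\<^sup>2 + b1 * s + b2 * r + l1 \<longrightarrow>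
    (q4 = 0 \<and> b2 = 0 \<and> e3 = 0 \<longrightarrow> 0 \<le> p1 * (t * s\<^sup>2) + b1 * (t * s) + l1 * t + q2 * (s\<^sup>2 * r) + e2 * (s * r) + l3 * r) \<longrightarrow>
    K \<le> p1 * (t * s\<^sup>2) + q1 * s ^ 3 + q2 * (s\<^sup>2 * r) + q3 * (s * r\<^sup>2) + q4 * r ^ 3 + b1 * (t * s) + b2 * (t * r)
    + e1 * s\<^sup>2 + e2 * (s * r) + e3 * r\<^sup>2 + l1 * t + l2 * s + l3 * r"
proof -
  obtain S \<delta>1 where S: "S \<ge> 1" and \<delta>1: "\<delta>1 > 0" and large: "\<And>t s r. region \<delta>1 t s r \<Longrightarrow> S \<le> \<bar>s\<bar> \<Longrightarrow>
    p1 / 4 * (t * s\<^sup>2) \<le> p1 * (t * s\<^sup>2)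
    + b1 * (t * s) + l1 * t + q1 * s ^ 3 + q2 * (s\<^sup>2 * r) + e1 * s\<^sup>2 + e2 * (s * r) + l2 * s + l3 * r"
    using transversal_large[OF p1, of b1 l1 q1 q2 e1 e2 l2 l3] by blast
  define A where "A = \<bar>q1\<bar> + \<bar>q2\<bar> + \<bar>q3\<bar> + \<bar>b1\<bar> + \<bar>e1\<bar> + \<bar>e2\<bar> + \<bar>e3\<bar> + \<bar>l1\<bar> + \<bar>l2\<bar> + \<bar>l3\<bar>"
  have A: "A \<ge> 0" by (simp add: A_def)
  have coef: "\<bar>q1\<bar> \<le> A" "\<bar>q2\<bar> \<le> A" "\<bar>q3\<bar> \<le> A" "\<bar>b1\<bar> \<le> A" "\<bar>e1\<bar> \<le> A" "\<bar>e2\<bar> \<le> A" "\<bar>e3\<bar> \<le> A" "\<bar>l1\<bar> \<le> A" "\<bar>l2\<bar> \<le> A" "\<bar>l3\<bar> \<le> A"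
    by (simp_all add: A_def)
  define A' where "A' = A * S ^ 3"
  have S3: "S ^ 3 \<ge> 1" "S \<le> S ^ 3" "S\<^sup>2 \<le> S ^ 3" using S by (auto simp: self_le_power power_increasing)
  have A': "A' \<ge> 0" "A \<le> A'" using A S S3 by (auto simp: A'_def mult_le_cancel_left1 intro!: mult_nonneg_nonneg)
  define c where "c = (if q4 > 0 then q4 / 2 else if b2 > 0 then b2 else if e3 > 0 then e3 else 1)"
  have c: "c > 0" using q4 b2 by (simp add: c_def)
  obtain \<delta>2 where \<delta>2: "0 < \<delta>2" "\<delta>2 \<le> 1" "9 * A' * \<delta>2 \<le> c" using small_constant[OF A'(1) c, of 9] by auto
  obtain \<delta>3 where \<delta>3: "0 < \<delta>3" "\<delta>3 \<le> 1" "1 * (q3\<^sup>2 / (2 * q4)) * \<delta>3 \<le> p1 / 4"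
    using small_constant[of "q3\<^sup>2 / (2 * q4)" "p1 / 4" 1] p1 q4 by auto
  define \<delta> where "\<delta> = min \<delta>1 (min \<delta>2 \<delta>3)"
  have \<delta>: "\<delta> > 0" "\<delta> \<le> 1" using \<delta>1 \<delta>2 \<delta>3 by (auto simp: \<delta>_def)
  have \<delta>A: "9 * A' * \<delta> \<le> c"
  proof -
    have "9 * A' * \<delta> \<le> 9 * A' * \<delta>2" using A' by (intro mult_left_mono) (auto simp: \<delta>_def)
    then show ?thesis using \<delta>2(3) by linarith
  qed
  have \<delta>q: "q3\<^sup>2 / (2 * q4) * \<delta> \<le> p1 / 4"
  proof -
    have "q3\<^sup>2 / (2 * q4) * \<delta> \<le> q3\<^sup>2 / (2 * q4) * \<delta>3" using q4 by (intro mult_left_mono) (auto simp: \<delta>_def)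
    then show ?thesis using \<delta>3(3) by linarith
  qed
  show ?thesis
  proof (rule exI[of _ "- (3 * A')"], rule exI[of _ \<delta>], rule conjI[OF \<delta>(1)], intro allI impI)
    fix t s r assume reg: "region \<delta> t s r" and slope: "0 \<le> p1 * s\<^sup>2 + b1 * s + b2 * r + l1"
      and degen: "q4 = 0 \<and> b2 = 0 \<and> e3 = 0 \<longrightarrow>
        0 \<le> p1 * (t * s\<^sup>2) + b1 * (t * s) + l1 * t + q2 * (s\<^sup>2 * r) + e2 * (s * r) + l3 * r"
    note R = regionD[OF reg \<delta>]
    have r1: "r \<le> \<delta> * r\<^sup>2" using mult_right_mono[of 1 "\<delta> * r" r] R by (simp add: power2_eq_square)
    have r2: "r\<^sup>2 \<le> \<delta> * r ^ 3"
      using mult_right_mono[of 1 "\<delta> * r" "r\<^sup>2"] R by (simp add: power2_eq_square power3_eq_cube)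
    have rr: "r \<le> r\<^sup>2" "1 \<le> r\<^sup>2" using R by (simp_all add: self_le_power)
    have r_tr: "r\<^sup>2 \<le> \<delta> * (t * r)" using mult_right_mono[OF R(6), of r] R by (simp add: power2_eq_square mult_ac)
    have t_tr: "t \<le> \<delta> * (t * r)" using mult_left_mono[OF R(4), of t] R by (simp add: mult_ac)
    have tr0: "0 \<le> t * r" using R by simp
    have small_A: "A * (\<delta> * m) \<le> c * m" if "m \<ge> 0" for m
    proof -
      have "A * \<delta> \<le> 9 * A' * \<delta>" using A' \<delta> by (intro mult_right_mono) auto
      then have "A * \<delta> \<le> c" using \<delta>A by simp
      from mult_right_mono[OF this that] show ?thesis by (simp add: mult.assoc)
    qed
    have small_A': "9 * (A' * (\<delta> * m)) \<le> c * m" if "m \<ge> 0" for m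
      using mult_right_mono[OF \<delta>A that] by (simp add: mult.assoc)
    show "- (3 * A') \<le> p1 * (t * s\<^sup>2) + q1 * s ^ 3 + q2 * (s\<^sup>2 * r) + q3 * (s * r\<^sup>2) + q4 * r ^ 3 + b1 * (t * s)
      + b2 * (t * r) + e1 * s\<^sup>2 + e2 * (s * r) + e3 * r\<^sup>2 + l1 * t + l2 * s + l3 * r"
    proof (cases "S \<le> \<bar>s\<bar>")
      case True
      have reg1: "region \<delta>1 t s r" using region_mono[OF reg \<delta>(1)] by (simp add: \<delta>_def)
      have "0 \<le> p1 / 4 * (t * s\<^sup>2) + q3 * (s * r\<^sup>2) + q4 * r ^ 3 + b2 * (t * r) + e3 * r\<^sup>2"
      proof (cases "q4 > 0")
        case q: True
        have "q3 * (s * r\<^sup>2) \<ge> - (q4 / 2 * r ^ 3) - q3\<^sup>2 / (2 * q4) * (s\<^sup>2 * r)"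
        proof -
          have "0 \<le> r / (2 * q4) * (q4 * r + q3 * s)\<^sup>2" using q R by simp
          also have "\<dots> = q4 / 2 * r ^ 3 + q3 * (s * r\<^sup>2) + q3\<^sup>2 / (2 * q4) * (s\<^sup>2 * r)"
            using q by (simp add: field_simps power2_eq_square power3_eq_cube)
          finally show ?thesis by simp
        qed
        moreover have "q3\<^sup>2 / (2 * q4) * (s\<^sup>2 * r) \<le> p1 / 4 * (t * s\<^sup>2)"
        proof -
          have "s\<^sup>2 * r \<le> \<delta> * (t * s\<^sup>2)" using mult_left_mono[OF R(6), of "s\<^sup>2"] by (simp add: mult_ac)
          then have "q3\<^sup>2 / (2 * q4) * (s\<^sup>2 * r) \<le> q3\<^sup>2 / (2 * q4) * (\<delta> * (t * s\<^sup>2))" using q by (intro mult_left_mono) auto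
          also have "\<dots> \<le> p1 / 4 * (t * s\<^sup>2)"
            using mult_right_mono[OF \<delta>q, of "t * s\<^sup>2"] R by (simp add: mult.assoc)
          finally show ?thesis .
        qed
        moreover have "e3 * r\<^sup>2 \<ge> - (q4 / 2 * r ^ 3)"
        proof -
          have "A * (\<delta> * r ^ 3) \<le> q4 / 2 * r ^ 3" using small_A[of "r ^ 3"] R q unfolding c_def by auto
          moreover have "- (A * (\<delta> * r ^ 3)) \<le> e3 * r\<^sup>2" using r2 by (intro coeff_bound coef) simp
          ultimately show ?thesis by linarith
        qed
        moreover have "b2 * (t * r) \<ge> 0" using b2 tr0 by simp
        ultimately show ?thesis by linarith
      next
        case q: False
        then have q0: "q4 = 0" "q3 = 0" using q4 q3 by auto
        have "0 \<le> p1 / 4 * (t * s\<^sup>2)" using p1 R by simp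
        moreover have "0 \<le> b2 * (t * r) + e3 * r\<^sup>2"
        proof (cases "b2 > 0")
          case True
          then show ?thesis
          proof -
            have "A * (\<delta> * (t * r)) \<le> b2 * (t * r)" using small_A[OF tr0] True q unfolding c_def by auto
            moreover have "- (A * (\<delta> * (t * r))) \<le> e3 * r\<^sup>2" using r_tr by (intro coeff_bound coef) simp
            ultimately show ?thesis by linarith
          qed
        qed (use b2 q0 e3 in auto)
        ultimately show ?thesis using q0 by simp
      qed
      then show ?thesis using large[OF reg1 True] A' by linarith
    next
      case False
      then have s: "\<bar>s\<bar> \<le> S" by simp
      have s2: "\<bar>s\<^sup>2\<bar> \<le> S\<^sup>2" using s power_mono[OF s, of 2] by simp
      have s3: "\<bar>s ^ 3\<bar> \<le> S ^ 3" using power_mono[OF s, of 3] by (simp add: power_abs)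
      have sS: "\<bar>s\<bar> \<le> S ^ 3" "\<bar>s\<^sup>2\<bar> \<le> S ^ 3" using s s2 S3 by linarith+
      have cb: "- (A' * g) \<le> \<alpha> * (\<mu> * \<nu>)" if "\<bar>\<alpha>\<bar> \<le> A" "\<bar>\<mu>\<bar> \<le> S ^ 3" "\<bar>\<nu>\<bar> \<le> g" for \<alpha> \<mu> \<nu> g
        using coeff_bound[OF that(1) mult_bound[OF that(2,3)]] by (simp add: A'_def mult.assoc)
      have slope_t: "0 \<le> p1 * (t * s\<^sup>2) + b1 * (t * s) + b2 * (t * r) + l1 * t"
      proof -
        have "0 \<le> t * (p1 * s\<^sup>2 + b1 * s + b2 * r + l1)" using slope R by simp
        then show ?thesis by (simp add: algebra_simps)
      qed
      have one: "\<bar>1::real\<bar> \<le> S ^ 3" using S3 by simp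
      consider "q4 > 0" | "q4 = 0" "b2 > 0" | "q4 = 0" "b2 = 0" "e3 > 0" | "q4 = 0" "b2 = 0" "e3 = 0"
        using q4 b2 e3 by force
      then show ?thesis
      proof cases
        case 1
        define g where "g = \<delta> * r ^ 3"
        have g: "\<bar>1\<bar> \<le> g" "\<bar>r\<bar> \<le> g" "\<bar>r\<^sup>2\<bar> \<le> g" using r2 rr R by (simp_all add: g_def)
        have "9 * (A' * g) \<le> c * r ^ 3" using small_A'[of "r ^ 3"] R by (simp add: g_def)
        moreover have "c * r ^ 3 \<le> q4 * r ^ 3" using 1 R by (intro mult_right_mono) (auto simp: c_def)
        moreover have "0 \<le> A' * g" using A' g by (intro mult_nonneg_nonneg) auto
        ultimately have c4: "8 * (A' * g) \<le> q4 * r ^ 3" by linarith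
        show ?thesis
          using slope_t c4 A'(1) cb[OF coef(1) s3 g(1)] cb[OF coef(2) sS(2) g(2)] cb[OF coef(3) sS(1) g(3)]
            cb[OF coef(5) sS(2) g(1)] cb[OF coef(6) sS(1) g(2)] cb[OF coef(7) one g(3)]
            cb[OF coef(9) sS(1) g(1)] cb[OF coef(10) one g(2)]
          by simp
      next
        case 2
        define g where "g = \<delta> * (t * r)"
        have g: "\<bar>1\<bar> \<le> g" "\<bar>r\<bar> \<le> g" "\<bar>r\<^sup>2\<bar> \<le> g" "\<bar>t\<bar> \<le> g" using r_tr rr R t_tr by (simp_all add: g_def)
        have c4: "9 * (A' * g) \<le> b2 * (t * r)" using small_A'[OF tr0] 2 by (simp add: c_def g_def)
        have "0 \<le> p1 * (t * s\<^sup>2)" using p1 R by simp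
        then show ?thesis
          using 2 q3 c4 A'(1) cb[OF coef(1) s3 g(1)] cb[OF coef(2) sS(2) g(2)] cb[OF coef(4) sS(1) g(4)]
            cb[OF coef(5) sS(2) g(1)] cb[OF coef(6) sS(1) g(2)] cb[OF coef(7) one g(3)] cb[OF coef(8) one g(4)]
            cb[OF coef(9) sS(1) g(1)] cb[OF coef(10) one g(2)]
          by (simp add: mult_ac)
      next
        case 3
        define g where "g = \<delta> * r\<^sup>2"
        have g: "\<bar>1\<bar> \<le> g" "\<bar>r\<bar> \<le> g" using r1 R by (simp_all add: g_def)
        have "9 * (A' * g) \<le> e3 * r\<^sup>2" using small_A'[of "r\<^sup>2"] R 3 by (simp add: c_def g_def)
        moreover have "0 \<le> A' * g" using A' g by (intro mult_nonneg_nonneg) auto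
        ultimately have c4: "6 * (A' * g) \<le> e3 * r\<^sup>2" by linarith
        show ?thesis
          using 3 q3 slope_t c4 A'(1) cb[OF coef(1) s3 g(1)] cb[OF coef(2) sS(2) g(2)]
            cb[OF coef(5) sS(2) g(1)] cb[OF coef(6) sS(1) g(2)]
            cb[OF coef(9) sS(1) g(1)] cb[OF coef(10) one g(2)]
          by simp
      next
        case 4
        have g: "\<bar>1::real\<bar> \<le> 1" by simp
        show ?thesis
          using 4 q3 degen cb[OF coef(1) s3 g] cb[OF coef(5) sS(2) g] cb[OF coef(9) sS(1) g] by simp
      qed
    qed
  qed
qed

text \<open>The same dichotomy on s as in \<open>transversal_bound\<close>, with \<open>s\<^sup>2 r\<close> in place of \<open>t s\<^sup>2\<close>.\<close>

lemma s_square_r_bound: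
  fixes q2 :: real
  assumes q2: "q2 > 0" and q4: "q4 \<ge> 0" and e1: "e1 \<ge> 0" and l1: "l1 \<ge> 0" and e3: "q4 = 0 \<Longrightarrow> e3 \<ge> 0"
  shows "\<exists>K. \<exists>\<delta>>0. \<forall>t s r. region \<delta> t s r \<longrightarrow>
    (q4 = 0 \<and> e3 = 0 \<longrightarrow> 0 \<le> l1 * t + q2 * (s\<^sup>2 * r) + e2 * (s * r) + l3 * r) \<longrightarrow>
    K \<le> q2 * (s\<^sup>2 * r) + q4 * r ^ 3 + e1 * s\<^sup>2 + e2 * (s * r) + e3 * r\<^sup>2 + l1 * t + l2 * s + l3 * r"
proof -
  define A where "A = \<bar>e2\<bar> + \<bar>e3\<bar> + \<bar>l2\<bar> + \<bar>l3\<bar>"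
  have A: "A \<ge> 0" by (simp add: A_def)
  have coef: "\<bar>e2\<bar> \<le> A" "\<bar>e3\<bar> \<le> A" "\<bar>l2\<bar> \<le> A" "\<bar>l3\<bar> \<le> A" by (simp_all add: A_def)
  define S where "S = 1 + A / q2"
  have S: "S \<ge> 1" using A q2 by (simp add: S_def)
  define A' where "A' = A * S"
  have A': "A' \<ge> 0" "A \<le> A'" using A S by (auto simp: A'_def mult_le_cancel_left1)
  define c where "c = (if q4 > 0 then q4 else if e3 > 0 then e3 else 1)"
  have c: "c > 0" using q4 by (simp add: c_def)
  obtain \<delta> where \<delta>: "0 < \<delta>" "\<delta> \<le> 1" and \<delta>A: "4 * A' * \<delta> \<le> c" using small_constant[OF A'(1) c, of 4] by auto
  show ?thesis
  proof (rule exI[of _ "- A'"], rule exI[of _ \<delta>], rule conjI[OF \<delta>(1)], intro allI impI)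
    fix t s r assume reg: "region \<delta> t s r"
      and degen: "q4 = 0 \<and> e3 = 0 \<longrightarrow> 0 \<le> l1 * t + q2 * (s\<^sup>2 * r) + e2 * (s * r) + l3 * r"
    note R = regionD[OF reg \<delta>]
    have r1: "r \<le> \<delta> * r\<^sup>2" using mult_right_mono[of 1 "\<delta> * r" r] R by (simp add: power2_eq_square)
    have r2: "r\<^sup>2 \<le> \<delta> * r ^ 3"
      using mult_right_mono[of 1 "\<delta> * r" "r\<^sup>2"] R by (simp add: power2_eq_square power3_eq_cube)
    have rr: "r \<le> r\<^sup>2" "1 \<le> r\<^sup>2" using R by (simp_all add: self_le_power)
    have l1t: "0 \<le> l1 * t" and e1s: "0 \<le> e1 * s\<^sup>2" using l1 e1 R by simp_all
    have small_A': "4 * (A' * (\<delta> * m)) \<le> c * m" if "m \<ge> 0" for m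
      using mult_right_mono[OF \<delta>A that] by (simp add: mult.assoc)
    show "- A' \<le> q2 * (s\<^sup>2 * r) + q4 * r ^ 3 + e1 * s\<^sup>2 + e2 * (s * r) + e3 * r\<^sup>2 + l1 * t + l2 * s + l3 * r"
    proof (cases "S \<le> \<bar>s\<bar>")
      case True
      then have s1: "1 \<le> \<bar>s\<bar>" using S by linarith
      define g where "g = \<bar>s\<bar> * r"
      have g0: "g \<ge> 0" using R by (simp add: g_def)
      have g: "\<bar>s * r\<bar> \<le> g" "\<bar>s\<bar> \<le> g" "\<bar>r\<bar> \<le> g" 
        using s1 R mult_left_mono[of 1 r "\<bar>s\<bar>"] mult_right_mono[of 1 "\<bar>s\<bar>" r] by (simp_all add: g_def abs_mult)
      have "A * g \<le> q2 * (s\<^sup>2 * r)"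
      proof -
        have "A / q2 \<le> \<bar>s\<bar>" using True by (simp add: S_def)
        then have "A \<le> q2 * \<bar>s\<bar>" using q2 by (simp add: field_simps)
        from mult_right_mono[OF this g0] show ?thesis by (simp add: g_def power2_eq_square mult_ac)
      qed
      moreover have "\<bar>e2\<bar> * g + \<bar>l2\<bar> * g + \<bar>l3\<bar> * g \<le> A * g"
        unfolding distrib_right[symmetric] using g0 by (intro mult_right_mono) (simp_all add: A_def)
      moreover have "- (\<bar>e2\<bar> * g) \<le> e2 * (s * r)" "- (\<bar>l2\<bar> * g) \<le> l2 * s" "- (\<bar>l3\<bar> * g) \<le> l3 * r"
        using g by (auto intro: coeff_bound)
      moreover have "0 \<le> q4 * r ^ 3 + e3 * r\<^sup>2"
      proof (cases "q4 > 0")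
        case True
        have "A * (\<delta> * r ^ 3) \<le> A' * (\<delta> * r ^ 3)" using A' R \<delta> by (intro mult_right_mono) auto
        moreover have "0 \<le> A' * (\<delta> * r ^ 3)" using A' R \<delta> by simp
        moreover have "4 * (A' * (\<delta> * r ^ 3)) \<le> q4 * r ^ 3"
          using small_A'[of "r ^ 3"] R True unfolding c_def by auto
        moreover have "- (A * (\<delta> * r ^ 3)) \<le> e3 * r\<^sup>2"
          using r2 by (intro coeff_bound coef) simp
        ultimately show ?thesis by linarith
      qed (use q4 e3 in auto)
      ultimately show ?thesis using l1t e1s A' by linarith
    next
      case False
      then have s: "\<bar>s\<bar> \<le> S" by simp
      have cb: "- (A' * g) \<le> \<alpha> * (\<mu> * \<nu>)" if "\<bar>\<alpha>\<bar> \<le> A" "\<bar>\<mu>\<bar> \<le> S" "\<bar>\<nu>\<bar> \<le> g" for \<alpha> \<mu> \<nu> g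
        using coeff_bound[OF that(1) mult_bound[OF that(2,3)]] by (simp add: A'_def mult.assoc)
      have one: "\<bar>1::real\<bar> \<le> S" using S by simp
      have q2s: "0 \<le> q2 * (s\<^sup>2 * r)" using q2 R by simp
      consider "q4 > 0" | "q4 = 0" "e3 > 0" | "q4 = 0" "e3 = 0"
        using q4 e3 by force
      then show ?thesis
      proof cases
        case 1
        define g where "g = \<delta> * r ^ 3"
        have g: "\<bar>1\<bar> \<le> g" "\<bar>r\<bar> \<le> g" "\<bar>r\<^sup>2\<bar> \<le> g" using r2 rr R by (simp_all add: g_def)
        have c4: "4 * (A' * g) \<le> q4 * r ^ 3" using small_A'[of "r ^ 3"] R 1 by (simp add: c_def g_def)
        show ?thesis
          using q2s l1t e1s c4 A'(1) cb[OF coef(1) s g(2)] cb[OF coef(2) one g(3)] cb[OF coef(3) s g(1)]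
            cb[OF coef(4) one g(2)] by simp
      next
        case 2
        define g where "g = \<delta> * r\<^sup>2"
        have g: "\<bar>1\<bar> \<le> g" "\<bar>r\<bar> \<le> g" using r1 R by (simp_all add: g_def)
        have "4 * (A' * g) \<le> e3 * r\<^sup>2" using small_A'[of "r\<^sup>2"] R 2 by (simp add: c_def g_def)
        moreover have "0 \<le> A' * g" using A' g by (intro mult_nonneg_nonneg) auto
        ultimately have c4: "3 * (A' * g) \<le> e3 * r\<^sup>2" by linarith
        show ?thesis
          using 2 q2s l1t e1s c4 A'(1) cb[OF coef(1) s g(2)] cb[OF coef(3) s g(1)]
            cb[OF coef(4) one g(2)] by simp
      next
        case 3
        have g: "\<bar>1::real\<bar> \<le> 1" by simp
        show ?thesis
          using 3 degen e1s cb[OF coef(3) s g] by simp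
      qed
    qed
  qed
qed

section \<open>Cones that are half-spaces near the limit direction\<close>

text \<open>Near d the cone is the half-space of all w with \<open>k \<bullet> w \<ge> 0\<close>; its boundary plane is spanned by d and u. The third
coordinate vector v is left open except for \<open>k \<bullet> v = 1\<close>, because the cases below need different choices
of it.\<close>

locale half_space_sequence = rayless_sequence T B L M a m x d
  for T :: "real ^ 'n \<Rightarrow> real ^ 'n \<Rightarrow> real ^ 'n \<Rightarrow> real" and B L M a m x d +
  fixes k u :: "real ^ 'n"
  assumes kd: "k \<bullet> d = 0" and ku: "k \<bullet> u = 0" and ud: "u \<bullet> d = 0" and norm_u: "norm u = 1"
    and kernel: "k \<bullet> w = 0 \<Longrightarrow> w = (w \<bullet> d) *\<^sub>R d + (w \<bullet> u) *\<^sub>R u"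
    and half_space: "k \<bullet> w \<ge> 0 \<Longrightarrow> w \<in> tangent a m d"
    and kx: "filterlim (\<lambda>j. k \<bullet> x j) at_top sequentially"
begin

abbreviation pt :: "real ^ 'n \<Rightarrow> real \<Rightarrow> real \<Rightarrow> real \<Rightarrow> real ^ 'n" where
  "pt v t s r \<equiv> t *\<^sub>R d + s *\<^sub>R u + r *\<^sub>R v"

lemma coordinates:
  assumes "k \<bullet> v = 1"
  shows "w = ((w - (k \<bullet> w) *\<^sub>R v) \<bullet> d) *\<^sub>R d + ((w - (k \<bullet> w) *\<^sub>R v) \<bullet> u) *\<^sub>R u + (k \<bullet> w) *\<^sub>R v"
proof -
  have "k \<bullet> (w - (k \<bullet> w) *\<^sub>R v) = 0" using assms by (simp add: inner_diff_right)
  from kernel[OF this] show ?thesis by (simp add: eq_diff_eq[symmetric])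
qed

lemma eventually_region:
  assumes v: "k \<bullet> v = 1" and "\<delta> > 0"
  shows "\<forall>\<^sub>F j in sequentially. region \<delta> ((x j - (k \<bullet> x j) *\<^sub>R v) \<bullet> d) ((x j - (k \<bullet> x j) *\<^sub>R v) \<bullet> u) (k \<bullet> x j)"
proof -
  define h where "h = 1 + norm k + norm k * norm v"
  have h: "h \<ge> 1" by (simp add: h_def)
  define \<epsilon> where "\<epsilon> = min (1 / (2 * h)) (\<delta> / (2 * h))"
  have \<epsilon>: "\<epsilon> > 0" using h assms(2) by (simp add: \<epsilon>_def)
  have \<epsilon>h: "\<epsilon> * h \<le> 1 / 2" "\<epsilon> * h \<le> \<delta> / 2"
  proof -
    have "\<epsilon> * h \<le> 1 / (2 * h) * h" "\<epsilon> * h \<le> \<delta> / (2 * h) * h"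
      using h by (intro mult_right_mono; simp add: \<epsilon>_def)+
    then show "\<epsilon> * h \<le> 1 / 2" "\<epsilon> * h \<le> \<delta> / 2" using h by simp_all
  qed
  have "\<forall>\<^sub>F j in sequentially. k \<bullet> x j \<ge> 1 / \<delta>" using kx by (simp add: filterlim_at_top)
  then show ?thesis using x_near_dir[OF \<epsilon>] eventually_norm_ge[of 1]
  proof eventually_elim
    case (elim j)
    define X where "X = norm (x j)"
    define e where "e = x j - X *\<^sub>R d"
    define r where "r = k \<bullet> x j"
    have X: "X \<ge> 1" using elim by (simp add: X_def)
    have e: "norm e \<le> \<epsilon> * X" using elim by (simp add: e_def X_def)
    have r0: "r > 0" using elim(1) assms(2) by (smt (verit) r_def divide_pos_pos)
    have xe: "x j = X *\<^sub>R d + e" by (simp add: e_def)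
    have "r = k \<bullet> e" by (simp add: r_def xe inner_add_right kd)
    then have "r \<le> norm k * norm e" using norm_cauchy_schwarz[of k e] by simp
    also have "\<dots> \<le> norm k * (\<epsilon> * X)" using e by (intro mult_left_mono) auto
    finally have rX: "r \<le> norm k * (\<epsilon> * X)" .
    have dd: "d \<bullet> d = 1" using norm_d by (simp add: norm_eq_1)
    have t: "\<bar>(x j - r *\<^sub>R v) \<bullet> d - X\<bar> \<le> \<epsilon> * h * X" and s: "\<bar>(x j - r *\<^sub>R v) \<bullet> u\<bar> \<le> \<epsilon> * h * X"
    proof -
      have n: "norm (e - r *\<^sub>R v) \<le> \<epsilon> * h * X"
      proof -
        have "norm (e - r *\<^sub>R v) \<le> norm e + r * norm v" using norm_triangle_ineq4[of e "r *\<^sub>R v"] r0 by simp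
        also have "\<dots> \<le> \<epsilon> * X + norm k * (\<epsilon> * X) * norm v" using e rX by (intro add_mono mult_right_mono) auto
        also have "\<dots> \<le> \<epsilon> * h * X" using X \<epsilon> by (simp add: h_def algebra_simps)
        finally show ?thesis .
      qed
      have "\<bar>(e - r *\<^sub>R v) \<bullet> d\<bar> \<le> norm (e - r *\<^sub>R v)" "\<bar>(e - r *\<^sub>R v) \<bullet> u\<bar> \<le> norm (e - r *\<^sub>R v)"
        using Cauchy_Schwarz_ineq2[of "e - r *\<^sub>R v"] norm_d norm_u by (metis mult.right_neutral)+
      moreover have "(x j - r *\<^sub>R v) \<bullet> d - X = (e - r *\<^sub>R v) \<bullet> d" "(x j - r *\<^sub>R v) \<bullet> u = (e - r *\<^sub>R v) \<bullet> u"
        using ud by (simp_all add: xe inner_diff_left inner_add_left dd inner_commute[of d u])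
      ultimately show "\<bar>(x j - r *\<^sub>R v) \<bullet> d - X\<bar> \<le> \<epsilon> * h * X" "\<bar>(x j - r *\<^sub>R v) \<bullet> u\<bar> \<le> \<epsilon> * h * X"
        using n by linarith+
    qed
    have b: "\<epsilon> * h * X \<le> X / 2" "\<epsilon> * h * X \<le> \<delta> / 2 * X"
      using mult_right_mono[OF \<epsilon>h(1), of X] mult_right_mono[OF \<epsilon>h(2), of X] X by simp_all
    have tX: "X / 2 \<le> (x j - r *\<^sub>R v) \<bullet> d" using t b by linarith
    have dt: "\<delta> / 2 * X \<le> \<delta> * ((x j - r *\<^sub>R v) \<bullet> d)"
      using mult_left_mono[OF tX, of \<delta>] assms(2) by simp
    have "r \<le> \<epsilon> * h * X"
    proof -
      have "norm k * (\<epsilon> * X) \<le> h * (\<epsilon> * X)" using \<epsilon> X by (intro mult_right_mono) (auto simp: h_def)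
      then show ?thesis using rX by (simp add: mult_ac)
    qed
    moreover have "1 \<le> \<delta> * r" using elim(1) assms(2) by (simp add: r_def field_simps)
    ultimately have "region \<delta> ((x j - r *\<^sub>R v) \<bullet> d) ((x j - r *\<^sub>R v) \<bullet> u) r"
      using s b dt r0 unfolding region_def by linarith
    then show ?case by (simp add: r_def)
  qed
qed

lemma region_contradiction:
  assumes v: "k \<bullet> v = 1" and \<delta>: "\<delta> > 0"
    and bound: "\<And>t s r. region \<delta> t s r \<Longrightarrow> pt v t s r \<in> C \<Longrightarrow>
      pt v t s r \<in> integer_points \<Longrightarrow> K \<le> cubic (pt v t s r)"
  shows False
proof -
  have "\<forall>\<^sub>F j in sequentially. K \<le> cubic (x j)"
    using eventually_region[OF v \<delta>]
  proof eventually_elim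
    case (elim j)
    from bound[OF this] show ?case
      unfolding coordinates[OF v, of "x j", symmetric] using x_cone x_int by blast
  qed
  then show False by (rule eventually_bounded_below_False)
qed

lemma wedge:
  assumes v: "k \<bullet> v = 1"
  obtains \<eta> where "\<eta> > 0" "\<And>t s r. t > 0 \<Longrightarrow> \<bar>s\<bar> \<le> \<eta> * t \<Longrightarrow> 0 \<le> r \<Longrightarrow> r \<le> \<eta> * t \<Longrightarrow> pt v t s r \<in> C"
proof -
  obtain \<eta> where \<eta>: "\<eta> > 0" "\<And>w. norm w \<le> \<eta> \<Longrightarrow> w \<in> tangent a m d \<Longrightarrow> d + w \<in> C"
    using poly_cone_tangent_nbhd[OF d_cone] by blast
  define \<eta>' where "\<eta>' = \<eta> / (1 + norm v)"
  have pos: "1 + norm v > 0" using norm_ge_zero[of v] by linarith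
  have \<eta>': "\<eta>' > 0" using \<eta>(1) pos by (simp add: \<eta>'_def)
  have "pt v t s r \<in> C" if t: "t > 0" "\<bar>s\<bar> \<le> \<eta>' * t" "0 \<le> r" "r \<le> \<eta>' * t" for t s r
  proof -
    define w where "w = (s / t) *\<^sub>R u + (r / t) *\<^sub>R v"
    have sr: "\<bar>s / t\<bar> \<le> \<eta>'" "\<bar>r / t\<bar> \<le> \<eta>'" using t by (auto simp: field_simps)
    have "norm w \<le> \<bar>s / t\<bar> * norm u + \<bar>r / t\<bar> * norm v"
      unfolding w_def by (rule order_trans[OF norm_triangle_ineq]) simp
    also have "\<dots> \<le> \<eta>' * 1 + \<eta>' * norm v"
      using sr norm_u by (intro add_mono mult_right_mono) auto
    also have "\<dots> = \<eta>' * (1 + norm v)" by (simp add: algebra_simps)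
    also have "\<dots> = \<eta>" using pos by (simp add: \<eta>'_def)
    finally have "norm w \<le> \<eta>" .
    moreover have "k \<bullet> w \<ge> 0" using t v ku by (simp add: w_def inner_add_right)
    ultimately have "t *\<^sub>R (d + w) \<in> C" using t by (intro poly_cone_scale \<eta>(2) half_space) auto
    moreover have "t *\<^sub>R (d + w) = pt v t s r" using t by (simp add: w_def scaleR_add_right)
    ultimately show ?thesis by simp
  qed
  then show thesis using that \<eta>' by blast
qed

lemma u_tangent: "u \<in> tangent a m d"
  using half_space ku by simp

lemma Tddu: "T d d u = 0"
proof -
  have "- u \<in> tangent a m d" using half_space ku by simp
  then show ?thesis using Tdd_tangent[OF u_tangent] Tdd_tangent[of "- u"] by (simp add: T_minus)
qed

lemma Tduu: "T d u u \<ge> 0"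
  using T_tangent_nonneg(2)[OF d_cone Tddd u_tangent Tddu] .

lemma T_expand:
  "T (pt v t s r) (pt v t s r) (pt v t s r) =
    3 * T d d v * (t\<^sup>2 * r) + 3 * T d u u * (t * s\<^sup>2) + 6 * T d u v * (t * s * r) + 3 * T d v v * (t * r\<^sup>2)
    + T u u u * s ^ 3 + 3 * T u u v * (s\<^sup>2 * r) + 3 * T u v v * (s * r\<^sup>2) + T v v v * r ^ 3"
proof -
  have sw: "T d u d = T d d u" "T u d d = T d d u" "T d v d = T d d v" "T v d d = T d d v"
    "T u d u = T d u u" "T u u d = T d u u" "T v d v = T d v v" "T v v d = T d v v"
    "T u v u = T u u v" "T v u u = T u u v" "T v u v = T u v v" "T v v u = T u v v"
    "T d v u = T d u v" "T u d v = T d u v" "T u v d = T d u v" "T v d u = T d u v" "T v u d = T d u v"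
    by (simp_all add: T_swap12 T_swap23)
  show ?thesis
    by (simp add: form_linear sw Tddd Tddu algebra_simps power2_eq_square power3_eq_cube)
qed

lemma B_expand:
  "B (pt v t s r) (pt v t s r) =
    2 * B d u * (t * s) + 2 * B d v * (t * r) + B u u * s\<^sup>2 + 2 * B u v * (s * r) + B v v * r\<^sup>2"
  by (simp add: form_linear Bdd B_swap[of u d] B_swap[of v d] B_swap[of v u] algebra_simps power2_eq_square)

lemma cubic_expand:
  "cubic (pt v t s r) =
    3 * T d d v * (t\<^sup>2 * r) + 3 * T d u u * (t * s\<^sup>2) + 6 * T d u v * (t * s * r) + 3 * T d v v * (t * r\<^sup>2)
    + T u u u * s ^ 3 + 3 * T u u v * (s\<^sup>2 * r) + 3 * T u v v * (s * r\<^sup>2) + T v v v * r ^ 3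
    + 2 * B d u * (t * s) + 2 * B d v * (t * r) + B u u * s\<^sup>2 + 2 * B u v * (s * r) + B v v * r\<^sup>2
    + L d * t + L u * s + L v * r"
  unfolding cubic_def T_expand B_expand by (simp add: form_linear mult_ac)

lemma T_wedge_nonneg:
  assumes v: "k \<bullet> v = 1"
  obtains \<eta> where "\<eta> > 0" "\<And>s r. \<bar>s\<bar> \<le> \<eta> \<Longrightarrow> 0 \<le> r \<Longrightarrow> r \<le> \<eta> \<Longrightarrow>
    3 * T d d v * r + 3 * T d u u * s\<^sup>2 + 6 * T d u v * (s * r) + 3 * T d v v * r\<^sup>2
    + T u u u * s ^ 3 + 3 * T u u v * (s\<^sup>2 * r) + 3 * T u v v * (s * r\<^sup>2) + T v v v * r ^ 3 \<ge> 0"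
proof -
  obtain \<eta> where \<eta>: "\<eta> > 0" "\<And>t s r. t > 0 \<Longrightarrow> \<bar>s\<bar> \<le> \<eta> * t \<Longrightarrow> 0 \<le> r \<Longrightarrow> r \<le> \<eta> * t \<Longrightarrow> pt v t s r \<in> C"
    using wedge[OF v] by blast
  show thesis
  proof (rule that[OF \<eta>(1)])
    fix s r assume "\<bar>s\<bar> \<le> \<eta>" "0 \<le> r" "r \<le> \<eta>"
    then have "pt v 1 s r \<in> C" by (intro \<eta>(2)) auto
    from cubic_term_nonneg[OF this] show "3 * T d d v * r + 3 * T d u u * s\<^sup>2 + 6 * T d u v * (s * r) + 3 * T d v v * r\<^sup>2
      + T u u u * s ^ 3 + 3 * T u u v * (s\<^sup>2 * r) + 3 * T u v v * (s * r\<^sup>2) + T v v v * r ^ 3 \<ge> 0"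
      unfolding T_expand by simp
  qed
qed

lemma Tuuu:
  assumes v: "k \<bullet> v = 1" and "T d u u = 0"
  shows "T u u u = 0"
proof -
  obtain \<eta> where \<eta>: "\<eta> > 0" "\<And>s r. \<bar>s\<bar> \<le> \<eta> \<Longrightarrow> 0 \<le> r \<Longrightarrow> r \<le> \<eta> \<Longrightarrow>
    3 * T d d v * r + 3 * T d u u * s\<^sup>2 + 6 * T d u v * (s * r) + 3 * T d v v * r\<^sup>2
    + T u u u * s ^ 3 + 3 * T u u v * (s\<^sup>2 * r) + 3 * T u v v * (s * r\<^sup>2) + T v v v * r ^ 3 \<ge> 0"
    using T_wedge_nonneg[OF v] by blast
  have "T u u u * \<eta> ^ 3 \<ge> 0" "T u u u * (- \<eta>) ^ 3 \<ge> 0"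
    using \<eta>(2)[of \<eta> 0] \<eta>(2)[of "- \<eta>" 0] \<eta>(1) assms(2) by auto
  then have "T u u u * \<eta> ^ 3 = 0" by simp
  then show ?thesis using \<eta>(1) by simp
qed

text \<open>Along integer points near a multiple \<tau> of an interior direction \<open>N d + v\<close>, the slope in direction d is
\<open>2 \<tau> B d v\<close> up to a bounded error, because \<open>T d\<close> vanishes on d and v. The points of the sequence would not do here:
on them a large component along u may hide a negative \<open>B d v\<close>.\<close>

lemma Bdv_nonneg:
  assumes v: "k \<bullet> v = 1" and Tdd0: "\<And>w. T d d w = 0" and Tdv0: "\<And>w. T d v w = 0"
  shows "B d v \<ge> 0"
proof (rule ccontr)
  assume neg: "\<not> B d v \<ge> 0"
  obtain \<eta> where \<eta>: "\<eta> > 0" "\<And>w. norm w \<le> \<eta> \<Longrightarrow> w \<in> tangent a m d \<Longrightarrow> d + w \<in> C"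
    using poly_cone_tangent_nbhd[OF d_cone] by blast
  define h where "h = real CARD('n)"
  have h: "h \<ge> 1" by (simp add: h_def Suc_leI)
  \<comment> \<open>So large that N d + v, and its integer roundings, stay in the cone near the direction d.\<close>
  define N where "N = (norm v + h) / \<eta>"
  have N: "N > 0" using h \<eta>(1) unfolding N_def by (intro divide_pos_pos add_nonneg_pos) auto
  have "eventually (\<lambda>\<tau>. \<tau> * (2 * B d v) + (3 * (M * h * h) + 2 * (M * h) + M) < 0) at_top"
    using neg by (intro eventually_linear_below) simp
  then obtain \<tau> where \<tau>: "\<tau> \<ge> max 1 (norm k * h)"
    "\<tau> * (2 * B d v) + (3 * (M * h * h) + 2 * (M * h) + M) < 0"
    unfolding eventually_at_top_linorder by (metis order_refl nle_le)
  define e where "e = \<tau> *\<^sub>R (N *\<^sub>R d + v)"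
  define y :: "real ^ 'n" where "y = (\<chi> i. of_int \<lfloor>e $ i\<rfloor>)"
  define \<epsilon> where "\<epsilon> = y - e"
  have yi: "y \<in> integer_points" by (simp add: y_def integer_points_def)
  have n\<epsilon>: "norm \<epsilon> \<le> h"
  proof -
    have "norm \<epsilon> \<le> (\<Sum>i\<in>UNIV. \<bar>\<epsilon> $ i\<bar>)" by (rule norm_le_l1_cart)
    also have "\<dots> \<le> (\<Sum>i\<in>(UNIV :: 'n set). 1)"
    proof (rule sum_mono)
      fix i :: 'n
      show "\<bar>\<epsilon> $ i\<bar> \<le> 1"
        using of_int_floor_le[of "e $ i"] real_of_int_floor_add_one_gt[of "e $ i"]
        unfolding \<epsilon>_def y_def vector_minus_component vec_lambda_beta by linarith
    qed
    finally show ?thesis by (simp add: h_def)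
  qed
  have ye: "y = \<tau> *\<^sub>R (N *\<^sub>R d + v) + \<epsilon>" by (simp add: \<epsilon>_def e_def)
  have yC: "y \<in> C"
  proof -
    have \<tau>1: "\<tau> \<ge> 1" using \<tau> by simp
    define w where "w = (1 / (\<tau> * N)) *\<^sub>R (\<tau> *\<^sub>R v + \<epsilon>)"
    have "norm (\<tau> *\<^sub>R v + \<epsilon>) \<le> \<tau> * norm v + \<tau> * h"
    proof (rule order_trans[OF norm_triangle_ineq])
      have "h \<le> \<tau> * h" using \<tau>1 h by simp
      then show "norm (\<tau> *\<^sub>R v) + norm \<epsilon> \<le> \<tau> * norm v + \<tau> * h" using n\<epsilon> \<tau>1 by simp
    qed
    then have "norm w \<le> (1 / (\<tau> * N)) * (\<tau> * norm v + \<tau> * h)"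
      using \<tau>1 N unfolding w_def norm_scaleR by (intro mult_mono) auto
    also have "\<dots> = (norm v + h) / N"
      using \<tau>1 N by (simp add: field_simps)
    also have "\<dots> = \<eta>" using N \<eta>(1) by (auto simp: N_def)
    finally have "norm w \<le> \<eta>" .
    moreover have "k \<bullet> w \<ge> 0"
    proof -
      have "\<bar>k \<bullet> \<epsilon>\<bar> \<le> norm k * h"
        using Cauchy_Schwarz_ineq2[of k \<epsilon>] mult_left_mono[OF n\<epsilon>, of "norm k"] by simp
      then have "\<tau> + k \<bullet> \<epsilon> \<ge> 0" using \<tau>(1) by linarith
      then show ?thesis using v N \<tau>1 by (simp add: w_def inner_add_right)
    qed
    ultimately have "(\<tau> * N) *\<^sub>R (d + w) \<in> C" using \<tau>1 N by (intro poly_cone_scale \<eta>(2) half_space) auto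
    moreover have "(\<tau> * N) *\<^sub>R (d + w) = y"
    proof -
      have "(\<tau> * N) *\<^sub>R w = \<tau> *\<^sub>R v + \<epsilon>" using \<tau>1 N by (simp add: w_def)
      then show ?thesis unfolding ye scaleR_add_right by simp
    qed
    ultimately show ?thesis by simp
  qed
  have "0 \<le> slope d y" by (rule slope_nonneg[OF d_cone Tddd yC yi]) (simp add: Tdd0 Bdd)
  also have "slope d y = 3 * T d \<epsilon> \<epsilon> + \<tau> * (2 * B d v) + 2 * B d \<epsilon> + L d"
  proof -
    have "T d \<epsilon> d = 0" "T d \<epsilon> v = 0" using Tdd0[of \<epsilon>] Tdv0[of \<epsilon>] by (metis T_swap23)+
    then show ?thesis unfolding slope_def ye
      by (simp add: form_linear Tdd0 Tdv0 Bdd algebra_simps)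
  qed
  also have "\<dots> \<le> \<tau> * (2 * B d v) + (3 * (M * h * h) + 2 * (M * h) + M)"
  proof -
    have "M * norm \<epsilon> * norm \<epsilon> \<le> M * h * h" "M * norm \<epsilon> \<le> M * h"
      using n\<epsilon> h M_nonneg by (auto intro!: mult_mono mult_left_mono)
    then have "T d \<epsilon> \<epsilon> \<le> M * h * h" "B d \<epsilon> \<le> M * h" "L d \<le> M"
      using T_bound[of d \<epsilon> \<epsilon>] B_bound[of d \<epsilon>] L_bound[of d] norm_d by auto
    then show ?thesis by linarith
  qed
  finally show False using \<tau>(2) by linarith
qed

text \<open>Otherwise \<open>t\<^sup>2 r\<close> would dominate.\<close>

lemma Tddv_zero:
  assumes v: "k \<bullet> v = 1"
  shows "T d d v = 0"
proof (rule ccontr)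
  assume "T d d v \<noteq> 0"
  moreover have "v \<in> tangent a m d" using half_space v by simp
  ultimately have pos: "3 * T d d v > 0" using Tdd_tangent[of v] by simp
  have "3 * T d u u \<ge> 0" using Tduu by simp
  moreover have "T u u u = 0" if "3 * T d u u = 0" using Tuuu[OF v] that by simp
  ultimately have "\<exists>\<delta>>0. \<forall>t s r. region \<delta> t s r \<longrightarrow> 0 \<le> cubic (pt v t s r)"
    unfolding cubic_expand by (rule dominated_by_ttr[OF pos])
  then show False using region_contradiction[OF v] by blast
qed

lemma Tdd0: "T d d w = 0" if v: "k \<bullet> v = 1"
  by (subst coordinates[OF v, of w]) (simp only: form_linear Tddd Tddu Tddv_zero[OF v] mult_zero_right add_0)

text \<open>Since the quadratic form \<open>T d\<close> is even, nonnegativity on the half-space extends to the whole space.\<close>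

lemma Tdww:
  assumes v: "k \<bullet> v = 1"
  shows "T d w w \<ge> 0"
proof -
  have *: "T d w w \<ge> 0" if "k \<bullet> w \<ge> 0" for w
    by (rule T_tangent_nonneg(2)[OF d_cone Tddd half_space[OF that] Tdd0[OF v]])
  show ?thesis using *[of w] *[of "- w"] by (cases "k \<bullet> w \<ge> 0") (auto simp: T_minus)
qed

lemma slope_d:
  assumes v: "k \<bullet> v = 1" and "y \<in> C" "y \<in> integer_points"
  shows "slope d y \<ge> 0"
  by (rule slope_nonneg[OF d_cone Tddd assms(2,3)]) (simp add: Tdd0[OF v] Bdd)

lemma not_positive_definite:
  assumes v: "k \<bullet> v = 1" and "T d u v = 0" "T d u u > 0"
  shows "T d v v = 0"
proof (rule ccontr)
  assume "T d v v \<noteq> 0"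
  then have "3 * T d v v > 0" "3 * T d u u > 0" using Tdww[OF v, of v] assms(3) by auto
  then have "\<exists>\<delta>>0. \<forall>t s r. region \<delta> t s r \<longrightarrow> 0 \<le> cubic (pt v t s r)"
    by (simp only: cubic_expand Tdd0[OF v] assms(2) mult_zero_left mult_zero_right add_0_left add_0_right)
      (rule dominated_by_tss_trr)
  then show False using region_contradiction[OF v] by blast
qed

text \<open>The form \<open>T d\<close> is nonnegative of rank one, with kernel spanned by d and v. So \<open>T d\<close> vanishes on the
directions d + \<eta> v, which lie in the interior of the cone for small \<eta> > 0, and the conditions in these directions
provide the hypotheses of \<open>transversal_bound\<close>.\<close>

lemma rank_one_contradiction:
  assumes v: "k \<bullet> v = 1" and duu: "T d u u > 0" and duv: "T d u v = 0" and dvv: "T d v v = 0"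
  shows False
proof -
  note dd = Tdd0[OF v]
  have dv: "T d v w = 0" for w
  proof -
    have "T d v d = 0" "T d v u = 0" using dd[of v] duv by (metis T_swap23)+
    then show ?thesis
      by (subst coordinates[OF v, of w]) (simp only: form_linear dvv mult_zero_right add_0)
  qed
  obtain \<eta> where \<eta>: "\<eta> > 0" and wC: "\<And>t s r. t > 0 \<Longrightarrow> \<bar>s\<bar> \<le> \<eta> * t \<Longrightarrow> 0 \<le> r \<Longrightarrow> r \<le> \<eta> * t \<Longrightarrow>
    pt v t s r \<in> C"
    using wedge[OF v] by blast
  have wT: "3 * T d u u * s\<^sup>2 + T u u u * s ^ 3 + 3 * T u u v * (s\<^sup>2 * r) + 3 * T u v v * (s * r\<^sup>2) + T v v v * r ^ 3 \<ge> 0"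
    if "\<bar>s\<bar> \<le> \<eta>" "0 \<le> r" "r \<le> \<eta>" for s r
    using cubic_term_nonneg[OF wC[of 1 s r]] that unfolding T_expand by (simp add: dd duv dvv)
  have vvv: "T v v v \<ge> 0"
    using wT[of 0 \<eta>] \<eta> by (simp add: zero_le_mult_iff)
  have uvv: "T u v v = 0" if vvv0: "T v v v = 0"
  proof -
    have 1: "3 * (T u v v * \<eta>\<^sup>2) \<ge> 0"
    proof (rule first_order_nonneg[OF \<eta>])
      fix e assume "0 < e" "e \<le> \<eta>"
      then show "0 \<le> e * (3 * (T u v v * \<eta>\<^sup>2)) + e\<^sup>2 * (3 * T d u u + 3 * T u u v * \<eta>) + e ^ 3 * T u u u"
        using wT[of e \<eta>] vvv0 by (simp add: algebra_simps)
    qed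
    have 2: "3 * (- T u v v * \<eta>\<^sup>2) \<ge> 0"
    proof (rule first_order_nonneg[OF \<eta>])
      fix e assume "0 < e" "e \<le> \<eta>"
      then show "0 \<le> e * (3 * (- T u v v * \<eta>\<^sup>2)) + e\<^sup>2 * (3 * T d u u + 3 * T u u v * \<eta>) + e ^ 3 * (- T u u u)"
        using wT[of "- e" \<eta>] vvv0 by (simp add: algebra_simps)
    qed
    have "T u v v * \<eta>\<^sup>2 = 0" using 1 2 by simp
    then show ?thesis using \<eta> by simp
  qed
  have bdv: "B d v \<ge> 0" by (rule Bdv_nonneg[OF v dd dv])
  have bvv: "B v v \<ge> 0" if "T v v v = 0" "B d v = 0"
  proof -
    have "pt v 1 0 \<eta> \<in> C" using \<eta> by (intro wC) auto
    from B_nonneg[OF this] have "B v v * \<eta>\<^sup>2 \<ge> 0"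
      unfolding T_expand B_expand by (simp add: dd duv dvv that)
    then show ?thesis using \<eta> by (simp add: zero_le_mult_iff)
  qed
  have "3 * T d u u > 0" "2 * B d v \<ge> 0" using duu bdv by auto
  moreover have "3 * T u v v = 0" if "T v v v = 0" using uvv that by simp
  moreover have "B v v \<ge> 0" if "T v v v = 0" "2 * B d v = 0" using bvv that by simp
  ultimately obtain K \<delta> where \<delta>: "\<delta> > 0" and bound: "\<And>t s r. region \<delta> t s r \<Longrightarrow>
    0 \<le> 3 * T d u u * s\<^sup>2 + 2 * B d u * s + 2 * B d v * r + L d \<Longrightarrow>
    (T v v v = 0 \<and> 2 * B d v = 0 \<and> B v v = 0 \<longrightarrow>
      0 \<le> 3 * T d u u * (t * s\<^sup>2) + 2 * B d u * (t * s) + L d * t + 3 * T u u v * (s\<^sup>2 * r) + 2 * B u v * (s * r) + L v * r) \<Longrightarrow>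
    K \<le> 3 * T d u u * (t * s\<^sup>2) + T u u u * s ^ 3 + 3 * T u u v * (s\<^sup>2 * r) + 3 * T u v v * (s * r\<^sup>2) + T v v v * r ^ 3
    + 2 * B d u * (t * s) + 2 * B d v * (t * r)
    + B u u * s\<^sup>2 + 2 * B u v * (s * r) + B v v * r\<^sup>2 + L d * t + L u * s + L v * r"
    using transversal_bound[OF _ vvv, of "3 * T d u u" "2 * B d v" "3 * T u v v" "B v v" "2 * B d u" "L d" "3 * T u u v"
      "2 * B u v" "L v" "T u u u" "B u u" "L u"] by metis
  define \<delta>' where "\<delta>' = min 1 (min \<delta> \<eta>)"
  have \<delta>': "\<delta>' > 0" "\<delta>' \<le> 1" using \<delta> \<eta> by (auto simp: \<delta>'_def)
  have \<delta>'_le: "\<delta>' \<le> \<delta>" "\<delta>' \<le> \<eta>" unfolding \<delta>'_def by linarith+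
  show False
  proof (rule region_contradiction[OF v \<delta>'(1), of K])
    fix t s r assume reg: "region \<delta>' t s r" and yC: "pt v t s r \<in> C"
      and yi: "pt v t s r \<in> integer_points"
    define y where "y = pt v t s r"
    note R = regionD[OF reg \<delta>']
    have reg1: "region \<delta> t s r" by (rule region_mono[OF reg \<delta>'(1) \<delta>'_le(1)])
    have \<eta>t: "\<delta>' * t \<le> \<eta> * t" using R \<delta>'_le by (intro mult_right_mono) auto
    have Tdyy: "T d y y = T d u u * s\<^sup>2"
      unfolding y_def using dd[of u] dd[of v] dv[of d] dv[of u] dv[of v] dd[of d]
      by (simp add: form_linear T_swap23[of d u d] T_swap23[of d u v] power2_eq_square)
    have "slope d y = 3 * T d u u * s\<^sup>2 + 2 * B d u * s + 2 * B d v * r + L d"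
      unfolding slope_def Tdyy by (simp add: y_def form_linear Bdd)
    then have 1: "0 \<le> 3 * T d u u * s\<^sup>2 + 2 * B d u * s + 2 * B d v * r + L d"
      using slope_d[OF v yC yi] by (simp add: y_def)
    have 2: "0 \<le> 3 * T d u u * (t * s\<^sup>2) + 2 * B d u * (t * s) + L d * t + 3 * T u u v * (s\<^sup>2 * r) + 2 * B u v * (s * r) + L v * r"
      if deg: "T v v v = 0 \<and> 2 * B d v = 0 \<and> B v v = 0"
    proof -
      define n where "n = t *\<^sub>R d + r *\<^sub>R v"
      have nC: "n \<in> C" using wC[of t 0 r] R \<eta>t \<eta> by (simp add: n_def)
      have uvv0: "T u v v = 0" using uvv deg by simp
      have vvy: "T v v y = 0"
        unfolding y_def using dv[of v] uvv0 deg
        by (simp add: form_linear T_swap13[of v v d] T_swap13[of v v u] T_swap13[of v v d])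
      have nny: "T n n y = 0"
        unfolding n_def using dd[of y] dv[of y] vvy
        by (simp add: form_linear T_swap12[of v d])
      have nnn: "T n n n = 0"
        unfolding n_def using dd dv[of v] dv[of d] deg
        by (simp add: form_linear T_swap12[of v d] T_swap13[of v v d])
      have Bnn: "B n n = 0" unfolding n_def using deg by (simp add: form_linear Bdd B_swap[of v d])
      have Tvyy: "T v y y = T u u v * s\<^sup>2"
      proof -
        have "T v y d = 0" "T v y v = 0" using dv[of y] vvy by (metis T_swap12 T_swap23)+
        then have "T v y y = s * T v y u" by (subst (2) y_def) (simp add: form_linear)
        also have "T v y u = s * T u u v"
          unfolding y_def using duv uvv0
          by (simp add: form_linear T_swap12[of v d] T_swap23[of d v u] T_swap13[of v u u] T_swap13[of v v u])
        finally show ?thesis by (simp add: power2_eq_square)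
      qed
      have "slope n y = 3 * T d u u * (t * s\<^sup>2) + 2 * B d u * (t * s) + L d * t + 3 * T u u v * (s\<^sup>2 * r) + 2 * B u v * (s * r) + L v * r"
      proof -
        have "T n y y = T d u u * (t * s\<^sup>2) + T u u v * (s\<^sup>2 * r)" by (simp add: n_def form_linear Tdyy Tvyy)
        moreover have "B n y = B d u * (t * s) + B u v * (s * r)"
          using deg by (simp add: n_def y_def form_linear Bdd B_swap[of v d] B_swap[of v u] algebra_simps)
        ultimately show ?thesis unfolding slope_def by (simp add: n_def form_linear)
      qed
      moreover have "slope n y \<ge> 0"
        using yC yi by (intro slope_nonneg nC nnn) (simp_all add: y_def[symmetric] nny Bnn)
      ultimately show ?thesis by simp
    qed
    show "K \<le> cubic (pt v t s r)"
      using bound[OF reg1 1] 2 unfolding cubic_expand by (simp add: dd duv dvv)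
  qed
qed

text \<open>If \<open>T d u u > 0\<close>, a shear of v makes u and v orthogonal for \<open>T d\<close>, which is then definite modulo d or of
rank one.\<close>

lemma Tduu_zero:
  assumes v: "k \<bullet> v = 1"
  shows "T d u u = 0"
proof (rule ccontr)
  assume "T d u u \<noteq> 0"
  then have pos: "T d u u > 0" using Tduu by simp
  \<comment> \<open>The shear that makes u and the new v orthogonal for the form T d.\<close>
  define w where "w = v - (T d u v / T d u u) *\<^sub>R u"
  have w: "k \<bullet> w = 1" using v ku by (simp add: w_def inner_diff_right)
  have duw: "T d u w = 0" using pos by (simp add: w_def form_diff form_linear)
  show False by (rule rank_one_contradiction[OF w pos duw not_positive_definite[OF w duw pos]])
qed

lemma Tdu0:
  assumes v: "k \<bullet> v = 1"
  shows "T d u w = 0"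
proof -
  have "T d w w + c * (2 * T d u w) \<ge> 0" for c
    using Tdww[OF v, of "w + c *\<^sub>R u"] Tduu_zero[OF v] by (simp add: form_linear T_swap23[of d w u])
  from zero_if_affine_nonneg[OF this] show ?thesis by simp
qed

text \<open>The directions d + s u lie in the boundary plane and annihilate the cubic form for small s of either sign.\<close>

lemma Bdu_Buu_Tuuv:
  assumes v: "k \<bullet> v = 1"
  shows "B d u = 0" "B u u \<ge> 0" "T u u v \<ge> 0"
proof -
  obtain \<eta> where \<eta>: "\<eta> > 0" and wC: "\<And>t s r. t > 0 \<Longrightarrow> \<bar>s\<bar> \<le> \<eta> * t \<Longrightarrow> 0 \<le> r \<Longrightarrow> r \<le> \<eta> * t \<Longrightarrow>
    pt v t s r \<in> C"
    using wedge[OF v] by blast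
  have uuu: "T u u u = 0" by (rule Tuuu[OF v Tduu_zero[OF v]])
  have Bs: "2 * B d u * s + B u u * s\<^sup>2 \<ge> 0" if "\<bar>s\<bar> \<le> \<eta>" for s
  proof -
    have "pt v 1 s 0 \<in> C" using that \<eta> by (intro wC) auto
    from B_nonneg[OF this] show ?thesis
      unfolding T_expand B_expand by (simp add: Tduu_zero[OF v] uuu)
  qed
  have 1: "2 * B d u \<ge> 0"
  proof (rule first_order_nonneg[OF \<eta>])
    fix e assume "0 < e" "e \<le> \<eta>"
    then show "0 \<le> e * (2 * B d u) + e\<^sup>2 * B u u + e ^ 3 * 0" using Bs[of e] by (simp add: mult_ac)
  qed
  have 2: "- 2 * B d u \<ge> 0"
  proof (rule first_order_nonneg[OF \<eta>])
    fix e assume "0 < e" "e \<le> \<eta>"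
    then show "0 \<le> e * (- 2 * B d u) + e\<^sup>2 * B u u + e ^ 3 * 0" using Bs[of "- e"] by (simp add: mult_ac)
  qed
  show du: "B d u = 0" using 1 2 by simp
  show "B u u \<ge> 0" using Bs[of \<eta>] \<eta> by (simp add: du zero_le_mult_iff)
  have "3 * T u u v * \<eta>\<^sup>2 \<ge> 0"
  proof (rule first_order_nonneg[OF \<eta>])
    fix e assume e: "0 < e" "e \<le> \<eta>"
    have "pt v 1 \<eta> e \<in> C" using e \<eta> by (intro wC) auto
    from cubic_term_nonneg[OF this]
    show "0 \<le> e * (3 * T u u v * \<eta>\<^sup>2) + e\<^sup>2 * (3 * T d v v + 3 * T u v v * \<eta>) + e ^ 3 * T v v v"
      unfolding T_expand by (simp add: Tdd0[OF v] Tdu0[OF v] uuu algebra_simps)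
  qed
  then show "T u u v \<ge> 0" using \<eta> by (simp add: zero_le_mult_iff)
qed

lemma Tdvv_zero:
  assumes v: "k \<bullet> v = 1"
  shows "T d v v = 0"
proof (rule ccontr)
  assume "T d v v \<noteq> 0"
  then have "3 * T d v v > 0" using Tdww[OF v, of v] by simp
  moreover have "3 * T u u v \<ge> 0" "B u u \<ge> 0" using Bdu_Buu_Tuuv[OF v] by auto
  ultimately have "\<exists>\<delta>>0. \<forall>t s r. region \<delta> t s r \<longrightarrow> 0 \<le> cubic (pt v t s r)"
    by (simp only: cubic_expand Tdd0[OF v] Tdu0[OF v] Tuuu[OF v Tduu_zero[OF v]] Bdu_Buu_Tuuv(1)[OF v]
        mult_zero_left mult_zero_right add_0_left add_0_right)
      (rule dominated_by_trr)
  then show False using region_contradiction[OF v] by blast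
qed

text \<open>At this point d drops out of the cubic form altogether: t survives in f only through \<open>B d v\<close> and \<open>L d\<close>.\<close>

lemma Td0:
  assumes v: "k \<bullet> v = 1"
  shows "T d w w' = 0"
proof -
  have dv: "T d v w' = 0"
  proof -
    have "T d v d = 0" "T d v u = 0" using Tdd0[OF v, of v] Tdu0[OF v, of v] by (metis T_swap23)+
    then show ?thesis
      by (subst coordinates[OF v, of w'])
        (simp only: form_linear Tdvv_zero[OF v] mult_zero_right add_0)
  qed
  show ?thesis
    by (subst coordinates[OF v, of w])
      (simp only: form_linear Tdd0[OF v] Tdu0[OF v] dv mult_zero_right add_0)
qed

text \<open>Adding a large multiple of d moves any point of the half-space into the cone; so a function that does not
depend on t inherits its sign on the half-plane from the cone.\<close>

lemma wedge_large:
  assumes v: "k \<bullet> v = 1" and "r \<ge> 0"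
  obtains t where "t > 0" "pt v t s r \<in> C"
proof -
  obtain \<eta> where \<eta>: "\<eta> > 0" and wC: "\<And>t s r. t > 0 \<Longrightarrow> \<bar>s\<bar> \<le> \<eta> * t \<Longrightarrow> 0 \<le> r \<Longrightarrow> r \<le> \<eta> * t \<Longrightarrow>
    pt v t s r \<in> C"
    using wedge[OF v] by blast
  define t where "t = (\<bar>s\<bar> + r + 1) / \<eta>"
  have "\<eta> * t = \<bar>s\<bar> + r + 1" "t > 0" using \<eta> assms(2) by (simp_all add: t_def add_nonneg_pos)
  then show thesis using that[of t] wC[of t s r] assms(2) by simp
qed

lemma T_half_plane_nonneg:
  assumes v: "k \<bullet> v = 1" and "r \<ge> 0"
  shows "3 * T u u v * (s\<^sup>2 * r) + 3 * T u v v * (s * r\<^sup>2) + T v v v * r ^ 3 \<ge> 0"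
proof -
  obtain t where "pt v t s r \<in> C" using wedge_large[OF assms] by blast
  from cubic_term_nonneg[OF this] show ?thesis
    unfolding T_expand by (simp add: Td0[OF v] Tuuu[OF v])
qed

lemma Bdv0:
  assumes v: "k \<bullet> v = 1"
  shows "B d v = 0"
proof (rule ccontr)
  assume "B d v \<noteq> 0"
  then have "2 * B d v > 0" using Bdv_nonneg[OF v Td0[OF v] Td0[OF v]] by simp
  moreover have "B u u \<ge> 0" using Bdu_Buu_Tuuv[OF v] by simp
  ultimately obtain \<delta> where \<delta>: "\<delta> > 0" and bound: "\<And>t s r. region \<delta> t s r \<Longrightarrow>
    0 \<le> 2 * B d v * (t * r) + B u u * s\<^sup>2 + 2 * B u v * (s * r) + B v v * r\<^sup>2 + L d * t + L u * s + L v * r"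
    using dominated_by_tr by blast
  show False
  proof (rule region_contradiction[OF v \<delta>, of 0])
    fix t s r assume reg: "region \<delta> t s r"
    then have "r \<ge> 0" by (simp add: region_def)
    from T_half_plane_nonneg[OF v this, of s] bound[OF reg]
    show "0 \<le> cubic (pt v t s r)"
      unfolding cubic_expand by (simp add: Td0[OF v] Tuuu[OF v] Bdu_Buu_Tuuv(1)[OF v])
  qed
qed

lemma cubic_reduced:
  assumes v: "k \<bullet> v = 1"
  shows "cubic (pt v t s r) = 3 * T u u v * (s\<^sup>2 * r) + 3 * T u v v * (s * r\<^sup>2) + T v v v * r ^ 3
    + B u u * s\<^sup>2 + 2 * B u v * (s * r) + B v v * r\<^sup>2 + L d * t + L u * s + L v * r"
  unfolding cubic_expand by (simp add: Td0[OF v] Tuuu[OF v] Bdu_Buu_Tuuv(1)[OF v] Bdv0[OF v])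

lemma Ld_nonneg:
  assumes v: "k \<bullet> v = 1"
  shows "L d \<ge> 0"
proof -
  have Bd: "B d w = 0" for w
    by (subst coordinates[OF v, of w])
      (simp only: form_linear Bdd Bdu_Buu_Tuuv(1)[OF v] Bdv0[OF v] mult_zero_right add_0)
  show ?thesis using slope_d[OF v x_cone x_int, of 0] by (simp add: slope_def Td0[OF v] Bd)
qed

lemma B_half_plane_nonneg:
  assumes v: "k \<bullet> v = 1" and "r \<ge> 0"
    and "3 * T u u v * (s\<^sup>2 * r) + 3 * T u v v * (s * r\<^sup>2) + T v v v * r ^ 3 = 0"
  shows "B u u * s\<^sup>2 + 2 * B u v * (s * r) + B v v * r\<^sup>2 \<ge> 0"
proof -
  obtain t where C: "pt v t s r \<in> C" using wedge_large[OF assms(1,2)] by blast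
  have "B (pt v t s r) (pt v t s r) \<ge> 0"
    by (rule B_nonneg[OF C]) (unfold T_expand, use assms(3) in \<open>simp add: Td0[OF v] Tuuu[OF v]\<close>)
  then show ?thesis unfolding B_expand by (simp add: Bdu_Buu_Tuuv(1)[OF v] Bdv0[OF v])
qed

text \<open>The slope in the direction obtained from the point itself by deleting its u-component. All directions t d + r v
are degenerate under the hypotheses.\<close>

lemma slope_v_nonneg:
  assumes v: "k \<bullet> v = 1" and "T v v v = 0" "T u v v = 0" "B v v = 0"
  shows "\<exists>\<eta>>0. \<forall>t s r. t > 0 \<longrightarrow> 0 \<le> r \<longrightarrow> r \<le> \<eta> * t \<longrightarrow> pt v t s r \<in> C \<longrightarrow>
    pt v t s r \<in> integer_points \<longrightarrow>
    0 \<le> L d * t + 3 * T u u v * (s\<^sup>2 * r) + 2 * B u v * (s * r) + L v * r"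
proof -
  obtain \<eta> where \<eta>: "\<eta> > 0" and wC: "\<And>t s r. t > 0 \<Longrightarrow> \<bar>s\<bar> \<le> \<eta> * t \<Longrightarrow> 0 \<le> r \<Longrightarrow> r \<le> \<eta> * t \<Longrightarrow>
    pt v t s r \<in> C"
    using wedge[OF v] by blast
  show ?thesis
  proof (rule exI[of _ \<eta>], rule conjI[OF \<eta>], intro allI impI)
    fix t s r assume t: "t > 0" "0 \<le> r" "r \<le> \<eta> * t"
    define y where "y = pt v t s r"
    define n where "n = t *\<^sub>R d + r *\<^sub>R v"
    assume "pt v t s r \<in> C" "pt v t s r \<in> integer_points"
    then have y: "y \<in> C" "y \<in> integer_points" by (simp_all add: y_def)
    have nC: "n \<in> C" using wC[of t 0 r] t \<eta> by (simp add: n_def)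
    have d0: "T d w w' = 0" "T w d w' = 0" "T w w' d = 0" for w w'
      using Td0[OF v] by (metis T_swap12 T_swap23)+
    have "T v v u = 0" "T v u v = 0" using assms(3) by (metis T_swap12 T_swap23)+
    then have nny: "T n n y = 0" and nnn: "T n n n = 0"
      using assms(2) by (simp_all add: n_def y_def form_linear d0)
    have Bnn: "B n n = 0" using assms(4) by (simp add: n_def form_linear Bdd Bdv0[OF v] B_swap[of v d])
    have "T n y y = T u u v * (s\<^sup>2 * r)"
      using \<open>T v v u = 0\<close> \<open>T v u v = 0\<close> assms(2)
      by (simp add: n_def y_def form_linear d0 T_swap13[of v u u] power2_eq_square)
    moreover have "B n y = B u v * (s * r)"
      using assms(4) by (simp add: n_def y_def form_linear Bdd Bdv0[OF v] Bdu_Buu_Tuuv(1)[OF v] B_swap[of v d] B_swap[of v u])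
    ultimately have "slope n y = L d * t + 3 * T u u v * (s\<^sup>2 * r) + 2 * B u v * (s * r) + L v * r"
      unfolding slope_def by (simp add: n_def form_linear)
    moreover have "slope n y \<ge> 0" by (intro slope_nonneg nC nnn y) (simp add: nny Bnn)
    ultimately show "0 \<le> L d * t + 3 * T u u v * (s\<^sup>2 * r) + 2 * B u v * (s * r) + L v * r" by simp
  qed
qed

text \<open>The counterpart of \<open>slope_v_nonneg\<close> for directions in the boundary plane.\<close>

lemma slope_u_nonneg:
  assumes v: "k \<bullet> v = 1" and "T u u v = 0" "T u v v = 0" "B u u = 0"
  shows "\<exists>\<eta>>0. \<forall>t s r. t > 0 \<longrightarrow> \<bar>s\<bar> \<le> \<eta> * t \<longrightarrow> pt v t s r \<in> C \<longrightarrow>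
    pt v t s r \<in> integer_points \<longrightarrow>
    0 \<le> L d * t + L u * s + 2 * B u v * (s * r)"
proof -
  obtain \<eta> where \<eta>: "\<eta> > 0" and wC: "\<And>t s r. t > 0 \<Longrightarrow> \<bar>s\<bar> \<le> \<eta> * t \<Longrightarrow> 0 \<le> r \<Longrightarrow> r \<le> \<eta> * t \<Longrightarrow>
    pt v t s r \<in> C"
    using wedge[OF v] by blast
  show ?thesis
  proof (rule exI[of _ \<eta>], rule conjI[OF \<eta>], intro allI impI)
    fix t s r assume t: "t > 0" "\<bar>s\<bar> \<le> \<eta> * t"
    define y where "y = pt v t s r"
    define n where "n = t *\<^sub>R d + s *\<^sub>R u"
    assume "pt v t s r \<in> C" "pt v t s r \<in> integer_points"
    then have y: "y \<in> C" "y \<in> integer_points" by (simp_all add: y_def)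
    have nC: "n \<in> C" using wC[of t s 0] t \<eta> by (simp add: n_def)
    have d0: "T d w w' = 0" "T w d w' = 0" "T w w' d = 0" for w w'
      using Td0[OF v] by (metis T_swap12 T_swap23)+
    have uuu: "T u u u = 0" by (rule Tuuu[OF v Td0[OF v]])
    have "T u v u = 0" using assms(2) by (metis T_swap23)
    then have nny: "T n n y = 0" and nnn: "T n n n = 0" and nyy: "T n y y = 0"
      using assms(2,3) uuu by (simp_all add: n_def y_def form_linear d0)
    have Bnn: "B n n = 0"
      using assms(4) by (simp add: n_def form_linear Bdd Bdu_Buu_Tuuv(1)[OF v] B_swap[of u d])
    have "B n y = B u v * (s * r)"
      using assms(4) by (simp add: n_def y_def form_linear Bdd Bdv0[OF v] Bdu_Buu_Tuuv(1)[OF v] B_swap[of u d])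
    then have "slope n y = L d * t + L u * s + 2 * B u v * (s * r)"
      unfolding slope_def nyy by (simp add: n_def form_linear)
    moreover have "slope n y \<ge> 0" by (intro slope_nonneg nC nnn y) (simp add: nny Bnn)
    ultimately show "0 \<le> L d * t + L u * s + 2 * B u v * (s * r)" by simp
  qed
qed

text \<open>If \<open>T u u v > 0\<close>, completing the square removes the term in \<open>s r\<^sup>2\<close>, and \<open>s_square_r_bound\<close> applies.\<close>

lemma Tuuv_zero:
  assumes v: "k \<bullet> v = 1"
  shows "T u u v = 0"
proof (rule ccontr)
  assume "T u u v \<noteq> 0"
  then have pos: "T u u v > 0" using Bdu_Buu_Tuuv(3)[OF v] by simp
  \<comment> \<open>The shear that completes the square: the coefficient of s r^2 becomes 0.\<close>
  define w where "w = v - (T u v v / (2 * T u u v)) *\<^sub>R u"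
  have w: "k \<bullet> w = 1" using v ku by (simp add: w_def inner_diff_right)
  have uuu: "T u u u = 0" by (rule Tuuu[OF v Td0[OF v]])
  have uuw: "T u u w = T u u v" by (simp add: w_def form_diff form_linear uuu)
  have uww: "T u w w = 0"
    using pos by (simp add: w_def form_diff form_linear uuu T_swap23[of u v u] field_simps)
  have www: "T w w w \<ge> 0" using T_half_plane_nonneg[OF w, of 1 0] by simp
  have bww: "B w w \<ge> 0" if "T w w w = 0"
    using B_half_plane_nonneg[OF w, of 1 0] that by simp
  have "3 * T u u w > 0" using pos uuw by simp
  from s_square_r_bound[OF this www Bdu_Buu_Tuuv(2)[OF w] Ld_nonneg[OF w] bww, of "2 * B u w" "L w" "L u"]
  obtain K \<delta> where \<delta>: "\<delta> > 0" and bound: "\<And>t s r. region \<delta> t s r \<Longrightarrow>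
    (T w w w = 0 \<and> B w w = 0 \<longrightarrow> 0 \<le> L d * t + 3 * T u u w * (s\<^sup>2 * r) + 2 * B u w * (s * r) + L w * r) \<Longrightarrow>
    K \<le> 3 * T u u w * (s\<^sup>2 * r) + T w w w * r ^ 3 + B u u * s\<^sup>2 + 2 * B u w * (s * r) + B w w * r\<^sup>2
      + L d * t + L u * s + L w * r"
    by blast
  have "\<exists>\<eta>>0. T w w w = 0 \<and> B w w = 0 \<longrightarrow> (\<forall>t s r. t > 0 \<longrightarrow> 0 \<le> r \<longrightarrow> r \<le> \<eta> * t \<longrightarrow>
    pt w t s r \<in> C \<longrightarrow> pt w t s r \<in> integer_points \<longrightarrow>
    0 \<le> L d * t + 3 * T u u w * (s\<^sup>2 * r) + 2 * B u w * (s * r) + L w * r)"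
    using slope_v_nonneg[OF w _ uww] zero_less_one by metis
  then obtain \<eta> where \<eta>: "\<eta> > 0" and sl: "T w w w = 0 \<and> B w w = 0 \<Longrightarrow> t > 0 \<Longrightarrow> 0 \<le> r \<Longrightarrow> r \<le> \<eta> * t \<Longrightarrow>
    pt w t s r \<in> C \<Longrightarrow> pt w t s r \<in> integer_points \<Longrightarrow>
    0 \<le> L d * t + 3 * T u u w * (s\<^sup>2 * r) + 2 * B u w * (s * r) + L w * r" for t s r
    by blast
  define \<delta>' where "\<delta>' = min 1 (min \<delta> \<eta>)"
  have \<delta>': "\<delta>' > 0" "\<delta>' \<le> 1" using \<delta> \<eta> by (auto simp: \<delta>'_def)
  have \<delta>'_le: "\<delta>' \<le> \<delta>" "\<delta>' \<le> \<eta>" unfolding \<delta>'_def by linarith+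
  show False
  proof (rule region_contradiction[OF w \<delta>'(1), of K])
    fix t s r assume reg: "region \<delta>' t s r" and y: "pt w t s r \<in> C"
      "pt w t s r \<in> integer_points"
    note R = regionD[OF reg \<delta>']
    have \<eta>t: "\<delta>' * t \<le> \<eta> * t" using R \<delta>'_le by (intro mult_right_mono) auto
    have "T w w w = 0 \<and> B w w = 0 \<longrightarrow> 0 \<le> L d * t + 3 * T u u w * (s\<^sup>2 * r) + 2 * B u w * (s * r) + L w * r"
      using R \<eta>t by (intro impI sl y; (assumption | linarith))
    from bound[OF region_mono[OF reg \<delta>'(1) \<delta>'_le(1)] this]
    show "K \<le> cubic (pt w t s r)"
      unfolding cubic_reduced[OF w] uww by simp
  qed
qed

lemma Tuvv_zero:
  assumes v: "k \<bullet> v = 1"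
  shows "T u v v = 0"
proof -
  have "T v v v + c * (3 * T u v v) \<ge> 0" for c
    using T_half_plane_nonneg[OF v, of 1 c] by (simp add: Tuuv_zero[OF v] mult_ac)
  from zero_if_affine_nonneg[OF this] show ?thesis by simp
qed

text \<open>The cubic form is now a multiple of \<open>r ^ 3\<close>. If \<open>B u u > 0\<close>, a shear of v makes u and v orthogonal for B, and
s enters only through \<open>B u u * s\<^sup>2 + L u * s\<close>, which is bounded below. If \<open>B u u = 0\<close>, all terms with s are
part of a slope in the boundary plane. The remaining terms in r either tend to infinity or belong to a slope.\<close>

lemma degenerate_direction_contradiction:
  assumes v: "k \<bullet> v = 1"
  shows False
proof (cases "B u u = 0")
  case Buu: True
  have vvv: "T v v v \<ge> 0" using T_half_plane_nonneg[OF v, of 1 0] by simp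
  obtain \<eta> where \<eta>: "\<eta> > 0" and sl: "\<And>t s r. t > 0 \<Longrightarrow> \<bar>s\<bar> \<le> \<eta> * t \<Longrightarrow> pt v t s r \<in> C \<Longrightarrow>
    pt v t s r \<in> integer_points \<Longrightarrow> 0 \<le> L d * t + L u * s + 2 * B u v * (s * r)"
    using slope_u_nonneg[OF v Tuuv_zero[OF v] Tuvv_zero[OF v] Buu] by blast
  have flat: "B u v = 0 \<and> B v v \<ge> 0" if "T v v v = 0"
  proof -
    have *: "B v v + c * (2 * B u v) \<ge> 0" for c
      using B_half_plane_nonneg[OF v, of 1 c] that
      by (simp add: Tuuv_zero[OF v] Tuvv_zero[OF v] Buu mult_ac)
    then show ?thesis using zero_if_affine_nonneg[OF *] *[of 0] by simp
  qed
  show False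
  proof (cases "T v v v = 0 \<and> B v v = 0")
    case True
    show False
    proof (rule region_contradiction[OF v zero_less_one, of 0])
      fix t s r assume y: "pt v t s r \<in> C" "pt v t s r \<in> integer_points"
      define y where "y = pt v t s r"
      have Tyyy: "T y y y = 0" and Byy: "B y y = 0"
        unfolding y_def T_expand B_expand using True flat
        by (simp_all add: Td0[OF v] Tuuu[OF v] Tuuv_zero[OF v] Tuvv_zero[OF v] Buu Bdu_Buu_Tuuv(1)[OF v] Bdv0[OF v])
      have "0 \<le> slope y y" using y by (intro slope_nonneg Tyyy) (simp_all add: y_def[symmetric] Tyyy Byy)
      then have "0 \<le> cubic y" by (simp add: slope_def cubic_def Tyyy Byy)
      then show "0 \<le> cubic (pt v t s r)" by (simp add: y_def)
    qed
  next
    case False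
    then have "T v v v > 0 \<or> (T v v v = 0 \<and> B v v > 0)" using vvv flat by force
    from r_dominates[OF this] obtain \<delta> where \<delta>: "\<delta> > 0" and
      bound: "\<And>t s r. region \<delta> t s r \<Longrightarrow> 0 \<le> T v v v * r ^ 3 + B v v * r\<^sup>2 + L v * r" by blast
    define \<delta>' where "\<delta>' = min 1 (min \<delta> \<eta>)"
    have \<delta>': "\<delta>' > 0" "\<delta>' \<le> 1" using \<delta> \<eta> by (auto simp: \<delta>'_def)
    have \<delta>'_le: "\<delta>' \<le> \<delta>" "\<delta>' \<le> \<eta>" unfolding \<delta>'_def by linarith+
    show False
    proof (rule region_contradiction[OF v \<delta>'(1), of 0])
      fix t s r assume reg: "region \<delta>' t s r" and y: "pt v t s r \<in> C"
        "pt v t s r \<in> integer_points"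
      note R = regionD[OF reg \<delta>']
      have \<eta>t: "\<delta>' * t \<le> \<eta> * t" using R \<delta>'_le by (intro mult_right_mono) auto
      have "0 \<le> L d * t + L u * s + 2 * B u v * (s * r)" using R \<eta>t by (intro sl y; linarith)
      then show "0 \<le> cubic (pt v t s r)"
        using bound[OF region_mono[OF reg \<delta>'(1) \<delta>'_le(1)]]
        unfolding cubic_reduced[OF v] by (simp add: Tuuv_zero[OF v] Tuvv_zero[OF v] Buu)
    qed
  qed
next
  case False
  then have pos: "B u u > 0" using Bdu_Buu_Tuuv(2)[OF v] by simp
  define w where "w = v - (B u v / B u u) *\<^sub>R u"
  have w: "k \<bullet> w = 1" using v ku by (simp add: w_def inner_diff_right)
  have Buw: "B u w = 0" using pos by (simp add: w_def form_diff form_linear)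
  have www: "T w w w \<ge> 0" using T_half_plane_nonneg[OF w, of 1 0] by simp
  have bww: "B w w \<ge> 0" if "T w w w = 0"
    using B_half_plane_nonneg[OF w, of 1 0] that by simp
  have sq: "B u u * s\<^sup>2 + L u * s \<ge> - ((L u)\<^sup>2 / (4 * B u u))" for s
  proof -
    have "0 \<le> (2 * B u u * s + L u)\<^sup>2 / (4 * B u u)" using pos by simp
    also have "\<dots> = B u u * s\<^sup>2 + L u * s + (L u)\<^sup>2 / (4 * B u u)"
      using pos by (simp add: field_simps power2_eq_square)
    finally show ?thesis by simp
  qed
  show False
  proof (cases "T w w w = 0 \<and> B w w = 0")
    case True
    obtain \<eta> where \<eta>: "\<eta> > 0" and sl: "\<And>t s r. t > 0 \<Longrightarrow> 0 \<le> r \<Longrightarrow> r \<le> \<eta> * t \<Longrightarrow>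
      pt w t s r \<in> C \<Longrightarrow> pt w t s r \<in> integer_points \<Longrightarrow>
      0 \<le> L d * t + 3 * T u u w * (s\<^sup>2 * r) + 2 * B u w * (s * r) + L w * r"
      using slope_v_nonneg[OF w _ Tuvv_zero[OF w]] True by blast
    define \<delta>' where "\<delta>' = min 1 \<eta>"
    have \<delta>': "\<delta>' > 0" "\<delta>' \<le> 1" using \<eta> by (auto simp: \<delta>'_def)
    show False
    proof (rule region_contradiction[OF w \<delta>'(1)])
      fix t s r assume reg: "region \<delta>' t s r" and y: "pt w t s r \<in> C"
        "pt w t s r \<in> integer_points"
      note R = regionD[OF reg \<delta>']
      have \<eta>t: "\<delta>' * t \<le> \<eta> * t" using R by (intro mult_right_mono) (auto simp: \<delta>'_def)
      have "0 \<le> L d * t + 3 * T u u w * (s\<^sup>2 * r) + 2 * B u w * (s * r) + L w * r"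
        using R \<eta>t by (intro sl y; linarith)
      then show "- ((L u)\<^sup>2 / (4 * B u u)) \<le> cubic (pt w t s r)"
        using sq[of s] True unfolding cubic_reduced[OF w]
        by (simp add: Tuuv_zero[OF w] Tuvv_zero[OF w] Buw)
    qed
  next
    case False
    then have "T w w w > 0 \<or> (T w w w = 0 \<and> B w w > 0)" using www bww by force
    from r_dominates[OF this] obtain \<delta> where \<delta>: "\<delta> > 0" and
      bound: "\<And>t s r. region \<delta> t s r \<Longrightarrow> 0 \<le> T w w w * r ^ 3 + B w w * r\<^sup>2 + L w * r" by blast
    define \<delta>' where "\<delta>' = min 1 \<delta>"
    have \<delta>': "\<delta>' > 0" "\<delta>' \<le> 1" "\<delta>' \<le> \<delta>" using \<delta> by (auto simp: \<delta>'_def)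
    show False
    proof (rule region_contradiction[OF w \<delta>'(1)])
      fix t s r assume reg: "region \<delta>' t s r"
      note R = regionD[OF reg \<delta>'(1,2)]
      have "0 \<le> L d * t" using Ld_nonneg[OF w] R by simp
      then show "- ((L u)\<^sup>2 / (4 * B u u)) \<le> cubic (pt w t s r)"
        using sq[of s] bound[OF region_mono[OF reg \<delta>'(1,3)]] unfolding cubic_reduced[OF w]
        by (simp add: Tuuv_zero[OF w] Tuvv_zero[OF w] Buw)
    qed
  qed
qed

lemma half_space_contradiction: False
proof -
  have "k \<noteq> 0"
  proof
    assume "k = 0"
    moreover have "\<forall>\<^sub>F j in sequentially. k \<bullet> x j \<ge> 1" using kx by (simp add: filterlim_at_top)
    ultimately show False by simp
  qed
  then have "k \<bullet> (k /\<^sub>R (k \<bullet> k)) = 1" by simp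
  then show False by (rule degenerate_direction_contradiction)
qed

end

context rayless_sequence
begin

text \<open>Dimension at most three forces the lineality space to be the whole hyperplane of the constraint i0; so every
tight constraint is a multiple of this one, and with the right sign, because the points of the sequence
satisfy it.\<close>

lemma plane_lineality_contradiction:
  assumes n: "CARD('n) \<le> 3" and i0: "i0 < m" "a i0 \<bullet> d = 0" "filterlim (\<lambda>j. a i0 \<bullet> x j) at_bot sequentially"
    and dim2: "dim (lineal a m d) \<ge> 2"
  shows False
proof -
  define S where "S = lineal a m d"
  have S: "subspace S" unfolding S_def by (rule subspace_lineal)
  have dS: "d \<in> S" unfolding S_def by (rule lineal_self)
  have "\<forall>\<^sub>F j in sequentially. a i0 \<bullet> x j < 0" using i0(3) by (simp add: filterlim_at_bot_dense)
  then obtain j0 where j0: "a i0 \<bullet> x j0 < 0" by (auto simp: eventually_sequentially)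
  then have a0: "a i0 \<noteq> 0" by auto
  have sub: "S \<subseteq> {w. a i0 \<bullet> w = 0}" using i0 by (auto simp: S_def lineal_def)
  have dimH: "dim {w. a i0 \<bullet> w = 0} \<le> 2" using dim_hyperplane[OF a0] n by simp
  have dimS: "dim S = 2" using dim_subset[OF sub] dimH dim2 by (simp add: S_def)
  have SH: "S = {w. a i0 \<bullet> w = 0}"
    using S sub dimH dimS by (intro subspace_dim_equal subspace_hyperplane) auto
  have "\<not> S \<subseteq> span {d}"
  proof
    assume "S \<subseteq> span {d}"
    then have "dim S \<le> card {d}" by (intro dim_le_card) auto
    then show False using dimS by simp
  qed
  then obtain w where w: "w \<in> S" "w \<notin> span {d}" by blast
  define w' where "w' = w - (w \<bullet> d) *\<^sub>R d"
  have w'S: "w' \<in> S" using w(1) dS S by (simp add: w'_def subspace_diff subspace_scale)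
  have w'0: "w' \<noteq> 0" using w(2) by (auto simp: w'_def span_singleton)
  have dd: "d \<bullet> d = 1" using norm_d by (simp add: norm_eq_1)
  have w'd: "w' \<bullet> d = 0" by (simp add: w'_def inner_diff_left dd)
  define u where "u = w' /\<^sub>R norm w'"
  have u: "norm u = 1" "u \<bullet> d = 0" "u \<in> S"
    using w'0 w'd w'S S by (simp_all add: u_def subspace_scale)
  have uu: "u \<bullet> u = 1" using u(1) by (simp add: norm_eq_1)
  have du: "d \<noteq> u" using u(2) dd by auto
  have "independent {d, u}"
    using u dd uu by (intro pairwise_orthogonal_independent)
      (auto simp: pairwise_def orthogonal_def inner_commute)
  then have "dim (span {d, u}) = 2" using du by (simp add: dim_span dim_eq_card_independent)
  moreover have "span {d, u} \<subseteq> S" using dS u(3) S by (intro span_minimal) auto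
  ultimately have span: "span {d, u} = S" using dimS S by (intro subspace_dim_equal) auto
  have kernel: "w = (w \<bullet> d) *\<^sub>R d + (w \<bullet> u) *\<^sub>R u" if "w \<in> S" for w
  proof -
    have "w \<in> span {d, u}" using that span by simp
    then obtain \<alpha> where "w - \<alpha> *\<^sub>R d \<in> span {u}" unfolding span_insert[of d "{u}"] by blast
    then obtain \<beta> where "w - \<alpha> *\<^sub>R d = \<beta> *\<^sub>R u" by (auto simp: span_singleton)
    then have "w = \<alpha> *\<^sub>R d + \<beta> *\<^sub>R u" by (simp add: algebra_simps)
    then show ?thesis using dd uu u(2) by (simp add: inner_add_left inner_commute[of d u])
  qed
  interpret half_space_sequence T B L M a m x d "- a i0" u
  proof
    show "w = (w \<bullet> d) *\<^sub>R d + (w \<bullet> u) *\<^sub>R u" if "- a i0 \<bullet> w = 0" for w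
      using that by (intro kernel) (simp add: SH)
    show "w \<in> tangent a m d" if "0 \<le> - a i0 \<bullet> w" for w
      unfolding tangent_def
    proof (intro CollectI allI impI)
      fix i assume i: "i < m" "a i \<bullet> d = 0"
      define \<beta> where "\<beta> = (a i0 \<bullet> w) / (a i0 \<bullet> x j0)"
      have \<beta>: "\<beta> \<ge> 0" using that j0 by (simp add: \<beta>_def divide_nonpos_neg)
      have "w - \<beta> *\<^sub>R x j0 \<in> S" using j0 by (simp add: SH inner_diff_right \<beta>_def)
      then have "a i \<bullet> w = \<beta> * (a i \<bullet> x j0)" using i by (simp add: S_def lineal_def inner_diff_right)
      moreover have "a i \<bullet> x j0 \<le> 0" using x_cone[of j0] i by (simp add: poly_cone_def)
      ultimately show "a i \<bullet> w \<le> 0" using \<beta> by (simp add: mult_nonneg_nonpos)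
    qed
    show "filterlim (\<lambda>j. - a i0 \<bullet> x j) at_top sequentially"
      using i0(3) by (simp add: filterlim_uminus_at_bot)
  qed (use i0 u SH in auto)
  show False by (rule half_space_contradiction)
qed

text \<open>If the lineality space at d is a line, it contains an integer vector, namely any approximant of a multiple of
d. This makes d proportional to an integer vector.\<close>

theorem descending_sequence_contradiction:
  assumes n: "CARD('n) \<le> 3"
    and descent: "\<And>z \<rho>. z \<in> integer_points \<Longrightarrow> \<rho> > 0 \<Longrightarrow> z = \<rho> *\<^sub>R d \<Longrightarrow>
      \<forall>\<^sub>F j in sequentially. cubic (x j) < cubic (x j - z)"
  shows False
proof (cases "\<forall>i<m. a i \<bullet> d = 0 \<longrightarrow> (\<forall>j. a i \<bullet> x j = 0)")
  case True
  then show False by (intro lineal_contradiction) (auto simp: lineal_def)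
next
  case False
  then obtain i0 where i0: "i0 < m" "a i0 \<bullet> d = 0" "filterlim (\<lambda>j. a i0 \<bullet> x j) at_bot sequentially"
    using constraint_x by blast
  show False
  proof (cases "dim (lineal a m d) \<ge> 2")
    case True
    then show False using plane_lineality_contradiction[OF n i0] by blast
  next
    case small: False
    have d0: "d \<noteq> 0" using norm_d by auto
    have S: "span {d} = lineal a m d"
    proof (rule subspace_dim_equal)
      show "span {d} \<subseteq> lineal a m d" by (intro span_minimal subspace_lineal) (simp add: lineal_self)
      have "dim (span {d}) = 1" using d0 by (simp add: dim_span dim_singleton)
      then show "dim (lineal a m d) \<le> dim (span {d})" using small by simp
    qed (auto intro: subspace_lineal)
    obtain t \<delta> where t: "t \<ge> 1" "norm \<delta> \<le> 1 / 2" "\<delta> \<in> lineal a m d" "t *\<^sub>R d + \<delta> \<in> integer_points"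
      by (rule integer_point_near_cone_ray[OF a_int d_cone, where \<eta> = "1 / 2" and R = 1]) auto
    obtain \<beta> where \<beta>: "\<delta> = \<beta> *\<^sub>R d" using t(3) unfolding S[symmetric] by (auto simp: span_singleton)
    have "\<bar>\<beta>\<bar> \<le> 1 / 2" using t(2) norm_d by (simp add: \<beta>)
    then have \<rho>: "t + \<beta> > 0" using t(1) by linarith
    have z: "t *\<^sub>R d + \<delta> = (t + \<beta>) *\<^sub>R d" by (simp add: \<beta> scaleR_add_left)
    show False
      by (rule integral_direction_contradiction[OF z \<rho> descent[OF t(4) \<rho> z]])
  qed
qed

end

section \<open>From polyhedra to cones\<close>

lemma rational_vector_common_denominator:
  fixes v :: "real ^ 'n"
  assumes "\<And>j. v $ j \<in> \<rat>"
  obtains q :: nat where "q > 0" "real q *\<^sub>R v \<in> integer_points"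
proof -
  have "\<exists>n::nat. n > 0 \<and> real n * v $ j \<in> \<int>" for j
  proof -
    obtain i :: int and n :: nat where "n \<noteq> 0" "v $ j = of_int i / of_nat n"
      using assms[of j] by (auto simp: Rats_eq_int_div_nat)
    then show ?thesis by (intro exI[of _ n]) simp
  qed
  then obtain n :: "'n \<Rightarrow> nat" where n: "\<And>j. n j > 0" "\<And>j. real (n j) * v $ j \<in> \<int>" by metis
  define q where "q = (\<Prod>j\<in>UNIV. n j)"
  have "real q * v $ j \<in> \<int>" for j
  proof -
    have "real q * v $ j = real (\<Prod>i\<in>UNIV - {j}. n i) * (real (n j) * v $ j)"
      by (simp add: q_def prod.remove[of UNIV j])
    then show ?thesis using n(2)[of j] by (metis Ints_mult Ints_of_nat)
  qed
  moreover have "q > 0" using n(1) by (simp add: q_def prod_pos)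
  ultimately show thesis using that by (simp add: integer_points_def)
qed

text \<open>Integer normals make the slacks of integer points discrete; the right-hand sides may be arbitrary reals.\<close>

lemma rational_polyhedron_integer_normals:
  fixes P :: "(real ^ 'n) set"
  assumes "rational_polyhedron P"
  shows "\<exists>(m :: nat) a b. (\<forall>i<m. a i \<in> integer_points) \<and> P = {x. \<forall>i<m. a i \<bullet> x \<le> b i}"
proof -
  obtain m and A :: "nat \<Rightarrow> real ^ 'n" and b where A: "\<And>i j. i < m \<Longrightarrow> A i $ j \<in> \<rat>"
    and P: "P = {x. \<forall>i<m. (\<Sum>j\<in>UNIV. A i $ j * x $ j) \<le> b i}"
    using assms unfolding rational_polyhedron_def by blast
  have "\<forall>i. \<exists>q::nat. i < m \<longrightarrow> q > 0 \<and> real q *\<^sub>R A i \<in> integer_points"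
    using rational_vector_common_denominator A by metis
  then obtain q :: "nat \<Rightarrow> nat" where q: "\<And>i. i < m \<Longrightarrow> q i > 0 \<and> real (q i) *\<^sub>R A i \<in> integer_points"
    by metis
  have "(real (q i) *\<^sub>R A i) \<bullet> x \<le> real (q i) * b i \<longleftrightarrow> (\<Sum>j\<in>UNIV. A i $ j * x $ j) \<le> b i" if "i < m" for i x
    using q[OF that] by (simp add: inner_vec_def mult.assoc sum_distrib_left[symmetric])
  then have "P = {x. \<forall>i<m. (real (q i) *\<^sub>R A i) \<bullet> x \<le> real (q i) * b i}" unfolding P by auto
  then show ?thesis
    using q by (intro exI[of _ m] exI[of _ "\<lambda>i. real (q i) *\<^sub>R A i"] exI[of _ "\<lambda>i. real (q i) * b i"]) blast
qed

lemma descending_ray_of_recession_cone: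
  fixes P :: "(real ^ 'n) set" and a :: "nat \<Rightarrow> real ^ 'n" and m :: nat
  assumes x0: "x0 \<in> P" "x0 \<in> integer_points" and P: "P = {x. \<forall>i<m. a i \<bullet> x \<le> b i}"
    and f: "\<And>y. f (x0 + y) = g y + k"
    and "has_descending_ray g (poly_cone a m)"
  shows "has_descending_ray f P"
proof -
  obtain y d where d: "d \<noteq> 0" and sub: "ray y d \<subseteq> poly_cone a m"
    and unb: "\<And>\<epsilon>. \<epsilon> > 0 \<Longrightarrow> unbounded_below_on g (poly_cone a m \<inter> integer_points \<inter> (ray y d + cball 0 \<epsilon>))"
    using assms(5) unfolding has_descending_ray_def by blast
  have shift: "x0 + w \<in> P" if "w \<in> poly_cone a m" for w
    unfolding P
  proof (intro CollectI allI impI)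
    fix i assume i: "i < m"
    then have "a i \<bullet> x0 \<le> b i" "a i \<bullet> w \<le> 0" using x0(1) that by (auto simp: P poly_cone_def)
    then show "a i \<bullet> (x0 + w) \<le> b i" by (simp add: inner_add_right)
  qed
  have ray_shift: "ray (x0 + y) d = (+) x0 ` ray y d"
    by (auto simp: ray_def image_iff add.assoc)
  show ?thesis unfolding has_descending_ray_def
  proof (rule exI[of _ "x0 + y"], rule exI[of _ d], intro conjI d allI impI)
    show "ray (x0 + y) d \<subseteq> P" unfolding ray_shift using sub shift by auto
    fix \<epsilon> :: real assume "\<epsilon> > 0"
    show "unbounded_below_on f (P \<inter> integer_points \<inter> (ray (x0 + y) d + cball 0 \<epsilon>))"
      unfolding unbounded_below_on_def
    proof
      fix c
      obtain w where w: "w \<in> poly_cone a m" "w \<in> integer_points" "w \<in> ray y d + cball 0 \<epsilon>" "g w < c - k"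
        using unb[OF \<open>\<epsilon> > 0\<close>] unfolding unbounded_below_on_def by blast
      obtain p e where pe: "w = p + e" "p \<in> ray y d" "e \<in> cball 0 \<epsilon>" using w(3) by (metis set_plus_elim)
      have "(x0 + p) + e \<in> ray (x0 + y) d + cball 0 \<epsilon>"
        unfolding ray_shift using pe by (intro set_plus_intro imageI)
      then have "x0 + w \<in> ray (x0 + y) d + cball 0 \<epsilon>" using pe(1) by (simp add: add.assoc)
      then show "\<exists>x\<in>P \<inter> integer_points \<inter> (ray (x0 + y) d + cball 0 \<epsilon>). f x < c"
        using w shift[OF w(1)] integer_points_add[OF x0(2) w(2)] f[of w]
        by (intro bexI[of _ "x0 + w"]) auto
    qed
  qed
qed

text \<open>The reduction described at the beginning. Minimality of the norms is needed for \<open>descent\<close>: if z is a positive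
multiple of d, then far out x - z is still a point of P, and it is shorter than x, so f is larger
there.\<close>

lemma descending_ray_exists:
  fixes P :: "(real ^ 'n) set" and a :: "nat \<Rightarrow> real ^ 'n" and m :: nat
  assumes n: "CARD('n) \<le> 3" and f: "cubic_polynomial f"
    and a: "\<And>i. i < m \<Longrightarrow> a i \<in> integer_points" and P: "P = {x. \<forall>i<m. a i \<bullet> x \<le> b i}"
    and unb: "unbounded_below_on f (P \<inter> integer_points)"
  shows "has_descending_ray f P"
proof (rule ccontr)
  assume no_ray: "\<not> has_descending_ray f P"
  \<comment> \<open>A natural-valued substitute for the norm, so that a minimum exists.\<close>
  define \<mu> where "\<mu> x = nat \<lfloor>(norm x)\<^sup>2\<rfloor>" for x :: "real ^ 'n"
  have "\<exists>x. (x \<in> P \<inter> integer_points \<and> f x \<le> - real j) \<and>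
    (\<forall>y. y \<in> P \<inter> integer_points \<and> f y \<le> - real j \<longrightarrow> \<mu> x \<le> \<mu> y)" for j
  proof -
    obtain x where "x \<in> P \<inter> integer_points" "f x < - real j" using unb unfolding unbounded_below_on_def by blast
    then show ?thesis
      using ex_has_least_nat[of "\<lambda>x. x \<in> P \<inter> integer_points \<and> f x \<le> - real j" x \<mu>] by auto
  qed
  then obtain X where X: "\<And>j. X j \<in> P" "\<And>j. X j \<in> integer_points" "\<And>j. f (X j) \<le> - real j"
    and X_min: "\<And>j y. y \<in> P \<Longrightarrow> y \<in> integer_points \<Longrightarrow> f y \<le> - real j \<Longrightarrow> \<mu> (X j) \<le> \<mu> y"
    by (metis IntI Int_iff)
  define slk where "slk i x = nat (\<lfloor>b i\<rfloor> - \<lfloor>a i \<bullet> x\<rfloor>)" for i and x :: "real ^ 'n"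
  have "finite (slk ` {..<m})" by simp
  from common_steady_subsequence[OF this, of X] obtain r1 where r1: "strict_mono r1"
    and "\<forall>\<phi>\<in>slk ` {..<m}. steady (\<lambda>j. \<phi> (X (r1 j)))" by blast
  then have slk_steady: "\<And>i. i < m \<Longrightarrow> steady (\<lambda>j. slk i (X (r1 j)))" by simp
  define x0 where "x0 = X (r1 0)"
  have x0: "x0 \<in> P" "x0 \<in> integer_points" using X by (auto simp: x0_def)
  define y where "y j = X (r1 j) - x0" for j
  have slk: "a i \<bullet> y j = real (slk i (X (r1 0))) - real (slk i (X (r1 j)))" if i: "i < m" for i j
  proof -
    have *: "a i \<bullet> x = of_int \<lfloor>b i\<rfloor> - real (slk i x)" if xP: "x \<in> P" "x \<in> integer_points" for x
    proof -
      obtain k where k: "a i \<bullet> x = of_int k" using integer_points_inner[OF a[OF i] xP(2)] by (rule Ints_cases)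
      have "of_int k \<le> b i" using xP(1) i k by (auto simp: P)
      then have "k \<le> \<lfloor>b i\<rfloor>" by (simp add: le_floor_iff)
      then show ?thesis unfolding slk_def k by simp
    qed
    show ?thesis using *[OF X(1,2), of "r1 0"] *[OF X(1,2), of "r1 j"]
      by (simp add: y_def x0_def inner_diff_right)
  qed
  have y_cone: "y j \<in> poly_cone a m" for j
    unfolding poly_cone_def
  proof (intro CollectI allI impI)
    fix i assume i: "i < m"
    have "slk i (X (r1 0)) \<le> slk i (X (r1 j))" using slk_steady[OF i] by (auto simp: steady_def incseq_def)
    then show "a i \<bullet> y j \<le> 0" using slk[OF i, of j] by simp
  qed
  have y_int: "y j \<in> integer_points" for j
    unfolding y_def x0_def by (intro integer_points_diff X)
  have y_constraint: "(\<forall>j. a i \<bullet> y j = 0) \<or> filterlim (\<lambda>j. a i \<bullet> y j) at_bot sequentially" if i: "i < m" for i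
    using slk_steady[OF i] unfolding steady_def
  proof (elim conjE disjE)
    assume const: "\<forall>j. slk i (X (r1 j)) = slk i (X (r1 0))"
    have "a i \<bullet> y j = 0" for j unfolding slk[OF i] spec[OF const, of j] by simp
    then show ?thesis by blast
  next
    assume "filterlim (\<lambda>j. slk i (X (r1 j))) at_top sequentially"
    then have "filterlim (\<lambda>j. real (slk i (X (r1 j)))) at_top sequentially"
      by (rule filterlim_compose[OF filterlim_real_sequentially])
    then have "filterlim (\<lambda>j. - real (slk i (X (r1 0))) + real (slk i (X (r1 j)))) at_top sequentially"
      by (rule filterlim_tendsto_add_at_top[OF tendsto_const])
    then have "filterlim (\<lambda>j. - (- real (slk i (X (r1 0))) + real (slk i (X (r1 j))))) at_bot sequentially"
      by (simp only: filterlim_uminus_at_top)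
    then have "filterlim (\<lambda>j. a i \<bullet> y j) at_bot sequentially" using slk[OF i] by simp
    then show ?thesis ..
  qed
  obtain T B L M k where form: "cubic_form T B L M"
    and f_shift: "\<And>y. f (x0 + y) = cubic_form.cubic T B L y + k"
    using cubic_polynomial_translate[OF f, of x0] unfolding cubic_polynomial_def by blast
  interpret cubic_form T B L M by fact
  interpret rayless_cubic T B L M a m
  proof
    show "\<not> has_descending_ray cubic (poly_cone a m)"
      using descending_ray_of_recession_cone[of x0 P m a b f cubic k, OF x0 P f_shift] no_ray by blast
  qed (rule a)
  have cubic_y: "filterlim (\<lambda>j. cubic (y j)) at_bot sequentially"
    unfolding filterlim_at_bot
  proof
    fix c :: real
    obtain N :: nat where N: "- (c + k) \<le> real N" using real_arch_simple by blast
    show "\<forall>\<^sub>F j in sequentially. cubic (y j) \<le> c"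
      using eventually_ge_at_top[of N]
    proof eventually_elim
      case (elim j)
      have "j \<le> r1 j" by (rule seq_suble[OF r1])
      then have "real N \<le> real (r1 j)" using elim by simp
      then show ?case using X(3)[of "r1 j"] f_shift[of "y j"] N by (simp add: y_def)
    qed
  qed
  have norm_y: "filterlim (\<lambda>j. norm (y j)) at_top sequentially"
    unfolding filterlim_at_top
  proof
    fix c :: real
    define R where "R = max c 0"
    have "\<forall>\<^sub>F j in sequentially. cubic (y j) < - (M * R ^ 3 + M * R\<^sup>2 + M * R)"
      using cubic_y by (simp add: filterlim_at_bot_dense)
    then show "\<forall>\<^sub>F j in sequentially. c \<le> norm (y j)"
    proof eventually_elim
      case (elim j)
      show ?case
      proof (rule ccontr)
        assume "\<not> c \<le> norm (y j)"
        then have "\<bar>cubic (y j)\<bar> \<le> M * R ^ 3 + M * R\<^sup>2 + M * R"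
          by (intro cubic_bound) (auto simp: R_def)
        then show False using elim by linarith
      qed
    qed
  qed
  have "y j /\<^sub>R norm (y j) \<in> cball 0 1" for j by (cases "y j = 0") auto
  then have "\<exists>d\<in>cball 0 1. \<exists>r. strict_mono r \<and> ((\<lambda>j. y j /\<^sub>R norm (y j)) \<circ> r) \<longlonglongrightarrow> d"
    using compact_cball[of "0 :: real ^ 'n" 1] by (simp add: compact_def)
  then obtain d r2 where r2: "strict_mono r2" "((\<lambda>j. y j /\<^sub>R norm (y j)) \<circ> r2) \<longlonglongrightarrow> d"
    by blast
  interpret rayless_sequence T B L M a m "\<lambda>j. y (r2 j)" d
  proof
    show "(\<lambda>j. y (r2 j) /\<^sub>R norm (y (r2 j))) \<longlonglongrightarrow> d" using r2(2) by (simp add: o_def)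
    show "filterlim (\<lambda>j. norm (y (r2 j))) at_top sequentially"
      by (rule filterlim_compose[OF norm_y filterlim_subseq[OF r2(1)]])
    show "filterlim (\<lambda>j. cubic (y (r2 j))) at_bot sequentially"
      by (rule filterlim_compose[OF cubic_y filterlim_subseq[OF r2(1)]])
    show "(\<forall>j. a i \<bullet> y (r2 j) = 0) \<or> filterlim (\<lambda>j. a i \<bullet> y (r2 j)) at_bot sequentially" if "i < m" for i
      using y_constraint[OF that] filterlim_compose[OF _ filterlim_subseq[OF r2(1)]] by blast
  qed (rule y_cone y_int)+
  show False
  proof (rule descending_sequence_contradiction[OF n])
    fix z \<rho> assume z: "z \<in> integer_points" "\<rho> > 0" "z = \<rho> *\<^sub>R d"
    have constraints: "\<forall>\<^sub>F j in sequentially. \<forall>i\<in>{..<m}. a i \<bullet> (x0 + y (r2 j) - z) \<le> b i"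
    proof (intro eventually_ball_finite ballI)
      fix i assume "i \<in> {..<m}"
      then have i: "i < m" by simp
      show "\<forall>\<^sub>F j in sequentially. a i \<bullet> (x0 + y (r2 j) - z) \<le> b i"
        using constraint_x[OF i]
      proof
        assume zero: "\<forall>j. a i \<bullet> y (r2 j) = 0"
        have "(\<lambda>j. a i \<bullet> (y (r2 j) /\<^sub>R norm (y (r2 j)))) \<longlonglongrightarrow> a i \<bullet> d" by (intro tendsto_intros dir)
        then have "a i \<bullet> d = 0" using zero by (simp add: LIMSEQ_const_iff)
        then show ?thesis using zero x0(1) i by (auto simp: z(3) inner_diff_right inner_add_right P)
      next
        assume "filterlim (\<lambda>j. a i \<bullet> y (r2 j)) at_bot sequentially"
        then have "\<forall>\<^sub>F j in sequentially. a i \<bullet> y (r2 j) \<le> b i - a i \<bullet> x0 + a i \<bullet> z"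
          by (simp add: filterlim_at_bot)
        then show ?thesis by eventually_elim (simp add: inner_diff_right inner_add_right)
      qed
    qed simp
    have half: "(1/2::real) > 0" by simp
    define c where "c = (2 * ((norm z)\<^sup>2 + 1 + 2 * \<bar>x0 \<bullet> z\<bar>)) / \<rho>"
    show "\<forall>\<^sub>F j in sequentially. cubic (y (r2 j)) < cubic (y (r2 j) - z)"
      using constraints x_near_dir[OF half] eventually_norm_ge[of c]
    proof eventually_elim
      case (elim j)
      define W where "W = x0 + y (r2 j)"
      define N where "N = norm (y (r2 j))"
      define l where "l = r1 (r2 j)"
      have W: "W = X l" by (simp add: W_def y_def l_def)
      have dd: "d \<bullet> d = 1" using norm_d by (simp add: norm_eq_1)
      have "y (r2 j) \<bullet> d \<ge> N / 2"
      proof -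
        have "\<bar>(y (r2 j) - N *\<^sub>R d) \<bullet> d\<bar> \<le> norm (y (r2 j) - N *\<^sub>R d) * norm d" by (rule Cauchy_Schwarz_ineq2)
        also have "\<dots> \<le> 1 / 2 * N" using elim(2) norm_d by (simp add: N_def)
        finally have "\<bar>y (r2 j) \<bullet> d - N\<bar> \<le> N / 2" by (simp add: inner_diff_left dd)
        then show ?thesis by linarith
      qed
      then have "\<rho> * (y (r2 j) \<bullet> d) \<ge> \<rho> * (N / 2)" using z(2) by (intro mult_left_mono) auto
      moreover have "\<rho> * N \<ge> 2 * ((norm z)\<^sup>2 + 1 + 2 * \<bar>x0 \<bullet> z\<bar>)"
        using elim(3) z(2) by (simp add: c_def N_def field_simps)
      ultimately have "y (r2 j) \<bullet> z \<ge> (norm z)\<^sup>2 + 1 + 2 * \<bar>x0 \<bullet> z\<bar>"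
        by (simp add: z(3))
      then have Wz: "2 * (W \<bullet> z) \<ge> (norm z)\<^sup>2 + 1"
        using zero_le_power2[of "norm z"] abs_ge_minus_self[of "x0 \<bullet> z"] abs_ge_zero[of "x0 \<bullet> z"]
        unfolding W_def inner_add_left by argo
      have "(norm (W - z))\<^sup>2 = (norm W)\<^sup>2 - 2 * (W \<bullet> z) + (norm z)\<^sup>2"
        by (simp add: power2_norm_eq_inner inner_diff_left inner_diff_right inner_commute)
      then have lt: "(norm (W - z))\<^sup>2 \<le> (norm W)\<^sup>2 - 1" using Wz by linarith
      have "\<mu> (W - z) < \<mu> W"
      proof -
        have "0 \<le> (norm (W - z))\<^sup>2" by simp
        then have "\<lfloor>(norm (W - z))\<^sup>2\<rfloor> < \<lfloor>(norm W)\<^sup>2\<rfloor>" "0 \<le> \<lfloor>(norm (W - z))\<^sup>2\<rfloor>" using lt by linarith+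
        then show ?thesis unfolding \<mu>_def by linarith
      qed
      moreover have "W - z \<in> P" using elim(1) by (auto simp: P W_def)
      moreover have "W - z \<in> integer_points" unfolding W by (intro integer_points_diff X z(1))
      ultimately have "f (W - z) > - real l" using X_min[of "W - z" l] by (force simp: W)
      moreover have "f W \<le> - real l" unfolding W by (rule X)
      ultimately show ?case
        using f_shift[of "y (r2 j)"] f_shift[of "y (r2 j) - z"] by (simp add: W_def add_diff_eq)
    qed
  qed
qed

theorem theorem2:
  fixes P :: "(real ^ 'n) set" and f :: "real ^ 'n \<Rightarrow> real"
  assumes "CARD('n) \<le> 3"
    and "rational_polyhedron P"
    and "cubic_function f"
  shows "unbounded_below_on f (P \<inter> integer_points) \<longleftrightarrow>
    (\<exists>y d. d \<noteq> 0 \<and> ray y d \<subseteq> P \<and>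
      (\<forall>\<epsilon>>0. unbounded_below_on f (P \<inter> integer_points \<inter> (ray y d + cball 0 \<epsilon>))))"
proof
  assume unb: "unbounded_below_on f (P \<inter> integer_points)"
  obtain p where "total_degree p = 3" "f = eval_mpoly p"
    using assms(3) unfolding cubic_function_def by blast
  then have f: "cubic_polynomial f" using cubic_polynomial_eval_mpoly[of p] by simp
  obtain m :: nat and a b where "\<forall>i<m. a i \<in> integer_points" and P: "P = {x. \<forall>i<m. a i \<bullet> x \<le> b i}"
    using rational_polyhedron_integer_normals[OF assms(2)] by (elim exE conjE)
  then have "\<And>i. i < m \<Longrightarrow> a i \<in> integer_points" by blast
  from descending_ray_exists[OF assms(1) f this P unb]
  show "\<exists>y d. d \<noteq> 0 \<and> ray y d \<subseteq> P \<and>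
      (\<forall>\<epsilon>>0. unbounded_below_on f (P \<inter> integer_points \<inter> (ray y d + cball 0 \<epsilon>)))"
    unfolding has_descending_ray_def .
next
  assume "\<exists>y d. d \<noteq> 0 \<and> ray y d \<subseteq> P \<and>
      (\<forall>\<epsilon>>0. unbounded_below_on f (P \<inter> integer_points \<inter> (ray y d + cball 0 \<epsilon>)))"
  then obtain y d where "\<forall>\<epsilon>>0. unbounded_below_on f (P \<inter> integer_points \<inter> (ray y d + cball 0 \<epsilon>))"
    by (elim exE conjE)
  then have "unbounded_below_on f (P \<inter> integer_points \<inter> (ray y d + cball 0 1))" by simp
  then show "unbounded_below_on f (P \<inter> integer_points)" unfolding unbounded_below_on_def by blast
qed

end
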